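(* Let $H$ be a finite-dimensional Hopf algebra over a field $k$ and let $K$ be a normal Hopf subalgebra of $H$. Then the ring extension $H\,|\,K$ is an $\overline{H}$-Galois extension (with respect to the natural coaction $H\to H\otimes_k\overline{H}$, $a\mapsto a_{(1)}\otimes\overline{a_{(2)}}$), where $\overline{H}=H/HK^+$, and therefore $H\,|\,K$ is a depth two extension.
   Context: Let $S$ be the antipode, $\varepsilon$ the counit, and $\Delta(a)=a_{(1)}\otimes a_{(2)}$ the comultiplication of $H$. A Hopf subalgebra $K\subseteq H$ is normal if $S(a_{(1)})xa_{(2)}\in K$ and $a_{(1)}xS(a_{(2)})\in K$ for all $a\in H$, $x\in K$. Put $K^+=\ker\varepsilon\cap K$. For normal $K$, $HK^+=K^+H$ is a Hopf ideal, $\overline{H}=H/HK^+$ is a Hopf algebra, and $a\mapsto\overline{a}$ denotes the canonical surjection $H\to\overline{H}$. For a Hopf algebra $L$ over $k$, an extension of $k$-algebras $A\,|\,B$ is $L$-Galois if $A$ is a right $L$-comodule algebra with coaction $a\mapsto a_{(0)}\otimes a_{(1)}\in A\otimes_k L$, $B$ is the subalgebra of coinvariants $\{a\in A: a_{(0)}\otimes a_{(1)}=a\otimes 1\}$, and the Galois map $\beta:A\otimes_B A\to A\otimes_k L$, $\beta(x\otimes y)=xy_{(0)}\otimes y_{(1)}$, is bijective. $M\oplus *\cong N$ means that $M$ is isomorphic to a direct summand of $N$. A ring extension $A\,|\,B$ is depth two if there is a positive integer $n$ such that $A\otimes_B A\oplus *\cong A^n$ holds as natural $B$-$A$-bimodules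 and also as natural $A$-$B$-bimodules. *)

theory Defs
  imports "HOL-Algebra.Algebra"
begin

section \<open>Tensor products\<close>

text \<open>
  \<open>M \<otimes>\<^sub>C N\<close>, for a right \<open>C\<close>-module \<open>M\<close> with action \<open>ra\<close> and a left \<open>C\<close>-module \<open>N\<close> with
  action \<open>la\<close> (\<open>C\<close> is given by its carrier set), is the free abelian group on
  \<open>carrier M \<times> carrier N\<close> modulo the subgroup generated by the usual relators.
  So an element of the tensor product is a coset, i.e. a set of formal sums.
\<close>

type_synonym ('m, 'n) tens = "(('m \<times> 'n) \<Rightarrow>\<^sub>0 int) set"

definition balanced_relators ::
  "'r set \<Rightarrow> ('m, 'x) ring_scheme \<Rightarrow> ('m \<Rightarrow> 'r \<Rightarrow> 'm) \<Rightarrow> ('n, 'y) ring_scheme \<Rightarrow> ('r \<Rightarrow> 'n \<Rightarrow> 'n)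
    \<Rightarrow> ('m, 'n) tens"
where
  "balanced_relators C M ra N la =
     {frag_of (x \<oplus>\<^bsub>M\<^esub> x', y) - frag_of (x, y) - frag_of (x', y) | x x' y.
        x \<in> carrier M \<and> x' \<in> carrier M \<and> y \<in> carrier N}
   \<union> {frag_of (x, y \<oplus>\<^bsub>N\<^esub> y') - frag_of (x, y) - frag_of (x, y') | x y y'.
        x \<in> carrier M \<and> y \<in> carrier N \<and> y' \<in> carrier N}
   \<union> {frag_of (ra x c, y) - frag_of (x, la c y) | x c y.
        x \<in> carrier M \<and> c \<in> C \<and> y \<in> carrier N}"

definition balanced_subgroup ::
  "'r set \<Rightarrow> ('m, 'x) ring_scheme \<Rightarrow> ('m \<Rightarrow> 'r \<Rightarrow> 'm) \<Rightarrow> ('n, 'y) ring_scheme \<Rightarrow> ('r \<Rightarrow> 'n \<Rightarrow> 'n)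
    \<Rightarrow> ('m, 'n) tens"
where
  "balanced_subgroup C M ra N la =
     generate (free_Abelian_group (carrier M \<times> carrier N)) (balanced_relators C M ra N la)"

definition balanced_group ::
  "'r set \<Rightarrow> ('m, 'x) ring_scheme \<Rightarrow> ('m \<Rightarrow> 'r \<Rightarrow> 'm) \<Rightarrow> ('n, 'y) ring_scheme \<Rightarrow> ('r \<Rightarrow> 'n \<Rightarrow> 'n)
    \<Rightarrow> ('m, 'n) tens monoid"
where
  "balanced_group C M ra N la =
     free_Abelian_group (carrier M \<times> carrier N) Mod balanced_subgroup C M ra N la"

text \<open>The multiplicative fields of this record carry no meaning; only the additive group does.\<close>

definition balanced_tensor ::
  "'r set \<Rightarrow> ('m, 'x) ring_scheme \<Rightarrow> ('m \<Rightarrow> 'r \<Rightarrow> 'm) \<Rightarrow> ('n, 'y) ring_scheme \<Rightarrow> ('r \<Rightarrow> 'n \<Rightarrow> 'n)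
    \<Rightarrow> ('m, 'n) tens ring"
where
  "balanced_tensor C M ra N la =
     \<lparr>carrier = carrier (balanced_group C M ra N la),
      monoid.mult = undefined, one = undefined,
      ring.zero = \<one>\<^bsub>balanced_group C M ra N la\<^esub>,
      add = monoid.mult (balanced_group C M ra N la)\<rparr>"

definition pure_tensor ::
  "'r set \<Rightarrow> ('m, 'x) ring_scheme \<Rightarrow> ('m \<Rightarrow> 'r \<Rightarrow> 'm) \<Rightarrow> ('n, 'y) ring_scheme \<Rightarrow> ('r \<Rightarrow> 'n \<Rightarrow> 'n)
    \<Rightarrow> 'm \<Rightarrow> 'n \<Rightarrow> ('m, 'n) tens"
where
  "pure_tensor C M ra N la x y =
     balanced_subgroup C M ra N la
       #>\<^bsub>free_Abelian_group (carrier M \<times> carrier N)\<^esub> frag_of (x, y)"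

text \<open>
  The additive map to \<open>P\<close> sending \<open>\<Sum>\<^sub>i x\<^sub>i \<otimes> y\<^sub>i\<close> to \<open>\<Sum>\<^sub>i \<phi> x\<^sub>i y\<^sub>i\<close>. For balanced \<open>\<phi>\<close> the
  value does not depend on the representing formal sum, so the image of a coset is a singleton.
  In Sweedler notation, \<open>tensor_lift P \<phi> (\<Delta> a)\<close> is \<open>\<phi> a\<^sub>1 a\<^sub>2\<close>.
\<close>

definition tensor_lift ::
  "('p, 'z) ring_scheme \<Rightarrow> ('m \<Rightarrow> 'n \<Rightarrow> 'p) \<Rightarrow> ('m, 'n) tens \<Rightarrow> 'p"
where
  "tensor_lift P \<phi> t =
     the_elem ((\<lambda>z. \<Oplus>\<^bsub>P\<^esub>p\<in>Poly_Mapping.keys z.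
                  [Poly_Mapping.lookup z p] \<cdot>\<^bsub>P\<^esub> \<phi> (fst p) (snd p)) ` t)"


section \<open>Algebras over a field and their tensor products\<close>

definition linear_map ::
  "('k, 'x) ring_scheme \<Rightarrow> ('k, 'm, 'y) module_scheme \<Rightarrow> ('k, 'n, 'z) module_scheme
    \<Rightarrow> ('m \<Rightarrow> 'n) set"
where
  "linear_map k M N =
     {f. f \<in> hom (add_monoid M) (add_monoid N) \<and>
         (\<forall>c\<in>carrier k. \<forall>x\<in>carrier M. f (c \<odot>\<^bsub>M\<^esub> x) = c \<odot>\<^bsub>N\<^esub> f x)}"

text \<open>Extensionality of the coefficient family \<open>c\<close> is what makes it unique as a function.\<close>

definition finite_basis ::
  "('k, 'x) ring_scheme \<Rightarrow> ('k, 'm, 'y) module_scheme \<Rightarrow> 'm set \<Rightarrow> bool"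
where
  "finite_basis k M B \<longleftrightarrow>
     finite B \<and> B \<subseteq> carrier M \<and>
     (\<forall>v\<in>carrier M. \<exists>!c. c \<in> B \<rightarrow>\<^sub>E carrier k \<and> v = (\<Oplus>\<^bsub>M\<^esub>b\<in>B. c b \<odot>\<^bsub>M\<^esub> b))"

definition finite_dimensional ::
  "('k, 'x) ring_scheme \<Rightarrow> ('k, 'm, 'y) module_scheme \<Rightarrow> bool"
where
  "finite_dimensional k M \<longleftrightarrow> (\<exists>B. finite_basis k M B)"

text \<open>The library locale \<open>algebra\<close> is about commutative algebras only.\<close>

locale k_algebra = K?: field k + module k A + A?: ring A
  for k (structure) and A (structure) +
  assumes smult_mult_left:
      "\<lbrakk>c \<in> carrier k; x \<in> carrier A; y \<in> carrier A\<rbrakk>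
        \<Longrightarrow> (c \<odot>\<^bsub>A\<^esub> x) \<otimes>\<^bsub>A\<^esub> y = c \<odot>\<^bsub>A\<^esub> (x \<otimes>\<^bsub>A\<^esub> y)"
    and smult_mult_right:
      "\<lbrakk>c \<in> carrier k; x \<in> carrier A; y \<in> carrier A\<rbrakk>
        \<Longrightarrow> x \<otimes>\<^bsub>A\<^esub> (c \<odot>\<^bsub>A\<^esub> y) = c \<odot>\<^bsub>A\<^esub> (x \<otimes>\<^bsub>A\<^esub> y)"

definition algebra_hom ::
  "('k, 'x) ring_scheme \<Rightarrow> ('k, 'a, 'y) module_scheme \<Rightarrow> ('k, 'b, 'z) module_scheme
    \<Rightarrow> ('a \<Rightarrow> 'b) set"
where
  "algebra_hom k A B = ring_hom A B \<inter> linear_map k A B"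

definition ground_algebra :: "('k, 'x) ring_scheme \<Rightarrow> ('k, 'k) module"
where
  "ground_algebra k =
     \<lparr>carrier = carrier k, monoid.mult = monoid.mult k, one = \<one>\<^bsub>k\<^esub>,
      ring.zero = \<zero>\<^bsub>k\<^esub>, add = add k, smult = monoid.mult k\<rparr>"

definition ptensor ::
  "('k, 'x) ring_scheme \<Rightarrow> ('k, 'm, 'y) module_scheme \<Rightarrow> ('k, 'n, 'z) module_scheme
    \<Rightarrow> 'm \<Rightarrow> 'n \<Rightarrow> ('m, 'n) tens"
where
  "ptensor k M N = pure_tensor (carrier k) M (\<lambda>x c. c \<odot>\<^bsub>M\<^esub> x) N (smult N)"

definition tensor_space ::
  "('k, 'x) ring_scheme \<Rightarrow> ('k, 'm, 'y) module_scheme \<Rightarrow> ('k, 'n, 'z) module_scheme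
    \<Rightarrow> ('m, 'n) tens ring"
where
  "tensor_space k M N = balanced_tensor (carrier k) M (\<lambda>x c. c \<odot>\<^bsub>M\<^esub> x) N (smult N)"

text \<open>
  \<open>M \<otimes>\<^sub>k N\<close>, with the multiplication \<open>(x \<otimes> y) (x' \<otimes> y') = x x' \<otimes> y y'\<close> when \<open>M\<close> and \<open>N\<close> are
  algebras.
\<close>

definition tensor ::
  "('k, 'x) ring_scheme \<Rightarrow> ('k, 'm, 'y) module_scheme \<Rightarrow> ('k, 'n, 'z) module_scheme
    \<Rightarrow> ('k, ('m, 'n) tens) module"
where
  "tensor k M N =
     \<lparr>carrier = carrier (tensor_space k M N),
      monoid.mult = (\<lambda>t u.
        tensor_lift (tensor_space k M N) (\<lambda>x y.
          tensor_lift (tensor_space k M N) (\<lambda>x' y'.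
            ptensor k M N (x \<otimes>\<^bsub>M\<^esub> x') (y \<otimes>\<^bsub>N\<^esub> y')) u) t),
      one = ptensor k M N \<one>\<^bsub>M\<^esub> \<one>\<^bsub>N\<^esub>,
      ring.zero = \<zero>\<^bsub>tensor_space k M N\<^esub>,
      add = add (tensor_space k M N),
      smult = (\<lambda>c. tensor_lift (tensor_space k M N) (\<lambda>x y. ptensor k M N (c \<odot>\<^bsub>M\<^esub> x) y))\<rparr>"

text \<open>\<open>f \<otimes> g\<close>, with values in \<open>M \<otimes>\<^sub>k N\<close>.\<close>

definition tensor_map ::
  "('k, 'x) ring_scheme \<Rightarrow> ('k, 'm, 'y) module_scheme \<Rightarrow> ('k, 'n, 'z) module_scheme
    \<Rightarrow> ('a \<Rightarrow> 'm) \<Rightarrow> ('b \<Rightarrow> 'n) \<Rightarrow> ('a, 'b) tens \<Rightarrow> ('m, 'n) tens"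
where
  "tensor_map k M N f g = tensor_lift (tensor k M N) (\<lambda>x y. ptensor k M N (f x) (g y))"

text \<open>The canonical map \<open>(M \<otimes> N) \<otimes> P \<rightarrow> M \<otimes> (N \<otimes> P)\<close>.\<close>

definition tensor_assoc ::
  "('k, 'x) ring_scheme \<Rightarrow> ('k, 'm, 'y) module_scheme \<Rightarrow> ('k, 'n, 'z) module_scheme
    \<Rightarrow> ('k, 'p, 'w) module_scheme \<Rightarrow> (('m, 'n) tens, 'p) tens \<Rightarrow> ('m, ('n, 'p) tens) tens"
where
  "tensor_assoc k M N P =
     tensor_lift (tensor k M (tensor k N P)) (\<lambda>t z.
       tensor_lift (tensor k M (tensor k N P)) (\<lambda>x y.
         ptensor k M (tensor k N P) x (ptensor k N P y z)) t)"


section \<open>Hopf algebras\<close>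

record ('k, 'h) hopf = "('k, 'h) module" +
  comul :: "'h \<Rightarrow> ('h, 'h) tens"
  counit :: "'h \<Rightarrow> 'k"
  antipode :: "'h \<Rightarrow> 'h"

locale hopf_algebra = k_algebra k H
  for k :: "('k, 'x) ring_scheme" (structure) and H :: "('k, 'h, 'y) hopf_scheme" (structure) +
  assumes comul_hom: "comul H \<in> algebra_hom k H (tensor k H H)"
    and counit_hom: "counit H \<in> algebra_hom k H (ground_algebra k)"
    and coassoc: "h \<in> carrier H \<Longrightarrow>
      tensor_assoc k H H H (tensor_map k (tensor k H H) H (comul H) (\<lambda>x. x) (comul H h)) =
      tensor_map k H (tensor k H H) (\<lambda>x. x) (comul H) (comul H h)"
    and counit_left: "h \<in> carrier H \<Longrightarrow>
      tensor_lift H (\<lambda>x y. counit H x \<odot>\<^bsub>H\<^esub> y) (comul H h) = h"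
    and counit_right: "h \<in> carrier H \<Longrightarrow>
      tensor_lift H (\<lambda>x y. counit H y \<odot>\<^bsub>H\<^esub> x) (comul H h) = h"
    and antipode_linear: "antipode H \<in> linear_map k H H"
    and antipode_left: "h \<in> carrier H \<Longrightarrow>
      tensor_lift H (\<lambda>x y. antipode H x \<otimes>\<^bsub>H\<^esub> y) (comul H h) = counit H h \<odot>\<^bsub>H\<^esub> \<one>\<^bsub>H\<^esub>"
    and antipode_right: "h \<in> carrier H \<Longrightarrow>
      tensor_lift H (\<lambda>x y. x \<otimes>\<^bsub>H\<^esub> antipode H y) (comul H h) = counit H h \<odot>\<^bsub>H\<^esub> \<one>\<^bsub>H\<^esub>"

text \<open>
  The condition \<open>\<Delta>(K) \<subseteq> K \<otimes> K\<close> refers to the image of \<open>K \<otimes>\<^sub>k K\<close> in \<open>H \<otimes>\<^sub>k H\<close> under the map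
  induced by the inclusion.
\<close>

definition hopf_subalgebra ::
  "('k, 'x) ring_scheme \<Rightarrow> ('k, 'h, 'y) hopf_scheme \<Rightarrow> 'h set \<Rightarrow> bool"
where
  "hopf_subalgebra k H K \<longleftrightarrow>
     subring K H \<and> submodule K k H \<and>
     comul H ` K \<subseteq> tensor_map k H H (\<lambda>x. x) (\<lambda>x. x)
                     ` carrier (tensor k (H\<lparr>carrier := K\<rparr>) (H\<lparr>carrier := K\<rparr>)) \<and>
     antipode H ` K \<subseteq> K"

definition normal_hopf_subalgebra ::
  "('k, 'x) ring_scheme \<Rightarrow> ('k, 'h, 'y) hopf_scheme \<Rightarrow> 'h set \<Rightarrow> bool"
where
  "normal_hopf_subalgebra k H K \<longleftrightarrow>
     hopf_subalgebra k H K \<and>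
     (\<forall>a\<in>carrier H. \<forall>x\<in>K.
        tensor_lift H (\<lambda>a1 a2. antipode H a1 \<otimes>\<^bsub>H\<^esub> x \<otimes>\<^bsub>H\<^esub> a2) (comul H a) \<in> K \<and>
        tensor_lift H (\<lambda>a1 a2. a1 \<otimes>\<^bsub>H\<^esub> x \<otimes>\<^bsub>H\<^esub> antipode H a2) (comul H a) \<in> K)"

definition augmentation_part ::
  "('k, 'x) ring_scheme \<Rightarrow> ('k, 'h, 'y) hopf_scheme \<Rightarrow> 'h set \<Rightarrow> 'h set"
where
  "augmentation_part k H K = a_kernel H k (counit H) \<inter> K"

definition quotient_module ::
  "('k, 'h, 'y) module_scheme \<Rightarrow> 'h set \<Rightarrow> ('k, 'h set) module"
where
  "quotient_module H I =
     ring.extend (H Quot I)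
       (module.fields (\<lambda>c U. the_elem ((\<lambda>x. I +>\<^bsub>H\<^esub> (c \<odot>\<^bsub>H\<^esub> x)) ` U)))"

text \<open>
  \<open>H / I\<close> with the operations induced on cosets; these are well defined and form a Hopf algebra
  when \<open>I\<close> is a Hopf ideal.
\<close>

definition hopf_quotient ::
  "('k, 'x) ring_scheme \<Rightarrow> ('k, 'h, 'y) hopf_scheme \<Rightarrow> 'h set \<Rightarrow> ('k, 'h set) hopf"
where
  "hopf_quotient k H I =
     module.extend (quotient_module H I)
       (hopf.fields
          (\<lambda>U. the_elem ((\<lambda>x. tensor_map k (quotient_module H I) (quotient_module H I)
                                (a_r_coset H I) (a_r_coset H I) (comul H x)) ` U))
          (\<lambda>U. the_elem (counit H ` U))
          (\<lambda>U. the_elem ((\<lambda>x. I +>\<^bsub>H\<^esub> antipode H x) ` U)))"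

text \<open>\<open>H / H K\<^sup>+\<close>; \<open>ideal_prod\<close> is the additive span of the products.\<close>

definition quotient_by ::
  "('k, 'x) ring_scheme \<Rightarrow> ('k, 'h, 'y) hopf_scheme \<Rightarrow> 'h set \<Rightarrow> ('k, 'h set) hopf"
where
  "quotient_by k H K =
     hopf_quotient k H (ideal_prod H (carrier H) (augmentation_part k H K))"

text \<open>\<open>a \<mapsto> a\<^sub>1 \<otimes> \<pi>(a\<^sub>2)\<close> with \<open>\<pi>: H \<rightarrow> H / H K\<^sup>+\<close> the canonical surjection.\<close>

definition quotient_coaction ::
  "('k, 'x) ring_scheme \<Rightarrow> ('k, 'h, 'y) hopf_scheme \<Rightarrow> 'h set \<Rightarrow> 'h \<Rightarrow> ('h, 'h set) tens"
where
  "quotient_coaction k H K a =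
     tensor_map k H (quotient_by k H K) (\<lambda>x. x)
       (a_r_coset H (ideal_prod H (carrier H) (augmentation_part k H K))) (comul H a)"


section \<open>Galois extensions\<close>

locale comodule_algebra = L: hopf_algebra k L + A: k_algebra k A
  for k :: "('k, 'x) ring_scheme" (structure) and L :: "('k, 'l, 'y) hopf_scheme" (structure)
    and A :: "('k, 'a, 'z) module_scheme" (structure) and \<delta> :: "'a \<Rightarrow> ('a, 'l) tens" +
  assumes coaction_hom: "\<delta> \<in> algebra_hom k A (tensor k A L)"
    and coaction_coassoc: "a \<in> carrier A \<Longrightarrow>
      tensor_assoc k A L L (tensor_map k (tensor k A L) L \<delta> (\<lambda>l. l) (\<delta> a)) =
      tensor_map k A (tensor k L L) (\<lambda>a. a) (comul L) (\<delta> a)"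
    and coaction_counit: "a \<in> carrier A \<Longrightarrow>
      tensor_lift A (\<lambda>x l. counit L l \<odot>\<^bsub>A\<^esub> x) (\<delta> a) = a"

definition coinvariants ::
  "('k, 'x) ring_scheme \<Rightarrow> ('k, 'l, 'y) hopf_scheme \<Rightarrow> ('k, 'a, 'z) module_scheme
    \<Rightarrow> ('a \<Rightarrow> ('a, 'l) tens) \<Rightarrow> 'a set"
where
  "coinvariants k L A \<delta> = {a \<in> carrier A. \<delta> a = ptensor k A L a \<one>\<^bsub>L\<^esub>}"

text \<open>\<open>A \<otimes>\<^sub>B A\<close> for a ring \<open>A\<close> and a subring \<open>B\<close>.\<close>

definition ring_tensor :: "('a, 'x) ring_scheme \<Rightarrow> 'a set \<Rightarrow> ('a, 'a) tens ring"
where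
  "ring_tensor A B = balanced_tensor B A (monoid.mult A) A (monoid.mult A)"

definition ring_ptensor :: "('a, 'x) ring_scheme \<Rightarrow> 'a set \<Rightarrow> 'a \<Rightarrow> 'a \<Rightarrow> ('a, 'a) tens"
where
  "ring_ptensor A B = pure_tensor B A (monoid.mult A) A (monoid.mult A)"

text \<open>\<open>x \<otimes> y \<mapsto> x y\<^sub>0 \<otimes> y\<^sub>1\<close>\<close>

definition galois_map ::
  "('k, 'x) ring_scheme \<Rightarrow> ('k, 'l, 'y) hopf_scheme \<Rightarrow> ('k, 'a, 'z) module_scheme
    \<Rightarrow> ('a \<Rightarrow> ('a, 'l) tens) \<Rightarrow> ('a, 'a) tens \<Rightarrow> ('a, 'l) tens"
where
  "galois_map k L A \<delta> =
     tensor_lift (tensor k A L) (\<lambda>x y.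
       tensor_lift (tensor k A L) (\<lambda>y0 y1. ptensor k A L (x \<otimes>\<^bsub>A\<^esub> y0) y1) (\<delta> y))"

definition galois_extension ::
  "('k, 'x) ring_scheme \<Rightarrow> ('k, 'l, 'y) hopf_scheme \<Rightarrow> ('k, 'a, 'z) module_scheme
    \<Rightarrow> ('a \<Rightarrow> ('a, 'l) tens) \<Rightarrow> 'a set \<Rightarrow> bool"
where
  "galois_extension k L A \<delta> B \<longleftrightarrow>
     comodule_algebra k L A \<delta> \<and>
     B = coinvariants k L A \<delta> \<and>
     bij_betw (galois_map k L A \<delta>) (carrier (ring_tensor A B)) (carrier (tensor k A L))"


section \<open>Depth two\<close>

text \<open>
  Abelian groups (in the additive fields) with a left action of \<open>'r\<close> and a right action of \<open>'s\<close>.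
  The acting rings are given separately by their carriers \<open>R\<close> and \<open>S\<close>, so that the same record
  serves for the natural \<open>B\<close>-\<open>A\<close>- and \<open>A\<close>-\<open>B\<close>-bimodule structures.
\<close>

record ('r, 's, 'm) bimodule = "'m ring" +
  lact :: "'r \<Rightarrow> 'm \<Rightarrow> 'm"
  ract :: "'m \<Rightarrow> 's \<Rightarrow> 'm"

definition subbimodule ::
  "'r set \<Rightarrow> 's set \<Rightarrow> 'm set \<Rightarrow> ('r, 's, 'm, 'x) bimodule_scheme \<Rightarrow> bool"
where
  "subbimodule R S P M \<longleftrightarrow>
     additive_subgroup P M \<and>
     (\<forall>p\<in>P. (\<forall>r\<in>R. lact M r p \<in> P) \<and> (\<forall>s\<in>S. ract M p s \<in> P))"

definition bimodule_iso ::
  "'r set \<Rightarrow> 's set \<Rightarrow> ('r, 's, 'm, 'x) bimodule_scheme \<Rightarrow> ('r, 's, 'n, 'y) bimodule_scheme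
    \<Rightarrow> ('m \<Rightarrow> 'n) set"
where
  "bimodule_iso R S M N =
     {f. f \<in> iso (add_monoid M) (add_monoid N) \<and>
         (\<forall>x\<in>carrier M. (\<forall>r\<in>R. f (lact M r x) = lact N r (f x)) \<and>
                        (\<forall>s\<in>S. f (ract M x s) = ract N (f x) s))}"

definition direct_summand ::
  "'r set \<Rightarrow> 's set \<Rightarrow> 'm set \<Rightarrow> ('r, 's, 'm, 'x) bimodule_scheme \<Rightarrow> bool"
where
  "direct_summand R S P N \<longleftrightarrow>
     subbimodule R S P N \<and>
     (\<exists>Q. subbimodule R S Q N \<and> P \<inter> Q = {\<zero>\<^bsub>N\<^esub>} \<and> P <+>\<^bsub>N\<^esub> Q = carrier N)"

definition iso_to_summand ::
  "'r set \<Rightarrow> 's set \<Rightarrow> ('r, 's, 'm, 'x) bimodule_scheme \<Rightarrow> ('r, 's, 'n, 'y) bimodule_scheme \<Rightarrow> bool"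
where
  "iso_to_summand R S M N \<longleftrightarrow>
     (\<exists>P. direct_summand R S P N \<and> bimodule_iso R S M (N\<lparr>carrier := P\<rparr>) \<noteq> {})"

definition tensor_bimodule ::
  "('a, 'x) ring_scheme \<Rightarrow> 'a set \<Rightarrow> ('a, 'a, ('a, 'a) tens) bimodule"
where
  "tensor_bimodule A B =
     ring.extend (ring_tensor A B)
       (bimodule.fields
          (\<lambda>a. tensor_lift (ring_tensor A B) (\<lambda>x y. ring_ptensor A B (a \<otimes>\<^bsub>A\<^esub> x) y))
          (\<lambda>t a. tensor_lift (ring_tensor A B) (\<lambda>x y. ring_ptensor A B x (y \<otimes>\<^bsub>A\<^esub> a)) t))"

definition power_bimodule ::
  "('a, 'x) ring_scheme \<Rightarrow> nat \<Rightarrow> ('a, 'a, nat \<Rightarrow> 'a) bimodule"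
where
  "power_bimodule A n =
     \<lparr>carrier = {..<n} \<rightarrow>\<^sub>E carrier A,
      monoid.mult = undefined, one = undefined,
      ring.zero = (\<lambda>i\<in>{..<n}. \<zero>\<^bsub>A\<^esub>),
      add = (\<lambda>u v. \<lambda>i\<in>{..<n}. u i \<oplus>\<^bsub>A\<^esub> v i),
      lact = (\<lambda>a u. \<lambda>i\<in>{..<n}. a \<otimes>\<^bsub>A\<^esub> u i),
      ract = (\<lambda>u a. \<lambda>i\<in>{..<n}. u i \<otimes>\<^bsub>A\<^esub> a)\<rparr>"

definition depth_two :: "('a, 'x) ring_scheme \<Rightarrow> 'a set \<Rightarrow> bool"
where
  "depth_two A B \<longleftrightarrow>
     ring A \<and> subring B A \<and>
     (\<exists>n>0. iso_to_summand B (carrier A) (tensor_bimodule A B) (power_bimodule A n) \<and>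
            iso_to_summand (carrier A) B (tensor_bimodule A B) (power_bimodule A n))"

end

theory Submission
  imports Defs
begin

text \<open>
  Write \<open>I = H K\<^sup>+ = K\<^sup>+ H\<close> and \<open>\<pi>\<close> for the projection to \<open>H / I\<close>; note that \<open>\<pi>(z) = \<epsilon>(z) 1\<close> on \<open>K\<close>.
  The Galois map \<open>x \<otimes>\<^sub>K y \<mapsto> x y\<^sub>1 \<otimes> \<pi>(y\<^sub>2)\<close> has the inverse \<open>x \<otimes> \<pi>(y) \<mapsto> x S(y\<^sub>1) \<otimes>\<^sub>K y\<^sub>2\<close>, without any
  flatness assumption. If \<open>h\<close> is coinvariant, the Galois map identifies \<open>1 \<otimes>\<^sub>K h\<close> and \<open>h \<otimes>\<^sub>K 1\<close>, so any
  right \<open>K\<close>-linear \<open>p: H \<rightarrow> K\<close> with \<open>p(1) = 1\<close> yields \<open>h = p(h) \<in> K\<close>. Such a \<open>p\<close> exists because \<open>K\<close> is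
  finite-dimensional; it is written down explicitly as a trace, which avoids integrals and freeness
  over Hopf subalgebras. Finally the Galois map is an isomorphism of \<open>H\<close>-\<open>K\<close>-bimodules onto
  \<open>H \<otimes> H / I\<close>, a power of \<open>H\<close>, and the analogous map \<open>x \<otimes>\<^sub>K y \<mapsto> x\<^sub>2 y \<otimes> \<pi>(x\<^sub>1)\<close> is an isomorphism of
  \<open>K\<close>-\<open>H\<close>-bimodules.
\<close>

section \<open>The universal property of the balanced tensor product\<close>

text \<open>The two inclusions behind \<open>H K\<^sup>+ = K\<^sup>+ H\<close> have different tasks.
  One makes \<open>I\<close> a two-sided ideal stable under the antipode; the other makes the
  inverse Galois map vanish on \<open>I\<close>, since an element of \<open>K\<close> can cross the
  tensor sign only when it stands next to it.

  The obstacle is the inclusion of the coinvariants in \<open>K\<close>. Bijectivity of the Galois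
  map yields only an equation in \<open>H \<otimes>\<^sub>K H\<close>; to read off membership in
  \<open>K\<close>, this space has to be mapped to \<open>H\<close> by means of a retraction onto
  \<open>K\<close>. A linear projection onto \<open>K\<close> is in general not
  \<open>K\<close>-linear. It is corrected by a partial trace over \<open>K\<close>, whose cyclicity
  gives linearity on the right. At 1 the trace is that of a rank-one map built from the counit,
  hence 1, so nothing is divided by a dimension.

  Elements of tensor products are cosets of formal sums and are hardly ever computed with: maps out
  of a tensor product are compared on pure tensors, and the Sweedler calculus reduces identities in
  \<open>H\<close> to linearity in each variable and the Hopf axioms.\<close>

lemma (in abelian_group) free_Abelian_group_extension:
  assumes f: "f \<in> S \<rightarrow> carrier G"
  defines "F \<equiv> \<lambda>z. \<Oplus>p\<in>Poly_Mapping.keys z. [Poly_Mapping.lookup z p] \<cdot> f p"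
  shows "F \<in> hom (free_Abelian_group S) (add_monoid G)" "\<And>p. p \<in> S \<Longrightarrow> F (frag_of p) = f p"
proof -

  obtain h where h: "h \<in> hom (free_Abelian_group S) (add_monoid G)" "\<And>x. x \<in> S \<Longrightarrow> h (frag_of x) = f x"
    using comm_group.free_Abelian_group_universal[OF a_comm_group, of f S] f by auto
  interpret h: group_hom "free_Abelian_group S" "add_monoid G" h
    by (simp add: group_hom_def group_hom_axioms_def h a_group)
  \<comment> \<open>Membership of the partial sums in the free group is carried along, because the
    homomorphism law for \<open>h\<close> needs it.\<close>
  have sum: "h (\<Sum>p\<in>A. frag_cmul (n p) (frag_of p)) = (\<Oplus>p\<in>A. [n p] \<cdot> f p) \<and>
      (\<Sum>p\<in>A. frag_cmul (n p) (frag_of p)) \<in> carrier (free_Abelian_group S)"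
    if "finite A" "A \<subseteq> S" for A and n :: "_ \<Rightarrow> int"
    using that
  proof (induction A rule: finite_induct)
    case empty
    then show ?case using h.hom_one by simp
  next
    case (insert a A)
    have a: "frag_cmul (n a) (frag_of a) \<in> carrier (free_Abelian_group S)"
      using insert keys_cmul[of "n a" "frag_of a"] by auto
    have "h (frag_cmul (n a) (frag_of a)) = h (frag_of a [^]\<^bsub>free_Abelian_group S\<^esub> n a)"
      using insert int_pow_free_Abelian_group[of "frag_of a" S "n a"] by simp
    also have "\<dots> = [n a] \<cdot> f a"
      using insert h(2)[of a] h.hom_int_pow[of "frag_of a" "n a"]
      by (simp add: add_pow_def del: int_pow_free_Abelian_group)
    finally have ha: "h (frag_cmul (n a) (frag_of a)) = [n a] \<cdot> f a" .
    have cl: "[n p] \<cdot> f p \<in> carrier G" if "p \<in> S" for p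
      using f that group.int_pow_closed[OF a_group, of "f p" "n p"] by (auto simp: add_pow_def)
    have IH: "h (\<Sum>p\<in>A. frag_cmul (n p) (frag_of p)) = (\<Oplus>p\<in>A. [n p] \<cdot> f p)"
      "(\<Sum>p\<in>A. frag_cmul (n p) (frag_of p)) \<in> carrier (free_Abelian_group S)"
      using insert by auto
    have "h (frag_cmul (n a) (frag_of a) + (\<Sum>p\<in>A. frag_cmul (n p) (frag_of p)))
        = [n a] \<cdot> f a \<oplus> (\<Oplus>p\<in>A. [n p] \<cdot> f p)"
      using h.hom_mult[OF a IH(2)] unfolding ha IH(1) mult_free_Abelian_group by simp
    moreover have "(\<Oplus>p\<in>insert a A. [n p] \<cdot> f p) = [n a] \<cdot> f a \<oplus> (\<Oplus>p\<in>A. [n p] \<cdot> f p)"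
      by (rule finsum_insert) (use insert.hyps insert.prems cl in \<open>simp_all add: Pi_def subset_iff\<close>)
    moreover have "frag_cmul (n a) (frag_of a) + (\<Sum>p\<in>A. frag_cmul (n p) (frag_of p)) \<in> carrier (free_Abelian_group S)"
      using monoid.m_closed[OF group.is_monoid[OF group_free_Abelian_group] a IH(2)] by simp
    ultimately show ?case
      using insert.hyps by simp
  qed
  \<comment> \<open>The explicit sum is the one that \<open>tensor_lift\<close> evaluates. Expanding
    \<open>z\<close> into generators identifies it with the homomorphism \<open>h\<close> given by
    the universal property.\<close>
  have eq: "F z = h z" if "z \<in> carrier (free_Abelian_group S)" for z
  proof -
    have "z = (\<Sum>p\<in>Poly_Mapping.keys z. frag_cmul (Poly_Mapping.lookup z p) (frag_of p))"
      using frag_expansion[of z] by (simp add: frag_extend_def)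
    then show ?thesis
      using sum[of "Poly_Mapping.keys z" "Poly_Mapping.lookup z"] that by (simp add: F_def)
  qed
  show "F \<in> hom (free_Abelian_group S) (add_monoid G)"
  proof (rule homI)
    fix x y assume xy: "x \<in> carrier (free_Abelian_group S)" "y \<in> carrier (free_Abelian_group S)"
    then have "x + y \<in> carrier (free_Abelian_group S)"
      using monoid.m_closed[OF group.is_monoid[OF group_free_Abelian_group], of x S y] by simp
    with xy show "F (x \<otimes>\<^bsub>free_Abelian_group S\<^esub> y) = F x \<otimes>\<^bsub>add_monoid G\<^esub> F y"
      using h.hom_mult[OF xy] eq by simp
  qed (use eq h.hom_closed in auto)
  show "\<And>p. p \<in> S \<Longrightarrow> F (frag_of p) = f p"
    using eq h by simp
qed

section \<open>Tensor products over an arbitrary set of scalars\<close>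

definition balanced_maps where
  "balanced_maps C M ra N la P = {\<phi>.
     (\<forall>x\<in>carrier M. \<forall>y\<in>carrier N. \<phi> x y \<in> carrier P) \<and>
     (\<forall>x\<in>carrier M. \<forall>x'\<in>carrier M. \<forall>y\<in>carrier N. \<phi> (x \<oplus>\<^bsub>M\<^esub> x') y = \<phi> x y \<oplus>\<^bsub>P\<^esub> \<phi> x' y) \<and>
     (\<forall>x\<in>carrier M. \<forall>y\<in>carrier N. \<forall>y'\<in>carrier N. \<phi> x (y \<oplus>\<^bsub>N\<^esub> y') = \<phi> x y \<oplus>\<^bsub>P\<^esub> \<phi> x y') \<and>
     (\<forall>x\<in>carrier M. \<forall>c\<in>C. \<forall>y\<in>carrier N. \<phi> (ra x c) y = \<phi> x (la c y))}"

text \<open>Only closure under the two actions is assumed, since each relator applies a single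
  scalar. The same construction thus covers scalars from the field \<open>k\<close> and scalars from
  the subalgebra \<open>K\<close>.\<close>

locale balanced_product = M: abelian_group M + N: abelian_group N
  for C :: "'r set" and M :: "('m, 'x) ring_scheme" and ra :: "'m \<Rightarrow> 'r \<Rightarrow> 'm"
    and N :: "('n, 'y) ring_scheme" and la :: "'r \<Rightarrow> 'n \<Rightarrow> 'n" +
  assumes ra_closed: "x \<in> carrier M \<Longrightarrow> c \<in> C \<Longrightarrow> ra x c \<in> carrier M"
    and la_closed: "y \<in> carrier N \<Longrightarrow> c \<in> C \<Longrightarrow> la c y \<in> carrier N"
begin

abbreviation "FG \<equiv> free_Abelian_group (carrier M \<times> carrier N)"
abbreviation "BS \<equiv> balanced_subgroup C M ra N la"
abbreviation "BT \<equiv> balanced_tensor C M ra N la"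
abbreviation "pt \<equiv> pure_tensor C M ra N la"

lemma keys_diff2:
  "Poly_Mapping.keys (frag_of a - frag_of b) \<subseteq> {a, b}"
  "Poly_Mapping.keys (frag_of a - frag_of b - frag_of c) \<subseteq> {a, b, c}"
  using keys_diff[of "frag_of a" "frag_of b"] keys_diff[of "frag_of a - frag_of b" "frag_of c"] by auto

lemma relators_closed: "balanced_relators C M ra N la \<subseteq> carrier FG"
  unfolding balanced_relators_def
  by (auto dest!: subsetD[OF keys_diff2(1)] subsetD[OF keys_diff2(2)] intro: ra_closed la_closed)

lemma subgroup_BS: "subgroup BS FG"
  unfolding balanced_subgroup_def
  by (rule group.generate_is_subgroup[OF group_free_Abelian_group relators_closed])

lemma normal_BS: "normal BS FG"
  by (rule comm_group.subgroup_imp_normal[OF abelian_free_Abelian_group subgroup_BS])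

lemma carrier_BT: "carrier BT = (\<lambda>z. BS #>\<^bsub>FG\<^esub> z) ` carrier FG"
  by (auto simp: balanced_tensor_def balanced_group_def FactGroup_def RCOSETS_def)

lemma add_BT:
  assumes "z \<in> carrier FG" "w \<in> carrier FG"
  shows "(BS #>\<^bsub>FG\<^esub> z) \<oplus>\<^bsub>BT\<^esub> (BS #>\<^bsub>FG\<^esub> w) = BS #>\<^bsub>FG\<^esub> (z + w)"
  using normal.rcos_sum[OF normal_BS assms]
  by (simp add: balanced_tensor_def balanced_group_def FactGroup_def)

lemma zero_BT: "\<zero>\<^bsub>BT\<^esub> = BS #>\<^bsub>FG\<^esub> 0"
  using group.coset_mult_one[OF group_free_Abelian_group subgroup.subset[OF subgroup_BS]]
  by (simp add: balanced_tensor_def balanced_group_def FactGroup_def)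

lemma FG_add: "z \<in> carrier FG \<Longrightarrow> w \<in> carrier FG \<Longrightarrow> z + w \<in> carrier FG"
  using monoid.m_closed[OF group.is_monoid[OF group_free_Abelian_group], of z _ w] by fastforce

lemma BT_cases:
  assumes "t \<in> carrier BT"
  obtains z where "z \<in> carrier FG" "t = BS #>\<^bsub>FG\<^esub> z"
  using assms by (auto simp: carrier_BT)

lemma coset_closed: "z \<in> carrier FG \<Longrightarrow> BS #>\<^bsub>FG\<^esub> z \<in> carrier BT"
  unfolding carrier_BT by (rule imageI)

lemma abelian_group_BT: "abelian_group BT"
proof (rule abelian_groupI)
  show "\<zero>\<^bsub>BT\<^esub> \<in> carrier BT" unfolding zero_BT by (rule coset_closed) simp
  fix x assume "x \<in> carrier BT"
  then obtain a where a: "a \<in> carrier FG" "x = BS #>\<^bsub>FG\<^esub> a" by (rule BT_cases)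
  have z: "0 \<in> carrier FG" by simp
  have n: "-a \<in> carrier FG" using a by simp
  show "\<exists>y\<in>carrier BT. y \<oplus>\<^bsub>BT\<^esub> x = \<zero>\<^bsub>BT\<^esub>"
    using coset_closed[OF n] add_BT[OF n a(1)] a(2) zero_BT by auto
  show "\<zero>\<^bsub>BT\<^esub> \<oplus>\<^bsub>BT\<^esub> x = x"
    using add_BT[OF z a(1)] a(2) zero_BT by simp
  fix y assume "y \<in> carrier BT"
  then obtain b where b: "b \<in> carrier FG" "y = BS #>\<^bsub>FG\<^esub> b" by (rule BT_cases)
  show "x \<oplus>\<^bsub>BT\<^esub> y \<in> carrier BT"
    using coset_closed[OF FG_add[OF a(1) b(1)]] add_BT[OF a(1) b(1)] a(2) b(2) by simp
  show "x \<oplus>\<^bsub>BT\<^esub> y = y \<oplus>\<^bsub>BT\<^esub> x"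
    using add_BT[OF a(1) b(1)] add_BT[OF b(1) a(1)] a(2) b(2) by (simp add: add.commute)
  fix z assume "z \<in> carrier BT"
  then obtain c where c: "c \<in> carrier FG" "z = BS #>\<^bsub>FG\<^esub> c" by (rule BT_cases)
  show "x \<oplus>\<^bsub>BT\<^esub> y \<oplus>\<^bsub>BT\<^esub> z = x \<oplus>\<^bsub>BT\<^esub> (y \<oplus>\<^bsub>BT\<^esub> z)"
    using a(2) b(2) c(2) add_BT[OF a(1) b(1)] add_BT[OF b(1) c(1)]
      add_BT[OF a(1) FG_add[OF b(1) c(1)]] add_BT[OF FG_add[OF a(1) b(1)] c(1)]
    by (simp add: add.assoc)
qed

lemma pt_closed: "x \<in> carrier M \<Longrightarrow> y \<in> carrier N \<Longrightarrow> pt x y \<in> carrier BT"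
  by (auto simp: pure_tensor_def carrier_BT)

lemma coset_eqI:
  assumes "z \<in> carrier FG" "w \<in> carrier FG" "z - w \<in> BS"
  shows "BS #>\<^bsub>FG\<^esub> z = BS #>\<^bsub>FG\<^esub> w"
proof -
  have "z \<in> BS #>\<^bsub>FG\<^esub> w"
    unfolding r_coset_def by (rule UN_I[OF assms(3)]) simp
  then show ?thesis
    by (rule group.repr_independence[OF group_free_Abelian_group _ assms(2) subgroup_BS, symmetric])
qed

lemma relator_in: "r \<in> balanced_relators C M ra N la \<Longrightarrow> r \<in> BS"
  by (auto simp: balanced_subgroup_def intro: generate.incl)

lemma pt_add_left:
  assumes "x \<in> carrier M" "x' \<in> carrier M" "y \<in> carrier N"
  shows "pt (x \<oplus>\<^bsub>M\<^esub> x') y = pt x y \<oplus>\<^bsub>BT\<^esub> pt x' y"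
proof -
  have "frag_of (x \<oplus>\<^bsub>M\<^esub> x', y) - frag_of (x, y) - frag_of (x', y) \<in> balanced_relators C M ra N la"
    unfolding balanced_relators_def
    by (rule UnI1, rule UnI1, rule CollectI, intro exI conjI, rule refl) (fact assms)+
  then have "frag_of (x \<oplus>\<^bsub>M\<^esub> x', y) - (frag_of (x, y) + frag_of (x', y)) \<in> BS"
    unfolding diff_diff_eq by (rule relator_in)
  moreover have *: "frag_of (x, y) \<in> carrier FG" "frag_of (x', y) \<in> carrier FG" "frag_of (x \<oplus>\<^bsub>M\<^esub> x', y) \<in> carrier FG"
    using assms by simp_all
  ultimately have "BS #>\<^bsub>FG\<^esub> frag_of (x \<oplus>\<^bsub>M\<^esub> x', y) = BS #>\<^bsub>FG\<^esub> (frag_of (x, y) + frag_of (x', y))"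
    by (intro coset_eqI FG_add)
  then show ?thesis
    unfolding pure_tensor_def add_BT[OF *(1,2)] .
qed

lemma pt_add_right:
  assumes "x \<in> carrier M" "y \<in> carrier N" "y' \<in> carrier N"
  shows "pt x (y \<oplus>\<^bsub>N\<^esub> y') = pt x y \<oplus>\<^bsub>BT\<^esub> pt x y'"
proof -
  have "frag_of (x, y \<oplus>\<^bsub>N\<^esub> y') - frag_of (x, y) - frag_of (x, y') \<in> balanced_relators C M ra N la"
    unfolding balanced_relators_def
    by (rule UnI1, rule UnI2, rule CollectI, intro exI conjI, rule refl) (fact assms)+
  then have "frag_of (x, y \<oplus>\<^bsub>N\<^esub> y') - (frag_of (x, y) + frag_of (x, y')) \<in> BS"
    unfolding diff_diff_eq by (rule relator_in)
  moreover have *: "frag_of (x, y) \<in> carrier FG" "frag_of (x, y') \<in> carrier FG" "frag_of (x, y \<oplus>\<^bsub>N\<^esub> y') \<in> carrier FG"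
    using assms by simp_all
  ultimately have "BS #>\<^bsub>FG\<^esub> frag_of (x, y \<oplus>\<^bsub>N\<^esub> y') = BS #>\<^bsub>FG\<^esub> (frag_of (x, y) + frag_of (x, y'))"
    by (intro coset_eqI FG_add)
  then show ?thesis
    unfolding pure_tensor_def add_BT[OF *(1,2)] .
qed

lemma pt_balanced:
  assumes "x \<in> carrier M" "c \<in> C" "y \<in> carrier N"
  shows "pt (ra x c) y = pt x (la c y)"
proof -
  have "frag_of (ra x c, y) - frag_of (x, la c y) \<in> balanced_relators C M ra N la"
    unfolding balanced_relators_def
    by (rule UnI2, rule CollectI, intro exI conjI, rule refl) (fact assms)+
  then have "frag_of (ra x c, y) - frag_of (x, la c y) \<in> BS"
    by (rule relator_in)
  moreover have "frag_of (ra x c, y) \<in> carrier FG" "frag_of (x, la c y) \<in> carrier FG"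
    using assms by (simp_all add: ra_closed la_closed)
  ultimately show ?thesis
    unfolding pure_tensor_def by (intro coset_eqI)
qed

lemma pt_zero_left:
  assumes y: "y \<in> carrier N"
  shows "pt \<zero>\<^bsub>M\<^esub> y = \<zero>\<^bsub>BT\<^esub>"
proof -
  interpret BT: abelian_group BT by (rule abelian_group_BT)
  have "pt \<zero>\<^bsub>M\<^esub> y \<oplus>\<^bsub>BT\<^esub> pt \<zero>\<^bsub>M\<^esub> y = pt \<zero>\<^bsub>M\<^esub> y"
    using pt_add_left[of "\<zero>\<^bsub>M\<^esub>" "\<zero>\<^bsub>M\<^esub>" y] y by simp
  then show ?thesis
    unfolding BT.add.l_cancel_one[OF pt_closed[OF M.zero_closed y] pt_closed[OF M.zero_closed y]] .
qed

text \<open>Zero and negatives need no cases of their own: zero is the pure tensor of two zeros, and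
  the negative of a pure tensor is again pure, with the left entry negated. Hence every element is a
  sum of pure tensors.\<close>

lemma BT_induct [consumes 1, case_names pure add]:
  assumes t: "t \<in> carrier BT"
    and pure: "\<And>x y. x \<in> carrier M \<Longrightarrow> y \<in> carrier N \<Longrightarrow> Q (pt x y)"
    and add: "\<And>t u. t \<in> carrier BT \<Longrightarrow> u \<in> carrier BT \<Longrightarrow> Q t \<Longrightarrow> Q u \<Longrightarrow> Q (t \<oplus>\<^bsub>BT\<^esub> u)"
  shows "Q t"
proof -
  interpret BT: abelian_group BT by (rule abelian_group_BT)
  obtain z where z: "z \<in> carrier FG" "t = BS #>\<^bsub>FG\<^esub> z" using t by (rule BT_cases)
  have minus: "- w \<in> carrier FG" if "w \<in> carrier FG" for w
    using that by simp
  have neg: "BS #>\<^bsub>FG\<^esub> (- w) = \<ominus>\<^bsub>BT\<^esub> (BS #>\<^bsub>FG\<^esub> w)" if w: "w \<in> carrier FG" for w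
  proof (rule BT.minus_equality[symmetric])
    show "(BS #>\<^bsub>FG\<^esub> (- w)) \<oplus>\<^bsub>BT\<^esub> (BS #>\<^bsub>FG\<^esub> w) = \<zero>\<^bsub>BT\<^esub>"
      unfolding add_BT[OF minus[OF w] w] zero_BT by simp
  qed (intro coset_closed w minus)+
  have zero: "Q (BS #>\<^bsub>FG\<^esub> 0)"
    using pure[OF M.zero_closed N.zero_closed] unfolding pt_zero_left[OF N.zero_closed] zero_BT .
  have "Poly_Mapping.keys z \<subseteq> carrier M \<times> carrier N" using z(1) by simp
  \<comment> \<open>Induction on formal sums closes under differences, so the claim for
    \<open>- z\<close> has to be carried along.\<close>
  then have "Q (BS #>\<^bsub>FG\<^esub> z) \<and> Q (BS #>\<^bsub>FG\<^esub> (-z))"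
  proof (induction z rule: free_Abelian_group_induct[consumes 1])
    case 1
    show ?case using zero by simp
  next
    case (2 x y)
    have x: "x \<in> carrier FG" and y: "y \<in> carrier FG" using 2(1,2) by simp_all
    have "Q ((BS #>\<^bsub>FG\<^esub> x) \<oplus>\<^bsub>BT\<^esub> (BS #>\<^bsub>FG\<^esub> (- y)))" "Q ((BS #>\<^bsub>FG\<^esub> y) \<oplus>\<^bsub>BT\<^esub> (BS #>\<^bsub>FG\<^esub> (- x)))"
      using 2(3,4) by (intro add coset_closed x y minus; simp)+
    then show ?case
      unfolding add_BT[OF x minus[OF y]] add_BT[OF y minus[OF x]] by simp
  next
    case (3 a)
    obtain x y where xy: "a = (x, y)" "x \<in> carrier M" "y \<in> carrier N" using 3 by auto
    have "pt (\<ominus>\<^bsub>M\<^esub> x) y \<oplus>\<^bsub>BT\<^esub> pt x y = \<zero>\<^bsub>BT\<^esub>"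
      using pt_add_left[of "\<ominus>\<^bsub>M\<^esub> x" x y] xy by (simp add: M.l_neg pt_zero_left)
    then have "pt (\<ominus>\<^bsub>M\<^esub> x) y = \<ominus>\<^bsub>BT\<^esub> pt x y"
      using xy pt_closed BT.minus_equality by simp
    then have "BS #>\<^bsub>FG\<^esub> (- frag_of a) = pt (\<ominus>\<^bsub>M\<^esub> x) y"
      using neg[of "frag_of a"] xy unfolding pure_tensor_def by simp
    moreover have "BS #>\<^bsub>FG\<^esub> frag_of a = pt x y"
      unfolding pure_tensor_def xy(1) ..
    ultimately show ?case using xy pure[of x y] pure[of "\<ominus>\<^bsub>M\<^esub> x" y] by simp
  qed
  then show ?thesis unfolding z(2) ..
qed

text \<open>The sum inside \<open>tensor_lift\<close> is a homomorphism on formal sums. Balancedness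
  of \<open>\<phi>\<close> says that it kills the relators, hence \<open>BS\<close>, so it is
  constant on each coset and the image handed to \<open>the_elem\<close> is a singleton.\<close>

lemma lift_coset:
  assumes P: "abelian_group P" and \<phi>: "\<phi> \<in> balanced_maps C M ra N la P"
  obtains F where "F \<in> hom FG (add_monoid P)"
    "\<And>x y. x \<in> carrier M \<Longrightarrow> y \<in> carrier N \<Longrightarrow> F (frag_of (x, y)) = \<phi> x y"
    "\<And>z. z \<in> carrier FG \<Longrightarrow> tensor_lift P \<phi> (BS #>\<^bsub>FG\<^esub> z) = F z"
proof -
  interpret P: abelian_group P by fact
  have f: "(\<lambda>p. \<phi> (fst p) (snd p)) \<in> carrier M \<times> carrier N \<rightarrow> carrier P"
    using \<phi> by (auto simp: balanced_maps_def)
  obtain F where F: "F \<in> hom FG (add_monoid P)"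
      "\<And>p. p \<in> carrier M \<times> carrier N \<Longrightarrow> F (frag_of p) = \<phi> (fst p) (snd p)"
    and F_eq: "\<And>z. (\<Oplus>\<^bsub>P\<^esub>p\<in>Poly_Mapping.keys z. [Poly_Mapping.lookup z p] \<cdot>\<^bsub>P\<^esub> \<phi> (fst p) (snd p)) = F z"
    using P.free_Abelian_group_extension[OF f] by blast
  interpret F: group_hom FG "add_monoid P" F
    by (simp add: group_hom_def group_hom_axioms_def F P.a_group)
  have F_closed: "F a \<in> carrier P" if "a \<in> carrier FG" for a
    using hom_in_carrier[OF F(1) that] by simp
  have F_add: "F (a + b) = F a \<oplus>\<^bsub>P\<^esub> F b" if "a \<in> carrier FG" "b \<in> carrier FG" for a b
    using hom_mult[OF F(1) that] by simp
  have F_zero: "F 0 = \<zero>\<^bsub>P\<^esub>"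
    using F.hom_one by simp
  have minus: "- a \<in> carrier FG" if "a \<in> carrier FG" for a
    using that by simp
  have F_minus: "F (- a) = \<ominus>\<^bsub>P\<^esub> F a" if a: "a \<in> carrier FG" for a
  proof (rule P.minus_equality[symmetric])
    show "F (- a) \<oplus>\<^bsub>P\<^esub> F a = \<zero>\<^bsub>P\<^esub>"
      unfolding F_add[OF minus[OF a] a, symmetric] by (simp add: F_zero)
  qed (intro F_closed a minus)+
  have diff: "F (a - b) = F a \<ominus>\<^bsub>P\<^esub> F b" if "a \<in> carrier FG" "b \<in> carrier FG" for a b
    using F_add[OF that(1) minus[OF that(2)]] F_minus[OF that(2)] by (simp add: a_minus_def)
  have cl: "\<phi> x y \<in> carrier P" if "x \<in> carrier M" "y \<in> carrier N" for x y
    using \<phi> that by (simp add: balanced_maps_def)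
  have rel: "F r = \<zero>\<^bsub>P\<^esub>" if "r \<in> balanced_relators C M ra N la" for r
  proof -
    have d2: "F (frag_of a - frag_of b) = \<phi> (fst a) (snd a) \<ominus>\<^bsub>P\<^esub> \<phi> (fst b) (snd b)"
      if "a \<in> carrier M \<times> carrier N" "b \<in> carrier M \<times> carrier N" for a b
      using that diff[of "frag_of a" "frag_of b"] by (simp add: F)
    have d3: "F (frag_of a - frag_of b - frag_of c) = \<phi> (fst a) (snd a) \<ominus>\<^bsub>P\<^esub> \<phi> (fst b) (snd b) \<ominus>\<^bsub>P\<^esub> \<phi> (fst c) (snd c)"
      if "a \<in> carrier M \<times> carrier N" "b \<in> carrier M \<times> carrier N" "c \<in> carrier M \<times> carrier N" for a b c
    proof -
      have "frag_of a - frag_of b \<in> carrier FG" using that keys_diff2(1)[of a b] by auto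
      from diff[OF this, of "frag_of c"] show ?thesis using that by (simp add: d2 F)
    qed
    have z: "x \<oplus>\<^bsub>P\<^esub> y \<ominus>\<^bsub>P\<^esub> x \<ominus>\<^bsub>P\<^esub> y = \<zero>\<^bsub>P\<^esub>"
      if "x \<in> carrier P" "y \<in> carrier P" for x y
    proof -
      have "x \<oplus>\<^bsub>P\<^esub> y \<ominus>\<^bsub>P\<^esub> x = y"
        using that P.a_comm[of x y] by (simp add: P.minus_eq P.a_assoc P.r_neg)
      then show "x \<oplus>\<^bsub>P\<^esub> y \<ominus>\<^bsub>P\<^esub> x \<ominus>\<^bsub>P\<^esub> y = \<zero>\<^bsub>P\<^esub>" using that by (simp add: P.minus_eq P.r_neg)
    qed
    have z': "x \<ominus>\<^bsub>P\<^esub> x = \<zero>\<^bsub>P\<^esub>" if "x \<in> carrier P" for x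
      using that by (simp add: P.minus_eq P.r_neg)
    have \<phi>_add: "\<phi> (x \<oplus>\<^bsub>M\<^esub> x') y = \<phi> x y \<oplus>\<^bsub>P\<^esub> \<phi> x' y" if "x \<in> carrier M" "x' \<in> carrier M" "y \<in> carrier N" for x x' y
      using \<phi> that by (simp add: balanced_maps_def)
    have \<phi>_add': "\<phi> x (y \<oplus>\<^bsub>N\<^esub> y') = \<phi> x y \<oplus>\<^bsub>P\<^esub> \<phi> x y'" if "x \<in> carrier M" "y \<in> carrier N" "y' \<in> carrier N" for x y y'
      using \<phi> that by (simp add: balanced_maps_def)
    have \<phi>_bal: "\<phi> (ra x c) y = \<phi> x (la c y)" if "x \<in> carrier M" "c \<in> C" "y \<in> carrier N" for x y c
      using \<phi> that by (simp add: balanced_maps_def)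
    show ?thesis
      using that unfolding balanced_relators_def Un_iff mem_Collect_eq
      by (elim disjE exE conjE)
        (simp_all add: d2 d3 ra_closed la_closed cl z z' \<phi>_add \<phi>_add' \<phi>_bal)
  qed
  have ker: "F r = \<zero>\<^bsub>P\<^esub>" if "r \<in> BS" for r
    using that unfolding balanced_subgroup_def
  proof (induction rule: generate.induct)
    case one
    show ?case by (simp add: F_zero)
  next
    case (incl h)
    then show ?case by (rule rel)
  next
    case (inv h)
    then have "h \<in> carrier FG" using relators_closed by (rule subsetD[rotated])
    then show ?case
      using F_minus[of h] rel[OF inv] by simp
  next
    case (eng h1 h2)
    then have "h1 \<in> carrier FG" "h2 \<in> carrier FG"
      using subgroup.subset[OF subgroup_BS] unfolding balanced_subgroup_def by blast+
    then show ?case using eng F_add[of h1 h2] by simp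
  qed
  have "tensor_lift P \<phi> (BS #>\<^bsub>FG\<^esub> z) = F z" if z: "z \<in> carrier FG" for z
  proof -
    have "F w = F z" if w: "w \<in> BS #>\<^bsub>FG\<^esub> z" for w
    proof -
      obtain r where r: "r \<in> BS" "w = r + z" using w by (auto simp: r_coset_def)
      then have "F w = F r \<oplus>\<^bsub>P\<^esub> F z"
        using F_add[OF subsetD[OF subgroup.subset[OF subgroup_BS] r(1)] z] by simp
      then show ?thesis using ker[OF r(1)] F_closed[OF z] by simp
    qed
    moreover have "z \<in> BS #>\<^bsub>FG\<^esub> z"
      by (rule group.rcos_self[OF group_free_Abelian_group z subgroup_BS])
    ultimately have "F ` (BS #>\<^bsub>FG\<^esub> z) = {F z}" by blast
    then show ?thesis unfolding tensor_lift_def F_eq by simp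
  qed
  with F show thesis by (intro that) auto
qed

lemma lift_pt:
  assumes P: "abelian_group P" and \<phi>: "\<phi> \<in> balanced_maps C M ra N la P"
    and xy: "x \<in> carrier M" "y \<in> carrier N"
  shows "tensor_lift P \<phi> (pt x y) = \<phi> x y"
proof -
  have "frag_of (x, y) \<in> carrier FG" using xy by simp
  with lift_coset[OF P \<phi>] xy show ?thesis
    unfolding pure_tensor_def by metis
qed

lemma lift_hom:
  assumes P: "abelian_group P" and \<phi>: "\<phi> \<in> balanced_maps C M ra N la P"
  shows "tensor_lift P \<phi> \<in> hom (add_monoid BT) (add_monoid P)"
proof -
  obtain F where F: "F \<in> hom FG (add_monoid P)"
    and lift: "\<And>z. z \<in> carrier FG \<Longrightarrow> tensor_lift P \<phi> (BS #>\<^bsub>FG\<^esub> z) = F z"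
    using lift_coset[OF P \<phi>] by metis
  show ?thesis
  proof (rule homI)
    fix x assume "x \<in> carrier (add_monoid BT)"
    then obtain z where z: "z \<in> carrier FG" "x = BS #>\<^bsub>FG\<^esub> z" using BT_cases by auto
    then show "tensor_lift P \<phi> x \<in> carrier (add_monoid P)"
      using hom_in_carrier[OF F z(1)] lift[OF z(1)] by simp
    fix y assume "y \<in> carrier (add_monoid BT)"
    then obtain w where w: "w \<in> carrier FG" "y = BS #>\<^bsub>FG\<^esub> w" using BT_cases by auto
    have xy: "x \<otimes>\<^bsub>add_monoid BT\<^esub> y = BS #>\<^bsub>FG\<^esub> (z + w)"
      using add_BT[OF z(1) w(1)] z(2) w(2) by simp
    show "tensor_lift P \<phi> (x \<otimes>\<^bsub>add_monoid BT\<^esub> y) = tensor_lift P \<phi> x \<otimes>\<^bsub>add_monoid P\<^esub> tensor_lift P \<phi> y"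
      unfolding xy unfolding z(2) w(2) lift[OF z(1)] lift[OF w(1)] lift[OF FG_add[OF z(1) w(1)]]
      using hom_mult[OF F z(1) w(1)] by simp
  qed
qed

lemma lift_closed:
  "abelian_group P \<Longrightarrow> \<phi> \<in> balanced_maps C M ra N la P \<Longrightarrow> t \<in> carrier BT \<Longrightarrow> tensor_lift P \<phi> t \<in> carrier P"
  using hom_in_carrier[OF lift_hom, of P \<phi> t] by simp

lemma lift_add:
  "abelian_group P \<Longrightarrow> \<phi> \<in> balanced_maps C M ra N la P \<Longrightarrow> t \<in> carrier BT \<Longrightarrow> u \<in> carrier BT \<Longrightarrow>
    tensor_lift P \<phi> (t \<oplus>\<^bsub>BT\<^esub> u) = tensor_lift P \<phi> t \<oplus>\<^bsub>P\<^esub> tensor_lift P \<phi> u"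
  using hom_mult[OF lift_hom, of P \<phi> t u] by simp

text \<open>
  \<open>tensor_lift P\<close> depends on the record \<open>P\<close> only through its additive group, so that the lifts into
  \<open>tensor_space\<close> occurring in the definitions can be replaced by lifts into \<open>tensor\<close>.
\<close>

lemma lift_cong:
  fixes P :: "('p, 'u) ring_scheme" and P' :: "('p, 'v) ring_scheme"
  assumes P: "abelian_group P" "abelian_group P'" "carrier P = carrier P'"
      "\<And>a b. a \<in> carrier P \<Longrightarrow> b \<in> carrier P \<Longrightarrow> a \<oplus>\<^bsub>P\<^esub> b = a \<oplus>\<^bsub>P'\<^esub> b"
    and \<phi>: "\<phi> \<in> balanced_maps C M ra N la P"
    and eq: "\<And>x y. x \<in> carrier M \<Longrightarrow> y \<in> carrier N \<Longrightarrow> \<phi> x y = \<psi> x y"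
    and t: "t \<in> carrier BT"
  shows "tensor_lift P \<phi> t = tensor_lift P' \<psi> t"
proof -
  have \<psi>: "\<psi> \<in> balanced_maps C M ra N la P'"
    using \<phi> P(3,4) eq by (simp add: balanced_maps_def ra_closed la_closed) 
  from t show ?thesis
  proof (induction t rule: BT_induct)
    case (pure x y)
    then show ?case using lift_pt[OF P(1) \<phi>] lift_pt[OF P(2) \<psi>] eq by simp
  next
    case (add t u)
    then show ?case
      using lift_add[OF P(1) \<phi>] lift_add[OF P(2) \<psi>] lift_closed[OF P(1) \<phi>] P(4) by simp
  qed
qed

end

section \<open>Linear and bilinear maps\<close>

lemma linear_mapI:
  assumes "\<And>x. x \<in> carrier M \<Longrightarrow> f x \<in> carrier N"
    and "\<And>x y. x \<in> carrier M \<Longrightarrow> y \<in> carrier M \<Longrightarrow> f (x \<oplus>\<^bsub>M\<^esub> y) = f x \<oplus>\<^bsub>N\<^esub> f y"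
    and "\<And>c x. c \<in> carrier k \<Longrightarrow> x \<in> carrier M \<Longrightarrow> f (c \<odot>\<^bsub>M\<^esub> x) = c \<odot>\<^bsub>N\<^esub> f x"
  shows "f \<in> linear_map k M N"
  using assms by (auto simp: linear_map_def hom_def)

lemma linear_mapD:
  assumes "f \<in> linear_map k M N"
  shows linear_map_closed: "\<And>x. x \<in> carrier M \<Longrightarrow> f x \<in> carrier N"
    and linear_map_add: "\<And>x y. x \<in> carrier M \<Longrightarrow> y \<in> carrier M \<Longrightarrow> f (x \<oplus>\<^bsub>M\<^esub> y) = f x \<oplus>\<^bsub>N\<^esub> f y"
    and linear_map_smult: "\<And>c x. c \<in> carrier k \<Longrightarrow> x \<in> carrier M \<Longrightarrow> f (c \<odot>\<^bsub>M\<^esub> x) = c \<odot>\<^bsub>N\<^esub> f x"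
  using assms by (auto simp: linear_map_def hom_def)

lemma linear_map_zero:
  assumes "f \<in> linear_map k M N" "module k M" "module k N"
  shows "f \<zero>\<^bsub>M\<^esub> = \<zero>\<^bsub>N\<^esub>"
proof -
  interpret M: module k M by fact
  interpret N: module k N by fact
  have "f \<zero>\<^bsub>M\<^esub> \<oplus>\<^bsub>N\<^esub> f \<zero>\<^bsub>M\<^esub> = f \<zero>\<^bsub>M\<^esub>"
    using linear_map_add[OF assms(1), of "\<zero>\<^bsub>M\<^esub>" "\<zero>\<^bsub>M\<^esub>"] by simp
  then show ?thesis
    using linear_map_closed[OF assms(1), of "\<zero>\<^bsub>M\<^esub>"] by simp
qed

lemma linear_map_minus:
  assumes "f \<in> linear_map k M N" "module k M" "module k N" "x \<in> carrier M"
  shows "f (\<ominus>\<^bsub>M\<^esub> x) = \<ominus>\<^bsub>N\<^esub> f x"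
proof -
  interpret M: module k M by fact
  interpret N: module k N by fact
  have "f (\<ominus>\<^bsub>M\<^esub> x) \<oplus>\<^bsub>N\<^esub> f x = \<zero>\<^bsub>N\<^esub>"
    using linear_map_add[OF assms(1), of "\<ominus>\<^bsub>M\<^esub> x" x] linear_map_zero[OF assms(1-3)] assms(4)
    by (simp add: M.l_neg)
  then show ?thesis
    using linear_map_closed[OF assms(1)] assms(4) N.minus_equality by simp
qed

lemma linear_map_finsum:
  assumes f: "f \<in> linear_map k M N" "module k M" "module k N"
    and A: "finite A" "g \<in> A \<rightarrow> carrier M"
  shows "f (finsum M g A) = (\<Oplus>\<^bsub>N\<^esub>i\<in>A. f (g i))"
proof -
  interpret M: module k M by fact
  interpret N: module k N by fact
  show ?thesis
    using A
  proof (induction A rule: finite_induct)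
    case empty
    then show ?case using linear_map_zero[OF f] by simp
  next
    case (insert a A)
    then show ?case
      by (simp add: linear_map_add[OF f(1)] linear_map_closed[OF f(1)] Pi_def)
  qed
qed

lemma linear_map_id: "(\<lambda>x. x) \<in> linear_map k M M"
  by (rule linear_mapI) simp_all

lemma linear_map_comp: "f \<in> linear_map k M N \<Longrightarrow> g \<in> linear_map k N P \<Longrightarrow> (\<lambda>x. g (f x)) \<in> linear_map k M P"
  by (simp add: linear_map_def hom_def Pi_def)

lemma linear_map_smult_const:
  assumes "module k P" "f \<in> linear_map k M P" "c \<in> carrier k"
  shows "(\<lambda>x. c \<odot>\<^bsub>P\<^esub> f x) \<in> linear_map k M P"
proof -
  interpret P: module k P by fact
  show ?thesis
    using assms(3) linear_mapD[OF assms(2)]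
    by (intro linear_mapI) (simp_all add: P.smult_r_distr P.smult_assoc1[symmetric] P.R.m_comm)
qed

lemma linear_map_plus:
  assumes "module k P" "f \<in> linear_map k M P" "g \<in> linear_map k M P"
  shows "(\<lambda>x. f x \<oplus>\<^bsub>P\<^esub> g x) \<in> linear_map k M P"
proof -
  interpret P: module k P by fact
  show ?thesis
    using linear_mapD[OF assms(2)] linear_mapD[OF assms(3)]
    by (intro linear_mapI) (simp_all add: P.smult_r_distr P.M.a_ac)
qed

lemma linear_map_sum:
  assumes P: "module k P" and A: "finite A" and f: "\<And>i. i \<in> A \<Longrightarrow> f i \<in> linear_map k M P"
  shows "(\<lambda>x. \<Oplus>\<^bsub>P\<^esub>i\<in>A. f i x) \<in> linear_map k M P"
proof -
  interpret P: module k P by fact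
  note fD = linear_mapD[OF f]
  show ?thesis
  proof (rule linear_mapI)
    fix x assume x: "x \<in> carrier M"
    then show "(\<Oplus>\<^bsub>P\<^esub>i\<in>A. f i x) \<in> carrier P" by (intro P.M.finsum_closed) (simp add: fD)
    fix y assume y: "y \<in> carrier M"
    have "(\<Oplus>\<^bsub>P\<^esub>i\<in>A. f i (x \<oplus>\<^bsub>M\<^esub> y)) = (\<Oplus>\<^bsub>P\<^esub>i\<in>A. f i x \<oplus>\<^bsub>P\<^esub> f i y)"
      by (rule P.M.finsum_cong') (use x y in \<open>simp_all add: fD\<close>)
    also have "\<dots> = (\<Oplus>\<^bsub>P\<^esub>i\<in>A. f i x) \<oplus>\<^bsub>P\<^esub> (\<Oplus>\<^bsub>P\<^esub>i\<in>A. f i y)"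
      by (rule P.M.finsum_addf) (use x y in \<open>simp_all add: fD\<close>)
    finally show "(\<Oplus>\<^bsub>P\<^esub>i\<in>A. f i (x \<oplus>\<^bsub>M\<^esub> y)) = (\<Oplus>\<^bsub>P\<^esub>i\<in>A. f i x) \<oplus>\<^bsub>P\<^esub> (\<Oplus>\<^bsub>P\<^esub>i\<in>A. f i y)" .
  next
    fix c x assume c: "c \<in> carrier k" and x: "x \<in> carrier M"
    have "(\<Oplus>\<^bsub>P\<^esub>i\<in>A. f i (c \<odot>\<^bsub>M\<^esub> x)) = (\<Oplus>\<^bsub>P\<^esub>i\<in>A. c \<odot>\<^bsub>P\<^esub> f i x)"
      by (rule P.M.finsum_cong') (use c x in \<open>simp_all add: fD\<close>)
    also have "\<dots> = c \<odot>\<^bsub>P\<^esub> (\<Oplus>\<^bsub>P\<^esub>i\<in>A. f i x)"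
      by (rule P.finsum_smult_ldistr[symmetric]) (use A c x in \<open>simp_all add: fD\<close>)
    finally show "(\<Oplus>\<^bsub>P\<^esub>i\<in>A. f i (c \<odot>\<^bsub>M\<^esub> x)) = c \<odot>\<^bsub>P\<^esub> (\<Oplus>\<^bsub>P\<^esub>i\<in>A. f i x)" .
  qed
qed

lemma linear_map_cong:
  assumes "f \<in> linear_map k M P" "module k M" "\<And>x. x \<in> carrier M \<Longrightarrow> f x = g x"
  shows "g \<in> linear_map k M P"
proof -
  interpret M: module k M by fact
  show ?thesis
    using linear_mapD[OF assms(1)] by (intro linear_mapI) (simp_all add: assms(3)[symmetric])
qed

definition bilinear ::
  "('k, 'x) ring_scheme \<Rightarrow> ('k, 'm, 'y) module_scheme \<Rightarrow> ('k, 'n, 'z) module_scheme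
    \<Rightarrow> ('k, 'p, 'w) module_scheme \<Rightarrow> ('m \<Rightarrow> 'n \<Rightarrow> 'p) set"
where
  "bilinear k M N P =
     {\<phi>. (\<forall>x\<in>carrier M. (\<lambda>y. \<phi> x y) \<in> linear_map k N P) \<and> (\<forall>y\<in>carrier N. (\<lambda>x. \<phi> x y) \<in> linear_map k M P)}"

lemma bilinearI:
  assumes "\<And>x. x \<in> carrier M \<Longrightarrow> (\<lambda>y. \<phi> x y) \<in> linear_map k N P"
    and "\<And>y. y \<in> carrier N \<Longrightarrow> (\<lambda>x. \<phi> x y) \<in> linear_map k M P"
  shows "(\<lambda>x y. \<phi> x y) \<in> bilinear k M N P"
  using assms by (simp add: bilinear_def)

lemma bilinearD:
  assumes "\<phi> \<in> bilinear k M N P"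
  shows bilinear_right: "\<And>x. x \<in> carrier M \<Longrightarrow> (\<lambda>y. \<phi> x y) \<in> linear_map k N P"
    and bilinear_left: "\<And>y. y \<in> carrier N \<Longrightarrow> (\<lambda>x. \<phi> x y) \<in> linear_map k M P"
  using assms by (auto simp: bilinear_def)

lemma bilinear_closed:
  "\<phi> \<in> bilinear k M N P \<Longrightarrow> x \<in> carrier M \<Longrightarrow> y \<in> carrier N \<Longrightarrow> \<phi> x y \<in> carrier P"
  using linear_map_closed[OF bilinear_right, of \<phi> k M N P x y] by simp

text \<open>Separates the two ingredients of a map on a tensor product: linearity, which follows
  from the shape of an expression, and compatibility with the scalars in \<open>C\<close>, which is
  the real issue when \<open>C\<close> is \<open>K\<close>.\<close>

lemma bilinear_balanced:
  assumes "\<phi> \<in> bilinear k M N P"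
    and "\<And>x c y. x \<in> carrier M \<Longrightarrow> c \<in> C \<Longrightarrow> y \<in> carrier N \<Longrightarrow> \<phi> (ra x c) y = \<phi> x (la c y)"
  shows "\<phi> \<in> balanced_maps C M ra N la P"
  using bilinear_closed[OF assms(1)] linear_map_add[OF bilinear_right[OF assms(1)]]
    linear_map_add[OF bilinear_left[OF assms(1)]] assms(2)
  by (simp add: balanced_maps_def)


section \<open>Tensor products as vector spaces\<close>

text \<open>
  The common abstraction of \<open>M \<otimes>\<^sub>k N\<close> and \<open>H \<otimes>\<^sub>K H\<close>: the scalars of \<open>k\<close> act on both factors
  through elements of \<open>C\<close>.
\<close>

locale linear_tensor = M: module k M + N: module k N + balanced_product C M ra N la
  for k :: "('k, 'w) ring_scheme" and M :: "('k, 'm, 'x) module_scheme" and N :: "('k, 'n, 'y) module_scheme"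
    and C :: "'r set" and ra :: "'m \<Rightarrow> 'r \<Rightarrow> 'm" and la :: "'r \<Rightarrow> 'n \<Rightarrow> 'n" +
  fixes T :: "('k, ('m, 'n) tens, 'z) module_scheme"
  assumes scalar: "c \<in> carrier k \<Longrightarrow>
      \<exists>d\<in>C. (\<forall>x\<in>carrier M. ra x d = c \<odot>\<^bsub>M\<^esub> x) \<and> (\<forall>y\<in>carrier N. la d y = c \<odot>\<^bsub>N\<^esub> y)"
    and ra_smult: "\<lbrakk>c \<in> carrier k; x \<in> carrier M; d \<in> C\<rbrakk> \<Longrightarrow> ra (c \<odot>\<^bsub>M\<^esub> x) d = c \<odot>\<^bsub>M\<^esub> ra x d"
    and carrier_T: "carrier T = carrier (balanced_tensor C M ra N la)"
    and add_T: "add T = add (balanced_tensor C M ra N la)"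
    and zero_T: "\<zero>\<^bsub>T\<^esub> = \<zero>\<^bsub>balanced_tensor C M ra N la\<^esub>"
    and smult_T: "smult T = (\<lambda>c. tensor_lift (balanced_tensor C M ra N la)
          (\<lambda>x y. pure_tensor C M ra N la (c \<odot>\<^bsub>M\<^esub> x) y))"
begin

lemma smult_balanced:
  assumes c: "c \<in> carrier k"
  shows "(\<lambda>x y. pt (c \<odot>\<^bsub>M\<^esub> x) y) \<in> balanced_maps C M ra N la BT"
  using c
  by (simp add: balanced_maps_def pt_closed M.smult_r_distr pt_add_left pt_add_right pt_balanced
      ra_smult[symmetric])

text \<open>Scalars act on the left factor by definition. They reach the right factor because
  \<open>c\<close> acts on both factors like some element \<open>d\<close> of \<open>C\<close>, and
  elements of \<open>C\<close> may cross the tensor sign.\<close>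

lemma smult_pt:
  assumes "c \<in> carrier k" "x \<in> carrier M" "y \<in> carrier N"
  shows "c \<odot>\<^bsub>T\<^esub> pt x y = pt (c \<odot>\<^bsub>M\<^esub> x) y" "c \<odot>\<^bsub>T\<^esub> pt x y = pt x (c \<odot>\<^bsub>N\<^esub> y)"
proof -
  show *: "c \<odot>\<^bsub>T\<^esub> pt x y = pt (c \<odot>\<^bsub>M\<^esub> x) y"
    unfolding smult_T using lift_pt[OF abelian_group_BT smult_balanced] assms by simp
  obtain d where "d \<in> C" "ra x d = c \<odot>\<^bsub>M\<^esub> x" "la d y = c \<odot>\<^bsub>N\<^esub> y"
    using scalar assms by blast
  then show "c \<odot>\<^bsub>T\<^esub> pt x y = pt x (c \<odot>\<^bsub>N\<^esub> y)"
    using pt_balanced[of x d y] assms * by simp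
qed

lemma T_induct [consumes 1, case_names pure add]:
  assumes t: "t \<in> carrier T"
    and pure: "\<And>x y. x \<in> carrier M \<Longrightarrow> y \<in> carrier N \<Longrightarrow> Q (pt x y)"
    and add: "\<And>t u. t \<in> carrier T \<Longrightarrow> u \<in> carrier T \<Longrightarrow> Q t \<Longrightarrow> Q u \<Longrightarrow> Q (t \<oplus>\<^bsub>T\<^esub> u)"
  shows "Q t"
proof -
  have "t \<in> carrier BT" using t by (simp add: carrier_T)
  then show ?thesis
  proof (induction t rule: BT_induct)
    case (pure x y)
    then show ?case by (rule assms(2))
  next
    case (add t u)
    then show ?case using assms(3)[of t u] by (simp add: carrier_T add_T)
  qed
qed

lemma pt_T: "x \<in> carrier M \<Longrightarrow> y \<in> carrier N \<Longrightarrow> pt x y \<in> carrier T"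
  by (simp add: carrier_T pt_closed)

lemma smult_T_closed: "c \<in> carrier k \<Longrightarrow> t \<in> carrier T \<Longrightarrow> c \<odot>\<^bsub>T\<^esub> t \<in> carrier T"
  using lift_closed[OF abelian_group_BT smult_balanced] by (simp add: carrier_T smult_T)

lemma smult_T_add:
  "c \<in> carrier k \<Longrightarrow> t \<in> carrier T \<Longrightarrow> u \<in> carrier T \<Longrightarrow> c \<odot>\<^bsub>T\<^esub> (t \<oplus>\<^bsub>T\<^esub> u) = c \<odot>\<^bsub>T\<^esub> t \<oplus>\<^bsub>T\<^esub> c \<odot>\<^bsub>T\<^esub> u"
  using lift_add[OF abelian_group_BT smult_balanced] by (simp add: carrier_T smult_T add_T)

lemma abelian_group_T: "abelian_group T"
proof -
  show ?thesis
    by (rule abelian_groupI)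
      (use abelian_groupE[OF abelian_group_BT] in \<open>simp_all add: carrier_T add_T zero_T\<close>)
qed

lemma module_T: "module k T"
proof (rule moduleI)
  interpret T: abelian_group T by (rule abelian_group_T)
  show "cring k" by unfold_locales
  show "abelian_group T" by (rule abelian_group_T)
  note cl = smult_T_closed pt_T
  show "c \<odot>\<^bsub>T\<^esub> t \<in> carrier T" if "c \<in> carrier k" "t \<in> carrier T" for c t
    using that by (rule smult_T_closed)
  show "c \<odot>\<^bsub>T\<^esub> (t \<oplus>\<^bsub>T\<^esub> u) = c \<odot>\<^bsub>T\<^esub> t \<oplus>\<^bsub>T\<^esub> c \<odot>\<^bsub>T\<^esub> u"
    if "c \<in> carrier k" "t \<in> carrier T" "u \<in> carrier T" for c t u
    using that by (rule smult_T_add)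
  fix c d t assume c: "c \<in> carrier k" and d: "d \<in> carrier k" and t: "t \<in> carrier T"
  show "(c \<oplus>\<^bsub>k\<^esub> d) \<odot>\<^bsub>T\<^esub> t = c \<odot>\<^bsub>T\<^esub> t \<oplus>\<^bsub>T\<^esub> d \<odot>\<^bsub>T\<^esub> t"
    using t
  proof (induction t rule: T_induct)
    case (pure x y)
    then show ?case
      using c d pt_add_left[of "c \<odot>\<^bsub>M\<^esub> x" "d \<odot>\<^bsub>M\<^esub> x" y] by (simp add: smult_pt(1) M.smult_l_distr add_T)
  next
    case (add t u)
    have "c \<odot>\<^bsub>T\<^esub> t \<oplus>\<^bsub>T\<^esub> d \<odot>\<^bsub>T\<^esub> t \<oplus>\<^bsub>T\<^esub> (c \<odot>\<^bsub>T\<^esub> u \<oplus>\<^bsub>T\<^esub> d \<odot>\<^bsub>T\<^esub> u)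
        = c \<odot>\<^bsub>T\<^esub> t \<oplus>\<^bsub>T\<^esub> c \<odot>\<^bsub>T\<^esub> u \<oplus>\<^bsub>T\<^esub> (d \<odot>\<^bsub>T\<^esub> t \<oplus>\<^bsub>T\<^esub> d \<odot>\<^bsub>T\<^esub> u)"
      using add c d cl by (simp add: T.a_ac)
    then show ?case using c d add cl by (simp add: smult_T_add)
  qed
  show "(c \<otimes>\<^bsub>k\<^esub> d) \<odot>\<^bsub>T\<^esub> t = c \<odot>\<^bsub>T\<^esub> (d \<odot>\<^bsub>T\<^esub> t)"
    using t
  proof (induction t rule: T_induct)
    case (pure x y)
    then show ?case using c d by (simp add: smult_pt(1) M.smult_assoc1)
  next
    case (add t u)
    then show ?case using c d cl by (simp add: smult_T_add)
  qed
next
  fix t assume "t \<in> carrier T"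
  then show "\<one>\<^bsub>k\<^esub> \<odot>\<^bsub>T\<^esub> t = t"
  proof (induction t rule: T_induct)
    case (pure x y)
    then show ?case by (simp add: smult_pt(1))
  next
    case (add t u)
    then show ?case by (simp add: smult_T_add)
  qed
qed

lemma pt_bilinear: "(\<lambda>x y. pt x y) \<in> bilinear k M N T"
  by (intro bilinearI linear_mapI) (simp_all add: pt_T pt_add_left pt_add_right add_T smult_pt[symmetric])

lemma lift_linear:
  assumes P: "module k P" and \<phi>: "\<phi> \<in> bilinear k M N P"
    and bal: "\<And>x c y. x \<in> carrier M \<Longrightarrow> c \<in> C \<Longrightarrow> y \<in> carrier N \<Longrightarrow> \<phi> (ra x c) y = \<phi> x (la c y)"
  shows "tensor_lift P \<phi> \<in> linear_map k T P"
proof -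
  interpret P: module k P by fact
  have P': "abelian_group P" by unfold_locales
  have \<phi>': "\<phi> \<in> balanced_maps C M ra N la P"
    using \<phi> bal by (rule bilinear_balanced)
  have ladd: "tensor_lift P \<phi> (t \<oplus>\<^bsub>T\<^esub> u) = tensor_lift P \<phi> t \<oplus>\<^bsub>P\<^esub> tensor_lift P \<phi> u"
    if "t \<in> carrier T" "u \<in> carrier T" for t u
    using lift_add[OF P' \<phi>'] that by (simp add: carrier_T add_T)
  have cl: "tensor_lift P \<phi> t \<in> carrier P" if "t \<in> carrier T" for t
    using lift_closed[OF P' \<phi>'] that by (simp add: carrier_T)
  show ?thesis
  proof (rule linear_mapI[OF cl ladd])
    fix c t assume c: "c \<in> carrier k" and "t \<in> carrier T"
    from this(2) show "tensor_lift P \<phi> (c \<odot>\<^bsub>T\<^esub> t) = c \<odot>\<^bsub>P\<^esub> tensor_lift P \<phi> t"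
    proof (induction t rule: T_induct)
      case (pure x y)
      then show ?case
        using c linear_map_smult[OF bilinear_left[OF \<phi>]] by (simp add: smult_pt(1) lift_pt[OF P' \<phi>'])
    next
      case (add t u)
      then show ?case
        using c by (simp add: smult_T_add smult_T_closed ladd cl P.smult_r_distr)
    qed
  qed auto
qed

lemma lift_pure:
  assumes P: "module k P" and \<phi>: "\<phi> \<in> bilinear k M N P"
    and bal: "\<And>x c y. x \<in> carrier M \<Longrightarrow> c \<in> C \<Longrightarrow> y \<in> carrier N \<Longrightarrow> \<phi> (ra x c) y = \<phi> x (la c y)"
    and xy: "x \<in> carrier M" "y \<in> carrier N"
  shows "tensor_lift P \<phi> (pt x y) = \<phi> x y"
proof -
  have "abelian_group P" using P by (simp add: module_def)
  moreover have "\<phi> \<in> balanced_maps C M ra N la P"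
    using \<phi> bal by (rule bilinear_balanced)
  ultimately show ?thesis using xy by (rule lift_pt)
qed

text \<open>Pure tensors generate additively, so agreement on them suffices. Most identities between
  maps on tensor products below are reduced to this principle.\<close>

lemma T_ext:
  assumes "f \<in> linear_map k T P" "g \<in> linear_map k T P" "t \<in> carrier T"
    and "\<And>x y. x \<in> carrier M \<Longrightarrow> y \<in> carrier N \<Longrightarrow> f (pt x y) = g (pt x y)"
  shows "f t = g t"
  using assms(3)
proof (induction t rule: T_induct)
  case (pure x y)
  then show ?case by (rule assms(4))
next
  case (add t u)
  then show ?case by (simp add: linear_map_add[OF assms(1)] linear_map_add[OF assms(2)])
qed

end

section \<open>The tensor product over the ground field\<close>

lemma linear_tensor_tensor:
  assumes "module k M" "module k N"
  shows "linear_tensor k M N (carrier k) (\<lambda>x c. c \<odot>\<^bsub>M\<^esub> x) (smult N) (tensor k M N)"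
proof -
  interpret M: module k M by fact
  interpret N: module k N by fact
  show ?thesis
  proof unfold_locales
    fix c assume c: "c \<in> carrier k"
    show "\<exists>d\<in>carrier k. (\<forall>x\<in>carrier M. d \<odot>\<^bsub>M\<^esub> x = c \<odot>\<^bsub>M\<^esub> x) \<and> (\<forall>y\<in>carrier N. d \<odot>\<^bsub>N\<^esub> y = c \<odot>\<^bsub>N\<^esub> y)"
      using c by blast
    fix x d assume "x \<in> carrier M" "d \<in> carrier k"
    with c show "d \<odot>\<^bsub>M\<^esub> (c \<odot>\<^bsub>M\<^esub> x) = c \<odot>\<^bsub>M\<^esub> (d \<odot>\<^bsub>M\<^esub> x)"
      by (simp add: M.smult_assoc1[symmetric] M.R.m_comm)
  qed (simp_all add: tensor_def tensor_space_def ptensor_def)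
qed

lemma module_tensor: "module k M \<Longrightarrow> module k N \<Longrightarrow> module k (tensor k M N)"
  by (rule linear_tensor.module_T[OF linear_tensor_tensor])

lemma ptensor_bilinear:
  "module k M \<Longrightarrow> module k N \<Longrightarrow> (\<lambda>x y. ptensor k M N x y) \<in> bilinear k M N (tensor k M N)"
  unfolding ptensor_def by (rule linear_tensor.pt_bilinear[OF linear_tensor_tensor])

lemma bilinear_scalar:
  assumes "\<phi> \<in> bilinear k M N P" "x \<in> carrier M" "c \<in> carrier k" "y \<in> carrier N"
  shows "\<phi> (c \<odot>\<^bsub>M\<^esub> x) y = \<phi> x (c \<odot>\<^bsub>N\<^esub> y)"
  using linear_map_smult[OF bilinear_left[OF assms(1)]] linear_map_smult[OF bilinear_right[OF assms(1)]] assms(2-)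
  by simp

lemma tensor_lift_linear:
  "module k M \<Longrightarrow> module k N \<Longrightarrow> module k P \<Longrightarrow> \<phi> \<in> bilinear k M N P \<Longrightarrow> tensor_lift P \<phi> \<in> linear_map k (tensor k M N) P"
  by (rule linear_tensor.lift_linear[OF linear_tensor_tensor]) (auto intro: bilinear_scalar)

lemma tensor_lift_ptensor:
  "module k M \<Longrightarrow> module k N \<Longrightarrow> module k P \<Longrightarrow> \<phi> \<in> bilinear k M N P \<Longrightarrow> x \<in> carrier M \<Longrightarrow> y \<in> carrier N \<Longrightarrow>
    tensor_lift P \<phi> (ptensor k M N x y) = \<phi> x y"
  unfolding ptensor_def
  by (rule linear_tensor.lift_pure[OF linear_tensor_tensor]) (auto intro: bilinear_scalar)

lemma tensor_ext:
  assumes "module k M" "module k N" "f \<in> linear_map k (tensor k M N) P" "g \<in> linear_map k (tensor k M N) P"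
    and "\<And>x y. x \<in> carrier M \<Longrightarrow> y \<in> carrier N \<Longrightarrow> f (ptensor k M N x y) = g (ptensor k M N x y)"
    and "t \<in> carrier (tensor k M N)"
  shows "f t = g t"
  using linear_tensor.T_ext[OF linear_tensor_tensor[OF assms(1,2)] assms(3,4,6)] assms(5)
  by (simp add: ptensor_def)

lemma tensor_induct [consumes 3, case_names pure add]:
  assumes "module k M" "module k N" "t \<in> carrier (tensor k M N)"
    and "\<And>x y. x \<in> carrier M \<Longrightarrow> y \<in> carrier N \<Longrightarrow> Q (ptensor k M N x y)"
    and "\<And>t u. t \<in> carrier (tensor k M N) \<Longrightarrow> u \<in> carrier (tensor k M N) \<Longrightarrow> Q t \<Longrightarrow> Q u \<Longrightarrow> Q (t \<oplus>\<^bsub>tensor k M N\<^esub> u)"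
  shows "Q t"
  using linear_tensor_tensor[OF assms(1,2)] assms(3)
proof (rule linear_tensor.T_induct)
qed (use assms(4,5) in \<open>simp_all add: ptensor_def\<close>)

lemma tensor_lift_cong:
  assumes "module k M" "module k N" "module k P" "\<phi> \<in> bilinear k M N P" "t \<in> carrier (tensor k M N)"
    and "\<And>x y. x \<in> carrier M \<Longrightarrow> y \<in> carrier N \<Longrightarrow> \<phi> x y = \<psi> x y"
  shows "tensor_lift P \<phi> t = tensor_lift P \<psi> t"
proof -
  interpret linear_tensor k M N "carrier k" "\<lambda>x c. c \<odot>\<^bsub>M\<^esub> x" "smult N" "tensor k M N"
    by (rule linear_tensor_tensor) fact+
  have P: "abelian_group P" using assms(3) by (simp add: module_def)
  have \<phi>: "\<phi> \<in> balanced_maps (carrier k) M (\<lambda>x c. c \<odot>\<^bsub>M\<^esub> x) N (smult N) P"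
    using assms(4) bilinear_scalar[OF assms(4)] by (rule bilinear_balanced)
  show ?thesis
    by (rule lift_cong[OF P P _ _ \<phi>]) (use assms(5,6) in \<open>simp_all add: carrier_T\<close>)
qed

lemma tensor_lift_tensor_space:
  assumes "module k M" "module k N" "module k M'" "module k N'" "\<phi> \<in> bilinear k M N (tensor k M' N')"
    and "t \<in> carrier (tensor k M N)"
    and "\<And>x y. x \<in> carrier M \<Longrightarrow> y \<in> carrier N \<Longrightarrow> \<phi> x y = \<psi> x y"
  shows "tensor_lift (tensor_space k M' N') \<psi> t = tensor_lift (tensor k M' N') \<phi> t"
proof -
  interpret linear_tensor k M N "carrier k" "\<lambda>x c. c \<odot>\<^bsub>M\<^esub> x" "smult N" "tensor k M N"
    by (rule linear_tensor_tensor) fact+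
  interpret T': linear_tensor k M' N' "carrier k" "\<lambda>x c. c \<odot>\<^bsub>M'\<^esub> x" "smult N'" "tensor k M' N'"
    by (rule linear_tensor_tensor) fact+
  have \<phi>: "\<phi> \<in> balanced_maps (carrier k) M (\<lambda>x c. c \<odot>\<^bsub>M\<^esub> x) N (smult N) (tensor k M' N')"
    using assms(5) bilinear_scalar[OF assms(5)] by (rule bilinear_balanced)
  have P: "abelian_group (tensor_space k M' N')"
    unfolding tensor_space_def by (rule T'.abelian_group_BT)
  have "tensor_lift (tensor k M' N') \<phi> t = tensor_lift (tensor_space k M' N') \<psi> t"
    by (rule lift_cong[OF T'.abelian_group_T P _ _ \<phi>])
      (use assms(6,7) in \<open>simp_all add: carrier_T T'.carrier_T T'.add_T tensor_space_def\<close>)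
  then show ?thesis ..
qed

lemma bilinear_app_left:
  assumes "\<beta> \<in> bilinear k M N P" "f \<in> linear_map k A M" "y \<in> carrier N"
  shows "(\<lambda>a. \<beta> (f a) y) \<in> linear_map k A P"
  using linear_map_comp[OF assms(2) bilinear_left[OF assms(1,3)]] .

lemma bilinear_app_right:
  assumes "\<beta> \<in> bilinear k M N P" "f \<in> linear_map k A N" "x \<in> carrier M"
  shows "(\<lambda>a. \<beta> x (f a)) \<in> linear_map k A P"
  using linear_map_comp[OF assms(2) bilinear_right[OF assms(1,3)]] .

lemma bilinear_comp:
  assumes "\<phi> \<in> bilinear k M N P" "f \<in> linear_map k P Q"
  shows "(\<lambda>x y. f (\<phi> x y)) \<in> bilinear k M N Q"
  using bilinearD[OF assms(1)] assms(2) by (intro bilinearI linear_map_comp[OF _ assms(2)]) auto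

text \<open>Both sides are linear in \<open>t\<close> and agree on pure tensors. Specialised to a
  coproduct, this moves a linear map under a Sweedler sum or pulls it out.\<close>

lemma tensor_lift_fuse:
  assumes M: "module k M" "module k N" and P: "module k P" "module k Q"
    and \<phi>: "\<phi> \<in> bilinear k M N P" and f: "f \<in> linear_map k P Q" and t: "t \<in> carrier (tensor k M N)"
  shows "f (tensor_lift P \<phi> t) = tensor_lift Q (\<lambda>x y. f (\<phi> x y)) t"
proof (rule tensor_ext[OF M _ _ _ t])
  show "(\<lambda>t. f (tensor_lift P \<phi> t)) \<in> linear_map k (tensor k M N) Q"
    by (rule linear_map_comp[OF tensor_lift_linear[OF M P(1) \<phi>] f])
  show "tensor_lift Q (\<lambda>x y. f (\<phi> x y)) \<in> linear_map k (tensor k M N) Q"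
    by (rule tensor_lift_linear[OF M P(2) bilinear_comp[OF \<phi> f]])
  show "f (tensor_lift P \<phi> (ptensor k M N x y)) = tensor_lift Q (\<lambda>x y. f (\<phi> x y)) (ptensor k M N x y)"
    if "x \<in> carrier M" "y \<in> carrier N" for x y
    using that by (simp add: tensor_lift_ptensor[OF M P(1) \<phi>] tensor_lift_ptensor[OF M P(2) bilinear_comp[OF \<phi> f]])
qed

lemma tensor_lift_closed:
  "module k M \<Longrightarrow> module k N \<Longrightarrow> module k P \<Longrightarrow> \<phi> \<in> bilinear k M N P \<Longrightarrow> t \<in> carrier (tensor k M N) \<Longrightarrow>
    tensor_lift P \<phi> t \<in> carrier P"
  by (rule linear_map_closed[OF tensor_lift_linear])

text \<open>For pure \<open>t\<close> this is the assumption, and sums of linear maps are linear. It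
  is what makes nested Sweedler sums linear in the outer variables on which an inner summand
  depends.\<close>

lemma tensor_lift_linear_parameter:
  assumes M: "module k M" "module k N" and P: "module k P" and A: "module k A"
    and lin: "\<And>x y. x \<in> carrier M \<Longrightarrow> y \<in> carrier N \<Longrightarrow> (\<lambda>a. \<phi> a x y) \<in> linear_map k A P"
    and bil: "\<And>a. a \<in> carrier A \<Longrightarrow> (\<lambda>x y. \<phi> a x y) \<in> bilinear k M N P"
    and t: "t \<in> carrier (tensor k M N)"
  shows "(\<lambda>a. tensor_lift P (\<lambda>x y. \<phi> a x y) t) \<in> linear_map k A P"
  using M t
proof (induction t rule: tensor_induct)
  case (pure x y)
  show ?case
    by (rule linear_map_cong[OF lin[OF pure] A]) (simp add: tensor_lift_ptensor[OF M P bil] pure)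
next
  case (add t u)
  show ?case
    by (rule linear_map_cong[OF linear_map_plus[OF P add(3,4)] A])
      (simp add: linear_map_add[OF tensor_lift_linear[OF M P bil]] add(1,2))
qed

lemma ptensor_closed:
  "module k M \<Longrightarrow> module k N \<Longrightarrow> x \<in> carrier M \<Longrightarrow> y \<in> carrier N \<Longrightarrow> ptensor k M N x y \<in> carrier (tensor k M N)"
  by (rule bilinear_closed[OF ptensor_bilinear])

lemma ptensor_linear_left:
  "module k M \<Longrightarrow> module k N \<Longrightarrow> f \<in> linear_map k A M \<Longrightarrow> y \<in> carrier N \<Longrightarrow>
    (\<lambda>a. ptensor k M N (f a) y) \<in> linear_map k A (tensor k M N)"
  by (rule bilinear_app_left[OF ptensor_bilinear])

lemma ptensor_linear_right:
  "module k M \<Longrightarrow> module k N \<Longrightarrow> f \<in> linear_map k A N \<Longrightarrow> x \<in> carrier M \<Longrightarrow>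
    (\<lambda>a. ptensor k M N x (f a)) \<in> linear_map k A (tensor k M N)"
  by (rule bilinear_app_right[OF ptensor_bilinear])

lemma (in k_algebra) module_A: "module k A"
  by unfold_locales

lemma (in k_algebra) mult_bilinear: "(\<lambda>x y. x \<otimes>\<^bsub>A\<^esub> y) \<in> bilinear k A A A"
  by (intro bilinearI linear_mapI) (simp_all add: smult_mult_left smult_mult_right A.l_distr A.r_distr)

lemma (in k_algebra) mult_linear_left:
  "f \<in> linear_map k B A \<Longrightarrow> y \<in> carrier A \<Longrightarrow> (\<lambda>b. f b \<otimes>\<^bsub>A\<^esub> y) \<in> linear_map k B A"
  by (rule bilinear_app_left[OF mult_bilinear])

lemma (in k_algebra) mult_linear_right:
  "f \<in> linear_map k B A \<Longrightarrow> x \<in> carrier A \<Longrightarrow> (\<lambda>b. x \<otimes>\<^bsub>A\<^esub> f b) \<in> linear_map k B A"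
  by (rule bilinear_app_right[OF mult_bilinear])

section \<open>Multiplication on a tensor product of algebras\<close>

locale two_algebras = M: k_algebra k M + N: k_algebra k N
  for k :: "('k, 'x) ring_scheme" and M :: "('k, 'm, 'y) module_scheme" and N :: "('k, 'n, 'z) module_scheme"
begin

abbreviation "T \<equiv> tensor k M N"

lemmas rules = M.module_A N.module_A module_tensor ptensor_closed ptensor_linear_left ptensor_linear_right
  M.mult_linear_left M.mult_linear_right N.mult_linear_left N.mult_linear_right linear_map_id
  M.A.m_closed N.A.m_closed bilinearI
  tensor_lift_closed[OF M.module_A N.module_A] tensor_lift_linear_parameter[OF M.module_A N.module_A]

lemma mult_inner:
  assumes "x \<in> carrier M" "y \<in> carrier N" "t \<in> carrier T"
  shows "tensor_lift (tensor_space k M N) (\<lambda>x' y'. ptensor k M N (x \<otimes>\<^bsub>M\<^esub> x') (y \<otimes>\<^bsub>N\<^esub> y')) t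
       = tensor_lift T (\<lambda>x' y'. ptensor k M N (x \<otimes>\<^bsub>M\<^esub> x') (y \<otimes>\<^bsub>N\<^esub> y')) t"
  by (rule tensor_lift_tensor_space[OF M.module_A N.module_A M.module_A N.module_A]) (insert assms, (assumption | rule rules refl)+)

lemma mult_eq:
  assumes "t \<in> carrier T" "u \<in> carrier T"
  shows "t \<otimes>\<^bsub>T\<^esub> u = tensor_lift T (\<lambda>x y. tensor_lift T (\<lambda>x' y'. ptensor k M N (x \<otimes>\<^bsub>M\<^esub> x') (y \<otimes>\<^bsub>N\<^esub> y')) u) t"
proof -
  have "t \<otimes>\<^bsub>T\<^esub> u = tensor_lift (tensor_space k M N) (\<lambda>x y. tensor_lift (tensor_space k M N) (\<lambda>x' y'. ptensor k M N (x \<otimes>\<^bsub>M\<^esub> x') (y \<otimes>\<^bsub>N\<^esub> y')) u) t"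
    by (simp add: tensor_def)
  also have "\<dots> = tensor_lift T (\<lambda>x y. tensor_lift T (\<lambda>x' y'. ptensor k M N (x \<otimes>\<^bsub>M\<^esub> x') (y \<otimes>\<^bsub>N\<^esub> y')) u) t"
    by (rule tensor_lift_tensor_space[OF M.module_A N.module_A M.module_A N.module_A])
      (insert assms, (assumption | rule rules mult_inner[symmetric])+)
  finally show ?thesis .
qed

text \<open>The product is a lift nested in a lift, so the two variables play different roles:
  linearity in the left one is that of the outer lift, linearity in the right one is linearity in a
  parameter.\<close>

lemma mult_bilinear: "(\<lambda>t u. t \<otimes>\<^bsub>T\<^esub> u) \<in> bilinear k T T T"
proof (rule bilinearI)
  have T: "module k T" by (rule rules)+
  fix t assume t: "t \<in> carrier T"
  show "(\<lambda>u. t \<otimes>\<^bsub>T\<^esub> u) \<in> linear_map k T T"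
    by (rule linear_map_cong[OF tensor_lift_linear_parameter[where M = M and N = N and t = t] T mult_eq[OF t, symmetric]])
      (insert t, (assumption | rule rules tensor_lift_linear)+)
  show "(\<lambda>u. u \<otimes>\<^bsub>T\<^esub> t) \<in> linear_map k T T"
    by (rule linear_map_cong[OF tensor_lift_linear[OF M.module_A N.module_A] T mult_eq[OF _ t, symmetric]])
      (insert t, (assumption | rule rules)+)
qed

lemma mult_ptensor:
  assumes "x \<in> carrier M" "x' \<in> carrier M" "y \<in> carrier N" "y' \<in> carrier N"
  shows "ptensor k M N x y \<otimes>\<^bsub>T\<^esub> ptensor k M N x' y' = ptensor k M N (x \<otimes>\<^bsub>M\<^esub> x') (y \<otimes>\<^bsub>N\<^esub> y')"
proof -
  have "ptensor k M N x y \<otimes>\<^bsub>T\<^esub> ptensor k M N x' y' =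
      tensor_lift T (\<lambda>x y. tensor_lift T (\<lambda>x' y'. ptensor k M N (x \<otimes>\<^bsub>M\<^esub> x') (y \<otimes>\<^bsub>N\<^esub> y')) (ptensor k M N x' y')) (ptensor k M N x y)"
    by (rule mult_eq) (insert assms, (assumption | rule rules)+)
  also have "\<dots> = tensor_lift T (\<lambda>x' y'. ptensor k M N (x \<otimes>\<^bsub>M\<^esub> x') (y \<otimes>\<^bsub>N\<^esub> y')) (ptensor k M N x' y')"
    by (rule tensor_lift_ptensor) (insert assms, (assumption | rule rules)+)
  also have "\<dots> = ptensor k M N (x \<otimes>\<^bsub>M\<^esub> x') (y \<otimes>\<^bsub>N\<^esub> y')"
    by (rule tensor_lift_ptensor) (insert assms, (assumption | rule rules)+)
  finally show ?thesis .
qed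

end


section \<open>Sweedler calculus\<close>

text \<open>Stands for \<open>\<phi> h\<^sub>1 h\<^sub>2\<close>. Longer Sweedler expressions are
  nested: splitting the first or the second component again gives two readings of
  \<open>\<phi> h\<^sub>1 h\<^sub>2 h\<^sub>3\<close>.\<close>

definition sweedler ::
  "('k, 'h, 'y) hopf_scheme \<Rightarrow> ('p, 'z) ring_scheme \<Rightarrow> ('h \<Rightarrow> 'h \<Rightarrow> 'p) \<Rightarrow> 'h \<Rightarrow> 'p"
where
  "sweedler H P \<phi> h = tensor_lift P \<phi> (comul H h)"

context hopf_algebra
begin

abbreviation hopf_mult (infixl "\<star>" 70) where "x \<star> y \<equiv> x \<otimes>\<^bsub>H\<^esub> y"
abbreviation "HH \<equiv> tensor k H H"
abbreviation "S \<equiv> antipode H"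
abbreviation "e \<equiv> counit H"
abbreviation "sw \<equiv> sweedler H"

lemma comul_linear: "comul H \<in> linear_map k H HH"
  using comul_hom by (simp add: algebra_hom_def)

lemma comul_closed: "h \<in> carrier H \<Longrightarrow> comul H h \<in> carrier HH"
  by (rule linear_map_closed[OF comul_linear])

lemma counit_linear: "e \<in> linear_map k H (ground_algebra k)"
  using counit_hom by (simp add: algebra_hom_def)

lemma counit_closed: "h \<in> carrier H \<Longrightarrow> e h \<in> carrier k"
  using linear_map_closed[OF counit_linear] by (simp add: ground_algebra_def)

lemma counit_mult: "a \<in> carrier H \<Longrightarrow> b \<in> carrier H \<Longrightarrow> e (a \<star> b) = e a \<otimes>\<^bsub>k\<^esub> e b"
  using counit_hom by (simp add: algebra_hom_def ring_hom_def ground_algebra_def)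

lemma counit_one: "e \<one>\<^bsub>H\<^esub> = \<one>\<^bsub>k\<^esub>"
  using counit_hom by (simp add: algebra_hom_def ring_hom_def ground_algebra_def)

lemma counit_add: "a \<in> carrier H \<Longrightarrow> b \<in> carrier H \<Longrightarrow> e (a \<oplus>\<^bsub>H\<^esub> b) = e a \<oplus>\<^bsub>k\<^esub> e b"
  using linear_map_add[OF counit_linear] by (simp add: ground_algebra_def)

lemma counit_smult: "c \<in> carrier k \<Longrightarrow> a \<in> carrier H \<Longrightarrow> e (c \<odot>\<^bsub>H\<^esub> a) = c \<otimes>\<^bsub>k\<^esub> e a"
  using linear_map_smult[OF counit_linear] by (simp add: ground_algebra_def)

lemma antipode_closed: "h \<in> carrier H \<Longrightarrow> S h \<in> carrier H"
  by (rule linear_map_closed[OF antipode_linear])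

lemma counit_scale_linear:
  assumes "module k P" "f \<in> linear_map k B H" "p \<in> carrier P"
  shows "(\<lambda>b. e (f b) \<odot>\<^bsub>P\<^esub> p) \<in> linear_map k B P"
proof -
  interpret P: module k P by fact
  show ?thesis
    using linear_mapD[OF assms(2)] assms(3)
    by (intro linear_mapI) (simp_all add: counit_closed counit_add counit_smult P.smult_l_distr P.smult_assoc1)
qed

lemma antipode_app_linear: "f \<in> linear_map k B H \<Longrightarrow> (\<lambda>b. S (f b)) \<in> linear_map k B H"
  by (rule linear_map_comp[OF _ antipode_linear])

lemma sweedler_linear: "module k P \<Longrightarrow> \<phi> \<in> bilinear k H H P \<Longrightarrow> sw P \<phi> \<in> linear_map k H P"
  unfolding sweedler_def by (rule linear_map_comp[OF comul_linear tensor_lift_linear[OF module_A module_A]])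

lemma sweedler_app_linear:
  "module k P \<Longrightarrow> \<phi> \<in> bilinear k H H P \<Longrightarrow> f \<in> linear_map k B H \<Longrightarrow> (\<lambda>b. sw P \<phi> (f b)) \<in> linear_map k B P"
  by (rule linear_map_comp[OF _ sweedler_linear])

lemma sweedler_closed: "module k P \<Longrightarrow> \<phi> \<in> bilinear k H H P \<Longrightarrow> h \<in> carrier H \<Longrightarrow> sw P \<phi> h \<in> carrier P"
  by (rule linear_map_closed[OF sweedler_linear])

lemma sweedler_linear_parameter:
  assumes "module k P" "module k B"
    and "\<And>x y. x \<in> carrier H \<Longrightarrow> y \<in> carrier H \<Longrightarrow> (\<lambda>b. \<phi> b x y) \<in> linear_map k B P"
    and "\<And>b. b \<in> carrier B \<Longrightarrow> (\<lambda>x y. \<phi> b x y) \<in> bilinear k H H P"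
    and "h \<in> carrier H"
  shows "(\<lambda>b. sw P (\<lambda>x y. \<phi> b x y) h) \<in> linear_map k B P"
  unfolding sweedler_def
  by (rule tensor_lift_linear_parameter[OF module_A module_A assms(1,2) assms(3,4) comul_closed[OF assms(5)]])

lemma sweedler_cong:
  assumes "module k P" "\<phi> \<in> bilinear k H H P" "h \<in> carrier H"
    and "\<And>x y. x \<in> carrier H \<Longrightarrow> y \<in> carrier H \<Longrightarrow> \<phi> x y = \<psi> x y"
  shows "sw P \<phi> h = sw P \<psi> h"
  unfolding sweedler_def
  by (rule tensor_lift_cong[OF module_A module_A assms(1,2) comul_closed[OF assms(3)] assms(4)])

lemma sweedler_fuse:
  assumes "module k P" "module k Q" "\<phi> \<in> bilinear k H H P" "f \<in> linear_map k P Q" "h \<in> carrier H"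
  shows "f (sw P \<phi> h) = sw Q (\<lambda>x y. f (\<phi> x y)) h"
  unfolding sweedler_def
  by (rule tensor_lift_fuse[OF module_A module_A assms(1-4) comul_closed[OF assms(5)]])

text \<open>Closure properties under which linear expressions are built. With them, linearity in
  each variable of an expression made of products, tensors, \<open>S\<close> and \<open>e\<close>
  follows from its shape alone; this settles the side conditions of nearly every Sweedler
  step.\<close>

lemmas base_rules = module_A module_tensor ptensor_closed ptensor_linear_left ptensor_linear_right
  mult_linear_left mult_linear_right linear_map_id A.m_closed A.one_closed antipode_closed counit_closed
  linear_map_smult_const counit_scale_linear antipode_app_linear bilinearI
  smult_closed comul_closed linear_map_comp[OF _ comul_linear]

lemmas sw_rules = base_rules sweedler_closed sweedler_app_linear sweedler_linear_parameter

section \<open>Coassociativity, counit and antipode under multilinear maps\<close>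

definition trilinear where
  "trilinear P = {\<phi>. (\<forall>y\<in>carrier H. \<forall>z\<in>carrier H. (\<lambda>x. \<phi> x y z) \<in> linear_map k H P) \<and>
     (\<forall>x\<in>carrier H. \<forall>z\<in>carrier H. (\<lambda>y. \<phi> x y z) \<in> linear_map k H P) \<and>
     (\<forall>x\<in>carrier H. \<forall>y\<in>carrier H. (\<lambda>z. \<phi> x y z) \<in> linear_map k H P)}"

lemma trilinearI:
  assumes "\<And>y z. y \<in> carrier H \<Longrightarrow> z \<in> carrier H \<Longrightarrow> (\<lambda>x. \<phi> x y z) \<in> linear_map k H P"
    and "\<And>x z. x \<in> carrier H \<Longrightarrow> z \<in> carrier H \<Longrightarrow> (\<lambda>y. \<phi> x y z) \<in> linear_map k H P"
    and "\<And>x y. x \<in> carrier H \<Longrightarrow> y \<in> carrier H \<Longrightarrow> (\<lambda>z. \<phi> x y z) \<in> linear_map k H P"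
  shows "(\<lambda>x y z. \<phi> x y z) \<in> trilinear P"
  using assms by (simp add: trilinear_def)

lemma trilinearD:
  assumes "\<phi> \<in> trilinear P"
  shows "\<And>y z. y \<in> carrier H \<Longrightarrow> z \<in> carrier H \<Longrightarrow> (\<lambda>x. \<phi> x y z) \<in> linear_map k H P"
    and "\<And>x z. x \<in> carrier H \<Longrightarrow> z \<in> carrier H \<Longrightarrow> (\<lambda>y. \<phi> x y z) \<in> linear_map k H P"
    and "\<And>x y. x \<in> carrier H \<Longrightarrow> y \<in> carrier H \<Longrightarrow> (\<lambda>z. \<phi> x y z) \<in> linear_map k H P"
  using assms by (auto simp: trilinear_def)

text \<open>A trilinear \<open>\<phi>\<close> factors through a linear map \<open>\<Psi>\<close> on
  \<open>H \<otimes> (H \<otimes> H)\<close>. Applying \<open>\<Psi>\<close> to the coassociativity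
  axiom and moving it under the sums turns the two sides of the axiom into the two nestings.\<close>

lemma sweedler_coassoc:
  assumes P: "module k P" and \<phi>: "\<phi> \<in> trilinear P" and h: "h \<in> carrier H"
  shows "sw P (\<lambda>x y. sw P (\<lambda>a b. \<phi> a b y) x) h = sw P (\<lambda>x y. sw P (\<lambda>a b. \<phi> x a b) y) h"
proof -
  let ?T3 = "tensor k H HH"
  let ?assoc = "\<lambda>t z. tensor_lift ?T3 (\<lambda>x y. ptensor k H HH x (ptensor k H H y z)) t"
  define \<Psi> where "\<Psi> = tensor_lift P (\<lambda>x t. tensor_lift P (\<lambda>y z. \<phi> x y z) t)"
  note T = trilinearD[OF \<phi>]
  have inner: "(\<lambda>x t. tensor_lift P (\<lambda>y z. \<phi> x y z) t) \<in> bilinear k H HH P"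
    by (rule bilinearI) (assumption | rule base_rules P tensor_lift_linear[OF module_A module_A] tensor_lift_linear_parameter[OF module_A module_A] T)+
  have \<Psi>: "\<Psi> \<in> linear_map k ?T3 P"
    unfolding \<Psi>_def by (rule tensor_lift_linear[OF module_A module_tensor[OF module_A module_A] P inner])
  have \<Psi>_pure: "\<Psi> (ptensor k H HH x (ptensor k H H y z)) = \<phi> x y z"
    if "x \<in> carrier H" "y \<in> carrier H" "z \<in> carrier H" for x y z
  proof -
    have "\<Psi> (ptensor k H HH x (ptensor k H H y z)) = tensor_lift P (\<lambda>y z. \<phi> x y z) (ptensor k H H y z)"
      unfolding \<Psi>_def by (rule tensor_lift_ptensor[OF _ _ _ inner]) (insert that P, (assumption | rule base_rules)+)
    also have "\<dots> = \<phi> x y z"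
      by (rule tensor_lift_ptensor) (insert that P T, (assumption | rule base_rules T)+)
    finally show ?thesis .
  qed
  have assoc: "(\<lambda>t z. ?assoc t z) \<in> bilinear k HH H ?T3"
    by (rule bilinearI) (assumption | rule base_rules P tensor_lift_linear[OF module_A module_A] tensor_lift_linear_parameter[OF module_A module_A] T)+
  have assoc_lin: "tensor_assoc k H H H \<in> linear_map k (tensor k HH H) ?T3"
    unfolding tensor_assoc_def
    by (rule tensor_lift_linear[OF _ _ _ assoc]) (rule base_rules)+
  have "\<Psi> (tensor_assoc k H H H (tensor_map k HH H (comul H) (\<lambda>x. x) (comul H h)))
      = \<Psi> (tensor_assoc k H H H (sw (tensor k HH H) (\<lambda>x y. ptensor k HH H (comul H x) y) h))"
    by (simp add: tensor_map_def sweedler_def)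
  also have "\<dots> = \<Psi> (sw ?T3 (\<lambda>x y. tensor_assoc k H H H (ptensor k HH H (comul H x) y)) h)"
    by (subst sweedler_fuse[OF _ _ _ assoc_lin h]) (assumption | rule base_rules refl)+
  also have "\<dots> = sw P (\<lambda>x y. \<Psi> (tensor_assoc k H H H (ptensor k HH H (comul H x) y))) h"
    by (rule sweedler_fuse[OF _ P _ \<Psi> h]) (assumption | rule base_rules linear_map_comp[OF _ assoc_lin])+
  also have "\<dots> = sw P (\<lambda>x y. sw P (\<lambda>a b. \<phi> a b y) x) h"
  proof (rule sweedler_cong[OF P _ h])
    show "(\<lambda>x y. \<Psi> (tensor_assoc k H H H (ptensor k HH H (comul H x) y))) \<in> bilinear k H H P"
      by (assumption | rule base_rules linear_map_comp[OF _ \<Psi>] linear_map_comp[OF _ assoc_lin])+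
    fix x y assume x: "x \<in> carrier H" and y: "y \<in> carrier H"
    have "tensor_assoc k H H H (ptensor k HH H (comul H x) y) = sw ?T3 (\<lambda>a b. ptensor k H HH a (ptensor k H H b y)) x"
      unfolding tensor_assoc_def sweedler_def
      by (rule tensor_lift_ptensor[OF _ _ _ assoc]) (insert x y, (assumption | rule base_rules)+)
    also have "\<Psi> \<dots> = sw P (\<lambda>a b. \<Psi> (ptensor k H HH a (ptensor k H H b y))) x"
      by (rule sweedler_fuse[OF _ P _ \<Psi> x]) (insert y, (assumption | rule base_rules)+)
    also have "\<dots> = sw P (\<lambda>a b. \<phi> a b y) x"
      by (rule sweedler_cong[OF P _ x]) (insert y, (assumption | rule base_rules linear_map_comp[OF _ \<Psi>] \<Psi>_pure)+)
    finally show "\<Psi> (tensor_assoc k H H H (ptensor k HH H (comul H x) y)) = sw P (\<lambda>a b. \<phi> a b y) x" .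
  qed
  finally have L: "\<Psi> (tensor_assoc k H H H (tensor_map k HH H (comul H) (\<lambda>x. x) (comul H h)))
      = sw P (\<lambda>x y. sw P (\<lambda>a b. \<phi> a b y) x) h" .
  have "\<Psi> (tensor_map k H HH (\<lambda>x. x) (comul H) (comul H h)) = \<Psi> (sw ?T3 (\<lambda>x y. ptensor k H HH x (comul H y)) h)"
    by (simp add: tensor_map_def sweedler_def)
  also have "\<dots> = sw P (\<lambda>x y. \<Psi> (ptensor k H HH x (comul H y))) h"
    by (rule sweedler_fuse[OF _ P _ \<Psi> h]) (assumption | rule base_rules)+
  also have "\<dots> = sw P (\<lambda>x y. sw P (\<lambda>a b. \<phi> x a b) y) h"
  proof (rule sweedler_cong[OF P _ h])
    show "(\<lambda>x y. \<Psi> (ptensor k H HH x (comul H y))) \<in> bilinear k H H P"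
      by (assumption | rule base_rules linear_map_comp[OF _ \<Psi>])+
    fix x y assume x: "x \<in> carrier H" and y: "y \<in> carrier H"
    show "\<Psi> (ptensor k H HH x (comul H y)) = sw P (\<lambda>a b. \<phi> x a b) y"
      unfolding \<Psi>_def sweedler_def
      by (rule tensor_lift_ptensor[OF _ _ P inner]) (insert x y, (assumption | rule base_rules)+)
  qed
  finally show ?thesis using L coassoc[OF h] by simp
qed

end

lemma (in field) module_ground_algebra: "module R (ground_algebra R)"
  by (rule moduleI)
    (auto simp: ground_algebra_def l_distr r_distr m_assoc a_assoc intro!: abelian_groupI intro: is_cring a_comm add.l_inv_ex)

context hopf_algebra
begin

text \<open>The counit axiom is pushed through \<open>f\<close>, so that a factor \<open>e x\<close>
  can be absorbed in front of any linear expression and not only in \<open>H\<close> itself.\<close>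

lemma sweedler_counit_left:
  assumes P: "module k P" and f: "f \<in> linear_map k H P" and h: "h \<in> carrier H"
  shows "sw P (\<lambda>x y. e x \<odot>\<^bsub>P\<^esub> f y) h = f h"
proof -
  have "f h = f (sw H (\<lambda>x y. e x \<odot>\<^bsub>H\<^esub> y) h)"
    using counit_left[OF h] by (simp add: sweedler_def)
  also have "\<dots> = sw P (\<lambda>x y. f (e x \<odot>\<^bsub>H\<^esub> y)) h"
    by (rule sweedler_fuse[OF _ P _ f h]) (assumption | rule sw_rules)+
  also have "\<dots> = sw P (\<lambda>x y. e x \<odot>\<^bsub>P\<^esub> f y) h"
    by (rule sweedler_cong[OF P _ h])
      (assumption | rule sw_rules linear_map_comp[OF _ f] linear_map_smult[OF f])+
  finally show ?thesis ..
qed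

lemma sweedler_counit_right:
  assumes P: "module k P" and f: "f \<in> linear_map k H P" and h: "h \<in> carrier H"
  shows "sw P (\<lambda>x y. e y \<odot>\<^bsub>P\<^esub> f x) h = f h"
proof -
  have "f h = f (sw H (\<lambda>x y. e y \<odot>\<^bsub>H\<^esub> x) h)"
    using counit_right[OF h] by (simp add: sweedler_def)
  also have "\<dots> = sw P (\<lambda>x y. f (e y \<odot>\<^bsub>H\<^esub> x)) h"
    by (rule sweedler_fuse[OF _ P _ f h]) (assumption | rule sw_rules)+
  also have "\<dots> = sw P (\<lambda>x y. e y \<odot>\<^bsub>P\<^esub> f x) h"
    by (rule sweedler_cong[OF P _ h])
      (assumption | rule sw_rules linear_map_comp[OF _ f] linear_map_smult[OF f])+
  finally show ?thesis ..
qed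

text \<open>Covers both antipode axioms, so that each cancellation law is proved only once.\<close>

definition antipodal where
  "antipodal = {m. m \<in> bilinear k H H H \<and> (\<forall>h\<in>carrier H. sw H m h = e h \<odot>\<^bsub>H\<^esub> \<one>\<^bsub>H\<^esub>)}"

lemma antipodal_left: "(\<lambda>x y. S x \<star> y) \<in> antipodal"
  unfolding antipodal_def mem_Collect_eq
  by (intro conjI ballI) ((assumption | rule sw_rules)+, simp add: sweedler_def antipode_left)

lemma antipodal_right: "(\<lambda>x y. x \<star> S y) \<in> antipodal"
  unfolding antipodal_def mem_Collect_eq
  by (intro conjI ballI) ((assumption | rule sw_rules)+, simp add: sweedler_def antipode_right)

text \<open>Both equations say that \<open>\<psi> (m h\<^sub>1 h\<^sub>2) h\<^sub>3\<close>
  collapses to \<open>\<psi> 1 h\<close>. In the first nesting the antipode axiom is visible,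
  leaving \<open>e h\<^sub>1\<close> for the counit to absorb; the second, which is the one arising
  in applications, follows by coassociativity.\<close>

lemma sweedler_cancel_left:
  assumes P: "module k P" and m: "m \<in> antipodal" and \<psi>: "\<psi> \<in> bilinear k H H P" and h: "h \<in> carrier H"
  shows "sw P (\<lambda>x y. sw P (\<lambda>a b. \<psi> (m a b) y) x) h = \<psi> \<one>\<^bsub>H\<^esub> h"
    and "sw P (\<lambda>x y. sw P (\<lambda>a b. \<psi> (m x a) b) y) h = \<psi> \<one>\<^bsub>H\<^esub> h"
proof -
  have m': "m \<in> bilinear k H H H" using m by (simp add: antipodal_def)
  note rs = sw_rules P bilinear_app_left[OF \<psi>] bilinear_app_right[OF \<psi>] bilinear_closed[OF \<psi>]
    bilinear_app_left[OF m'] bilinear_app_right[OF m'] bilinear_closed[OF m']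
  have "sw P (\<lambda>x y. sw P (\<lambda>a b. \<psi> (m a b) y) x) h = sw P (\<lambda>x y. e x \<odot>\<^bsub>P\<^esub> \<psi> \<one>\<^bsub>H\<^esub> y) h"
  proof (rule sweedler_cong[OF P _ h])
    show "(\<lambda>x y. sw P (\<lambda>a b. \<psi> (m a b) y) x) \<in> bilinear k H H P"
      by (assumption | rule rs)+
    fix x y assume x: "x \<in> carrier H" and y: "y \<in> carrier H"
    have "sw P (\<lambda>a b. \<psi> (m a b) y) x = \<psi> (sw H m x) y"
      by (rule sweedler_fuse[OF module_A P m' bilinear_left[OF \<psi> y] x, symmetric])
    also have "\<dots> = \<psi> (e x \<odot>\<^bsub>H\<^esub> \<one>\<^bsub>H\<^esub>) y"
      using m x by (simp add: antipodal_def)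
    also have "\<dots> = e x \<odot>\<^bsub>P\<^esub> \<psi> \<one>\<^bsub>H\<^esub> y"
      using linear_map_smult[OF bilinear_left[OF \<psi> y]] x by (simp add: counit_closed)
    finally show "sw P (\<lambda>a b. \<psi> (m a b) y) x = e x \<odot>\<^bsub>P\<^esub> \<psi> \<one>\<^bsub>H\<^esub> y" .
  qed
  also have "\<dots> = \<psi> \<one>\<^bsub>H\<^esub> h"
    by (rule sweedler_counit_left[OF P _ h]) (rule bilinear_right[OF \<psi> A.one_closed])
  finally show "sw P (\<lambda>x y. sw P (\<lambda>a b. \<psi> (m a b) y) x) h = \<psi> \<one>\<^bsub>H\<^esub> h" .
  moreover have "sw P (\<lambda>x y. sw P (\<lambda>a b. \<psi> (m a b) y) x) h = sw P (\<lambda>x y. sw P (\<lambda>a b. \<psi> (m x a) b) y) h"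
    by (rule sweedler_coassoc[OF P _ h]) (rule trilinearI; (assumption | rule rs)+)
  ultimately show "sw P (\<lambda>x y. sw P (\<lambda>a b. \<psi> (m x a) b) y) h = \<psi> \<one>\<^bsub>H\<^esub> h" by simp
qed

text \<open>The mirror image, cancelling the last two of three components:
  \<open>\<psi> h\<^sub>1 (m h\<^sub>2 h\<^sub>3)\<close> is \<open>\<psi> h 1\<close>.\<close>

lemma sweedler_cancel_right:
  assumes P: "module k P" and m: "m \<in> antipodal" and \<psi>: "\<psi> \<in> bilinear k H H P" and h: "h \<in> carrier H"
  shows "sw P (\<lambda>x y. sw P (\<lambda>a b. \<psi> x (m a b)) y) h = \<psi> h \<one>\<^bsub>H\<^esub>"
    and "sw P (\<lambda>x y. sw P (\<lambda>a b. \<psi> a (m b y)) x) h = \<psi> h \<one>\<^bsub>H\<^esub>"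
proof -
  have m': "m \<in> bilinear k H H H" using m by (simp add: antipodal_def)
  note rs = sw_rules P bilinear_app_left[OF \<psi>] bilinear_app_right[OF \<psi>] bilinear_closed[OF \<psi>]
    bilinear_app_left[OF m'] bilinear_app_right[OF m'] bilinear_closed[OF m']
  have "sw P (\<lambda>x y. sw P (\<lambda>a b. \<psi> x (m a b)) y) h = sw P (\<lambda>x y. e y \<odot>\<^bsub>P\<^esub> \<psi> x \<one>\<^bsub>H\<^esub>) h"
  proof (rule sweedler_cong[OF P _ h])
    show "(\<lambda>x y. sw P (\<lambda>a b. \<psi> x (m a b)) y) \<in> bilinear k H H P"
      by (assumption | rule rs)+
    fix x y assume x: "x \<in> carrier H" and y: "y \<in> carrier H"
    have "sw P (\<lambda>a b. \<psi> x (m a b)) y = \<psi> x (sw H m y)"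
      by (rule sweedler_fuse[OF module_A P m' bilinear_right[OF \<psi> x] y, symmetric])
    also have "\<dots> = \<psi> x (e y \<odot>\<^bsub>H\<^esub> \<one>\<^bsub>H\<^esub>)"
      using m y by (simp add: antipodal_def)
    also have "\<dots> = e y \<odot>\<^bsub>P\<^esub> \<psi> x \<one>\<^bsub>H\<^esub>"
      using linear_map_smult[OF bilinear_right[OF \<psi> x]] y by (simp add: counit_closed)
    finally show "sw P (\<lambda>a b. \<psi> x (m a b)) y = e y \<odot>\<^bsub>P\<^esub> \<psi> x \<one>\<^bsub>H\<^esub>" .
  qed
  also have "\<dots> = \<psi> h \<one>\<^bsub>H\<^esub>"
    by (rule sweedler_counit_right[OF P _ h]) (rule bilinear_left[OF \<psi> A.one_closed])
  finally show "sw P (\<lambda>x y. sw P (\<lambda>a b. \<psi> x (m a b)) y) h = \<psi> h \<one>\<^bsub>H\<^esub>" .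
  moreover have "sw P (\<lambda>x y. sw P (\<lambda>a b. \<psi> a (m b y)) x) h = sw P (\<lambda>x y. sw P (\<lambda>a b. \<psi> x (m a b)) y) h"
    by (rule sweedler_coassoc[OF P _ h]) (rule trilinearI; (assumption | rule rs)+)
  ultimately show "sw P (\<lambda>x y. sw P (\<lambda>a b. \<psi> a (m b y)) x) h = \<psi> h \<one>\<^bsub>H\<^esub>" by simp
qed

section \<open>Sweedler sums of products and the antipode\<close>

lemma two_algebras_HH: "two_algebras k H H"
  by (simp add: two_algebras_def k_algebra_axioms)

text \<open>Multiplicativity of the coproduct in the form
  \<open>\<phi> (a\<^sub>1 b\<^sub>1) (a\<^sub>2 b\<^sub>2)\<close>. The identity is proved for
  arbitrary elements of \<open>HH\<close> in place of the two coproducts, where it may be tested on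
  pure tensors one argument at a time.\<close>

lemma sweedler_mult:
  assumes P: "module k P" and \<phi>: "\<phi> \<in> bilinear k H H P" and a: "a \<in> carrier H" and b: "b \<in> carrier H"
  shows "sw P \<phi> (a \<star> b) = sw P (\<lambda>x y. sw P (\<lambda>u v. \<phi> (x \<star> u) (y \<star> v)) b) a"
proof -
  interpret HH: two_algebras k H H by (rule two_algebras_HH)
  note rs = sw_rules P bilinear_app_left[OF \<phi>] bilinear_app_right[OF \<phi>] bilinear_closed[OF \<phi>]
    tensor_lift_closed[OF module_A module_A] tensor_lift_linear[OF module_A module_A]
    tensor_lift_linear_parameter[OF module_A module_A]
  have \<phi>': "tensor_lift P \<phi> \<in> linear_map k HH P"
    by (rule tensor_lift_linear[OF module_A module_A P \<phi>])
  have *: "tensor_lift P \<phi> (t \<otimes>\<^bsub>HH\<^esub> u) = tensor_lift P (\<lambda>x y. tensor_lift P (\<lambda>u v. \<phi> (x \<star> u) (y \<star> v)) u) t"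
    if t: "t \<in> carrier HH" and u: "u \<in> carrier HH" for t u
  proof (rule tensor_ext[OF module_A module_A _ _ _ t])
    show "(\<lambda>t. tensor_lift P \<phi> (t \<otimes>\<^bsub>HH\<^esub> u)) \<in> linear_map k HH P"
      by (rule linear_map_comp[OF bilinear_left[OF HH.mult_bilinear u] \<phi>'])
    show "tensor_lift P (\<lambda>x y. tensor_lift P (\<lambda>u v. \<phi> (x \<star> u) (y \<star> v)) u) \<in> linear_map k HH P"
      by (insert u, (assumption | rule rs)+)
    fix x y assume x: "x \<in> carrier H" and y: "y \<in> carrier H"
    have "tensor_lift P \<phi> (ptensor k H H x y \<otimes>\<^bsub>HH\<^esub> u) = tensor_lift P (\<lambda>u v. \<phi> (x \<star> u) (y \<star> v)) u"
    proof (rule tensor_ext[OF module_A module_A _ _ _ u])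
      show "(\<lambda>u. tensor_lift P \<phi> (ptensor k H H x y \<otimes>\<^bsub>HH\<^esub> u)) \<in> linear_map k HH P"
        by (rule linear_map_comp[OF bilinear_right[OF HH.mult_bilinear] \<phi>']) (insert x y, (assumption | rule rs)+)
      show "tensor_lift P (\<lambda>u v. \<phi> (x \<star> u) (y \<star> v)) \<in> linear_map k HH P"
        by (insert x y, (assumption | rule rs)+)
      fix c d assume c: "c \<in> carrier H" and d: "d \<in> carrier H"
      have "tensor_lift P \<phi> (ptensor k H H x y \<otimes>\<^bsub>HH\<^esub> ptensor k H H c d) = \<phi> (x \<star> c) (y \<star> d)"
        unfolding HH.mult_ptensor[OF x c y d]
        by (rule tensor_lift_ptensor[OF _ _ P \<phi>]) (insert x y c d, (assumption | rule rs)+)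
      also have "\<dots> = tensor_lift P (\<lambda>u v. \<phi> (x \<star> u) (y \<star> v)) (ptensor k H H c d)"
        by (rule tensor_lift_ptensor[OF _ _ P, symmetric]) (insert x y c d, (assumption | rule rs)+)
      finally show "tensor_lift P \<phi> (ptensor k H H x y \<otimes>\<^bsub>HH\<^esub> ptensor k H H c d) =
        tensor_lift P (\<lambda>u v. \<phi> (x \<star> u) (y \<star> v)) (ptensor k H H c d)" .
    qed
    also have "\<dots> = tensor_lift P (\<lambda>x y. tensor_lift P (\<lambda>u v. \<phi> (x \<star> u) (y \<star> v)) u) (ptensor k H H x y)"
      by (rule tensor_lift_ptensor[OF _ _ P, symmetric]) (insert x y u, (assumption | rule rs)+)
    finally show "tensor_lift P \<phi> (ptensor k H H x y \<otimes>\<^bsub>HH\<^esub> u) =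
      tensor_lift P (\<lambda>x y. tensor_lift P (\<lambda>u v. \<phi> (x \<star> u) (y \<star> v)) u) (ptensor k H H x y)" .
  qed
  have "comul H (a \<star> b) = comul H a \<otimes>\<^bsub>HH\<^esub> comul H b"
    using comul_hom a b by (simp add: algebra_hom_def ring_hom_def)
  then show ?thesis
    unfolding sweedler_def using *[OF comul_closed[OF a] comul_closed[OF b]] by simp
qed

lemma sweedler_one:
  assumes P: "module k P" and \<phi>: "\<phi> \<in> bilinear k H H P"
  shows "sw P \<phi> \<one>\<^bsub>H\<^esub> = \<phi> \<one>\<^bsub>H\<^esub> \<one>\<^bsub>H\<^esub>"
proof -
  have "comul H \<one>\<^bsub>H\<^esub> = ptensor k H H \<one>\<^bsub>H\<^esub> \<one>\<^bsub>H\<^esub>"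
    using comul_hom by (simp add: algebra_hom_def ring_hom_def tensor_def)
  then show ?thesis
    unfolding sweedler_def using tensor_lift_ptensor[OF module_A module_A P \<phi>] by simp
qed

lemma antipode_one: "S \<one>\<^bsub>H\<^esub> = \<one>\<^bsub>H\<^esub>"
proof -
  have "sw H (\<lambda>x y. S x \<star> y) \<one>\<^bsub>H\<^esub> = S \<one>\<^bsub>H\<^esub> \<star> \<one>\<^bsub>H\<^esub>"
    by (rule sweedler_one) (assumption | rule sw_rules)+
  moreover have "sw H (\<lambda>x y. S x \<star> y) \<one>\<^bsub>H\<^esub> = \<one>\<^bsub>H\<^esub>"
    using antipodal_left by (simp add: antipodal_def counit_one)
  ultimately show ?thesis by (simp add: antipode_closed)
qed

text \<open>Independent Sweedler sums commute. The coproduct of \<open>y\<close> is replaced by a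
  variable tensor, in which both sides are linear; on pure tensors the sum over \<open>c\<close> and
  \<open>d\<close> disappears.\<close>

lemma sweedler_swap:
  assumes P: "module k P" and x: "x \<in> carrier H" and y: "y \<in> carrier H"
    and \<phi>: "\<And>a b. a \<in> carrier H \<Longrightarrow> b \<in> carrier H \<Longrightarrow> (\<lambda>c d. \<phi> a b c d) \<in> bilinear k H H P"
      "\<And>c d. c \<in> carrier H \<Longrightarrow> d \<in> carrier H \<Longrightarrow> (\<lambda>a b. \<phi> a b c d) \<in> bilinear k H H P"
  shows "sw P (\<lambda>a b. sw P (\<lambda>c d. \<phi> a b c d) y) x = sw P (\<lambda>c d. sw P (\<lambda>a b. \<phi> a b c d) x) y"
proof -
  note HH = module_A module_A
  have lin: "(\<lambda>a. \<phi> a b c d) \<in> linear_map k H P" "(\<lambda>b. \<phi> a b c d) \<in> linear_map k H P"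
      "(\<lambda>c. \<phi> a b c d) \<in> linear_map k H P" "(\<lambda>d. \<phi> a b c d) \<in> linear_map k H P"
    if "a \<in> carrier H" "b \<in> carrier H" "c \<in> carrier H" "d \<in> carrier H" for a b c d
    using bilinear_left[OF \<phi>(2)[OF that(3,4)] that(2)] bilinear_right[OF \<phi>(2)[OF that(3,4)] that(1)]
      bilinear_left[OF \<phi>(1)[OF that(1,2)] that(4)] bilinear_right[OF \<phi>(1)[OF that(1,2)] that(3)] by simp_all
  have "(\<lambda>t. sw P (\<lambda>a b. tensor_lift P (\<lambda>c d. \<phi> a b c d) t) x) (comul H y)
      = tensor_lift P (\<lambda>c d. sw P (\<lambda>a b. \<phi> a b c d) x) (comul H y)"
  proof (rule tensor_ext[OF HH _ _ _ comul_closed[OF y]])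
    show "(\<lambda>t. sw P (\<lambda>a b. tensor_lift P (\<lambda>c d. \<phi> a b c d) t) x) \<in> linear_map k HH P"
      by (insert P x, (assumption | rule sw_rules tensor_lift_linear[OF HH] tensor_lift_linear_parameter[OF HH] lin)+)
    show "tensor_lift P (\<lambda>c d. sw P (\<lambda>a b. \<phi> a b c d) x) \<in> linear_map k HH P"
      by (insert P x, (assumption | rule tensor_lift_linear[OF HH] sw_rules lin)+)
    fix c d assume c: "c \<in> carrier H" and d: "d \<in> carrier H"
    have "sw P (\<lambda>a b. tensor_lift P (\<lambda>c d. \<phi> a b c d) (ptensor k H H c d)) x = sw P (\<lambda>a b. \<phi> a b c d) x"
      by (rule sweedler_cong[OF P _ x])
        (insert P c d, (assumption | rule tensor_lift_ptensor[OF HH] sw_rules tensor_lift_linear_parameter[OF HH] lin)+)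
    also have "\<dots> = tensor_lift P (\<lambda>c d. sw P (\<lambda>a b. \<phi> a b c d) x) (ptensor k H H c d)"
      by (rule tensor_lift_ptensor[OF HH P, symmetric])
        (insert P c d x, (assumption | rule sw_rules lin)+)
    finally show "sw P (\<lambda>a b. tensor_lift P (\<lambda>c d. \<phi> a b c d) (ptensor k H H c d)) x =
      tensor_lift P (\<lambda>c d. sw P (\<lambda>a b. \<phi> a b c d) x) (ptensor k H H c d)" .
  qed
  then show ?thesis by (simp add: sweedler_def)
qed

text \<open>Both sides are computed from \<open>S(x\<^sub>1 y\<^sub>1) x\<^sub>2 y\<^sub>2 S(y\<^sub>3) S(x\<^sub>3)\<close>.\<close>

lemma antipode_mult:
  assumes x: "x \<in> carrier H" and y: "y \<in> carrier H"
  shows "S (x \<star> y) = S y \<star> S x"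
proof -
  \<comment> \<open>Here \<open>p\<close>, \<open>r\<close>, \<open>s\<close> are the three
    components of \<open>y\<close> and \<open>a\<close>, \<open>c\<close>, \<open>d\<close> those of
    \<open>x\<close>; \<open>q\<close> and \<open>b\<close> denote the intermediate elements that
    are split further.\<close>
  let ?g = "\<lambda>p r s a c d. S (a \<star> p) \<star> (c \<star> (r \<star> S s) \<star> S d)"
  note H = module_A
  have "S (x \<star> y) = sw H (\<lambda>a b. sw H (\<lambda>c d. S (a \<star> y) \<star> (c \<star> S d)) b) x"
    by (subst sweedler_cancel_right(1)[where \<psi> = "\<lambda>a z. S (a \<star> y) \<star> z", OF H antipodal_right])
      (insert x y, (assumption | rule sw_rules A.r_one[symmetric])+)
  also have "\<dots> = sw H (\<lambda>a b. sw H (\<lambda>c d. S (a \<star> y) \<star> (c \<star> \<one>\<^bsub>H\<^esub> \<star> S d)) b) x"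
    by (intro sweedler_cong) (insert x y, (assumption | rule sw_rules | simp)+)
  also have "\<dots> = sw H (\<lambda>p q. sw H (\<lambda>r s. sw H (\<lambda>a b. sw H (\<lambda>c d. ?g p r s a c d) b) x) q) y"
    by (rule sweedler_cancel_right(1)[where \<psi> = "\<lambda>p z. sw H (\<lambda>a b. sw H (\<lambda>c d. S (a \<star> p) \<star> (c \<star> z \<star> S d)) b) x",
          OF H antipodal_right, symmetric])
      (insert x y, (assumption | rule sw_rules)+)
  also have "\<dots> = sw H (\<lambda>q s. sw H (\<lambda>p r. sw H (\<lambda>a b. sw H (\<lambda>c d. ?g p r s a c d) b) x) q) y"
    by (rule sweedler_coassoc[symmetric, OF H _ y]) (rule trilinearI; insert x, (assumption | rule sw_rules)+)
  also have "\<dots> = sw H (\<lambda>q s. sw H (\<lambda>p r. sw H (\<lambda>b d. sw H (\<lambda>a c. ?g p r s a c d) b) x) q) y"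
    by (intro sweedler_cong sweedler_coassoc[symmetric, OF H _ x] trilinearI) (insert x y, (assumption | rule sw_rules)+)
  also have "\<dots> = sw H (\<lambda>q s. e q \<odot>\<^bsub>H\<^esub> (S s \<star> S x)) y"
  proof (rule sweedler_cong[OF H _ y])
    show "(\<lambda>q s. sw H (\<lambda>p r. sw H (\<lambda>b d. sw H (\<lambda>a c. ?g p r s a c d) b) x) q) \<in> bilinear k H H H"
      by (insert x, (assumption | rule sw_rules)+)
    fix q s assume q: "q \<in> carrier H" and s: "s \<in> carrier H"
    have "sw H (\<lambda>p r. sw H (\<lambda>b d. sw H (\<lambda>a c. ?g p r s a c d) b) x) q
        = sw H (\<lambda>b d. sw H (\<lambda>p r. sw H (\<lambda>a c. ?g p r s a c d) b) q) x"
      by (rule sweedler_swap[OF H q x]) (insert s, (assumption | rule sw_rules)+)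
    also have "\<dots> = sw H (\<lambda>b d. e b \<odot>\<^bsub>H\<^esub> (e q \<odot>\<^bsub>H\<^esub> (S s \<star> S d))) x"
    proof (rule sweedler_cong[OF H _ x])
      show "(\<lambda>b d. sw H (\<lambda>p r. sw H (\<lambda>a c. ?g p r s a c d) b) q) \<in> bilinear k H H H"
        by (insert q s, (assumption | rule sw_rules)+)
      fix b d assume b: "b \<in> carrier H" and d: "d \<in> carrier H"
      have "sw H (\<lambda>p r. sw H (\<lambda>a c. ?g p r s a c d) b) q = sw H (\<lambda>a c. sw H (\<lambda>p r. ?g p r s a c d) q) b"
        by (rule sweedler_swap[OF H q b]) (insert s d, (assumption | rule sw_rules)+)
      also have "\<dots> = sw H (\<lambda>a c. sw H (\<lambda>p r. S (a \<star> p) \<star> (c \<star> r) \<star> (S s \<star> S d)) q) b"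
        by (intro sweedler_cong) (insert q s d b, (assumption | rule sw_rules | simp add: A.m_assoc antipode_closed)+)
      \<comment> \<open>The pairs \<open>a\<close>, \<open>c\<close> and \<open>p\<close>,
        \<open>r\<close> together form the coproduct of the product \<open>b \<star> q\<close>, so
        that the antipode axiom applies to this product and leaves its counit.\<close>
      also have "\<dots> = sw H (\<lambda>u v. S u \<star> v \<star> (S s \<star> S d)) (b \<star> q)"
        by (rule sweedler_mult[symmetric]) (insert q s d b, (assumption | rule sw_rules)+)
      also have "\<dots> = sw H (\<lambda>u v. S u \<star> v) (b \<star> q) \<star> (S s \<star> S d)"
        by (rule sweedler_fuse[symmetric, where f = "\<lambda>z. z \<star> (S s \<star> S d)", OF H H])
          (insert q s d b, (assumption | rule sw_rules)+)
      also have "\<dots> = e b \<odot>\<^bsub>H\<^esub> (e q \<odot>\<^bsub>H\<^esub> (S s \<star> S d))"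
        using antipodal_left b q s d
        by (simp add: antipodal_def counit_mult smult_mult_left counit_closed antipode_closed smult_assoc1)
      finally show "sw H (\<lambda>p r. sw H (\<lambda>a c. ?g p r s a c d) b) q = e b \<odot>\<^bsub>H\<^esub> (e q \<odot>\<^bsub>H\<^esub> (S s \<star> S d))" .
    qed
    also have "\<dots> = e q \<odot>\<^bsub>H\<^esub> (S s \<star> S x)"
      by (rule sweedler_counit_left[OF H _ x]) (insert q s, (assumption | rule sw_rules)+)
    finally show "sw H (\<lambda>p r. sw H (\<lambda>b d. sw H (\<lambda>a c. ?g p r s a c d) b) x) q = e q \<odot>\<^bsub>H\<^esub> (S s \<star> S x)" .
  qed
  also have "\<dots> = S y \<star> S x"
    by (rule sweedler_counit_left[OF H _ y]) (insert x, (assumption | rule sw_rules)+)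
  finally show ?thesis .
qed

text \<open>A coproduct is a sum of pure tensors, hence an additively closed property of all values
  of \<open>\<phi>\<close> passes to the Sweedler sum. It serves for membership in \<open>I\<close>
  and for vanishing.\<close>

lemma sweedler_induct [consumes 3, case_names pure add]:
  assumes P: "module k P" and \<phi>: "\<phi> \<in> bilinear k H H P" and h: "h \<in> carrier H"
    and pure: "\<And>x y. x \<in> carrier H \<Longrightarrow> y \<in> carrier H \<Longrightarrow> Q (\<phi> x y)"
    and add: "\<And>p q. p \<in> carrier P \<Longrightarrow> q \<in> carrier P \<Longrightarrow> Q p \<Longrightarrow> Q q \<Longrightarrow> Q (p \<oplus>\<^bsub>P\<^esub> q)"
  shows "Q (sw P \<phi> h)"
proof -
  note lin = tensor_lift_linear[OF module_A module_A P \<phi>]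
  have "Q (tensor_lift P \<phi> t)" if "t \<in> carrier HH" for t
    using module_A module_A that
  proof (induction t rule: tensor_induct)
    case (pure x y)
    then show ?case using tensor_lift_ptensor[OF module_A module_A P \<phi>] assms(4) by simp
  next
    case (add t u)
    then show ?case using linear_map_add[OF lin] linear_map_closed[OF lin] assms(5) by simp
  qed
  then show ?thesis using comul_closed[OF h] by (simp add: sweedler_def)
qed

text \<open>Applying \<open>e\<close> to \<open>S(h\<^sub>1) h\<^sub>2 = e(h) 1\<close> gives
  \<open>e(S h\<^sub>1) e(h\<^sub>2)\<close> on the left, and the factor \<open>e(h\<^sub>2)\<close>
  is absorbed by the counit axiom.\<close>

lemma counit_antipode:
  assumes h: "h \<in> carrier H"
  shows "e (S h) = e h"
proof -
  let ?G = "ground_algebra k"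
  have G: "module k ?G" by (rule K.module_ground_algebra)
  have smult_G: "c \<odot>\<^bsub>?G\<^esub> d = c \<otimes>\<^bsub>k\<^esub> d" for c d by (simp add: ground_algebra_def)
  have lin: "(\<lambda>x. e (S x)) \<in> linear_map k H ?G"
    by (rule linear_map_comp[OF antipode_linear counit_linear])
  have "e (S h) = sw ?G (\<lambda>x y. e y \<odot>\<^bsub>?G\<^esub> e (S x)) h"
    by (rule sweedler_counit_right[OF G lin h, symmetric])
  also have "\<dots> = sw ?G (\<lambda>x y. e (S x \<star> y)) h"
  proof (rule sweedler_cong[OF G _ h, symmetric])
    show "(\<lambda>x y. e (S x \<star> y)) \<in> bilinear k H H ?G"
      by (assumption | rule sw_rules linear_map_comp[OF _ counit_linear])+
    show "e (S x \<star> y) = e y \<odot>\<^bsub>?G\<^esub> e (S x)" if "x \<in> carrier H" "y \<in> carrier H" for x y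
      using that by (simp add: counit_mult antipode_closed smult_G counit_closed K.m_comm)
  qed
  also have "\<dots> = e (sw H (\<lambda>x y. S x \<star> y) h)"
    by (rule sweedler_fuse[OF module_A G _ counit_linear h, symmetric]) (assumption | rule sw_rules)+
  also have "\<dots> = e h"
    using antipodal_left h by (simp add: antipodal_def counit_smult counit_closed counit_one)
  finally show ?thesis .
qed

end

section \<open>The quotient Hopf algebra\<close>

context hopf_algebra
begin

text \<open>The construction common to the comultiplication of a quotient and to its coaction.\<close>

lemma sweedler_algebra_hom:
  assumes M: "k_algebra k M" and N: "k_algebra k N"
    and f: "f \<in> algebra_hom k H M" and g: "g \<in> algebra_hom k H N"
  shows "(\<lambda>h. sw (tensor k M N) (\<lambda>a b. ptensor k M N (f a) (g b)) h) \<in> algebra_hom k H (tensor k M N)"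
proof -
  let ?T = "tensor k M N"
  let ?\<theta> = "\<lambda>h. sw ?T (\<lambda>a b. ptensor k M N (f a) (g b)) h"
  interpret two_algebras k M N using M N by (simp add: two_algebras_def)
  note MN = M.module_A N.module_A
  have T: "module k ?T" by (rule module_tensor[OF MN])
  have fl: "f \<in> linear_map k H M" and gl: "g \<in> linear_map k H N"
    using f g by (simp_all add: algebra_hom_def)
  have f': "f (x \<star> y) = f x \<otimes>\<^bsub>M\<^esub> f y" "g (x \<star> y) = g x \<otimes>\<^bsub>N\<^esub> g y"
    if "x \<in> carrier H" "y \<in> carrier H" for x y
    using f g that by (simp_all add: algebra_hom_def ring_hom_def)
  have one: "f \<one>\<^bsub>H\<^esub> = \<one>\<^bsub>M\<^esub>" "g \<one>\<^bsub>H\<^esub> = \<one>\<^bsub>N\<^esub>"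
    using f g by (simp_all add: algebra_hom_def ring_hom_def)
  note rs = sw_rules MN T linear_map_comp[OF _ fl] linear_map_comp[OF _ gl] linear_map_closed[OF fl] linear_map_closed[OF gl]
    bilinear_app_left[OF mult_bilinear] bilinear_app_right[OF mult_bilinear] bilinear_closed[OF mult_bilinear]
  have bil: "(\<lambda>a b. ptensor k M N (f a) (g b)) \<in> bilinear k H H ?T"
    by (assumption | rule rs)+
  have lin: "?\<theta> \<in> linear_map k H ?T"
    by (rule sweedler_linear[OF T bil])
  have "?\<theta> (x \<star> y) = ?\<theta> x \<otimes>\<^bsub>?T\<^esub> ?\<theta> y" if x: "x \<in> carrier H" and y: "y \<in> carrier H" for x y
  proof -
    have \<theta>y: "?\<theta> y \<in> carrier ?T" by (rule linear_map_closed[OF lin y])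
    have "?\<theta> (x \<star> y) = sw ?T (\<lambda>a b. sw ?T (\<lambda>c d. ptensor k M N (f (a \<star> c)) (g (b \<star> d))) y) x"
      by (rule sweedler_mult[OF T bil x y])
    also have "\<dots> = sw ?T (\<lambda>a b. ptensor k M N (f a) (g b) \<otimes>\<^bsub>?T\<^esub> ?\<theta> y) x"
    proof (rule sweedler_cong[OF T _ x])
      show "(\<lambda>a b. sw ?T (\<lambda>c d. ptensor k M N (f (a \<star> c)) (g (b \<star> d))) y) \<in> bilinear k H H ?T"
        by (insert y, (assumption | rule rs)+)
      fix a b assume a: "a \<in> carrier H" and b: "b \<in> carrier H"
      have pt: "ptensor k M N (f a) (g b) \<in> carrier ?T" by (insert a b, (assumption | rule rs)+)
      have "sw ?T (\<lambda>c d. ptensor k M N (f (a \<star> c)) (g (b \<star> d))) y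
          = sw ?T (\<lambda>c d. ptensor k M N (f a) (g b) \<otimes>\<^bsub>?T\<^esub> ptensor k M N (f c) (g d)) y"
        by (rule sweedler_cong[OF T _ y])
          (insert a b, (assumption | rule rs | simp add: f' mult_ptensor linear_map_closed[OF fl] linear_map_closed[OF gl])+)
      also have "\<dots> = ptensor k M N (f a) (g b) \<otimes>\<^bsub>?T\<^esub> ?\<theta> y"
        by (rule sweedler_fuse[OF T T bil bilinear_right[OF mult_bilinear pt] y, symmetric])
      finally show "sw ?T (\<lambda>c d. ptensor k M N (f (a \<star> c)) (g (b \<star> d))) y
          = ptensor k M N (f a) (g b) \<otimes>\<^bsub>?T\<^esub> ?\<theta> y" .
    qed
    also have "\<dots> = ?\<theta> x \<otimes>\<^bsub>?T\<^esub> ?\<theta> y"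
      by (rule sweedler_fuse[OF T T bil bilinear_left[OF mult_bilinear \<theta>y] x, symmetric])
    finally show ?thesis .
  qed
  moreover have "?\<theta> \<one>\<^bsub>H\<^esub> = \<one>\<^bsub>?T\<^esub>"
    unfolding sweedler_one[OF T bil] one by (simp add: tensor_def)
  ultimately show ?thesis
    using lin linear_mapD[OF lin] unfolding algebra_hom_def
    by (intro IntI ring_hom_memI) auto
qed

end

section \<open>Normal Hopf subalgebras and the ideal they generate\<close>

locale normal_subalgebra = hopf_algebra k H
  for k :: "('k, 'x) ring_scheme" (structure) and H :: "('k, 'h, 'y) hopf_scheme" (structure) +
  fixes K :: "'h set"
  assumes normal: "normal_hopf_subalgebra k H K"
begin

lemma K_hopf: "hopf_subalgebra k H K"
  using normal by (simp add: normal_hopf_subalgebra_def)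

lemma K_subring: "subring K H" and K_submodule: "submodule K k H"
  using K_hopf by (simp_all add: hopf_subalgebra_def)

lemma K_sub: "x \<in> K \<Longrightarrow> x \<in> carrier H"
  using subringE(1)[OF K_subring] by blast

lemmas K_closed = subringE(2,3,5-7)[OF K_subring] submodule.smult_closed[OF K_submodule]

lemma K_antipode: "x \<in> K \<Longrightarrow> S x \<in> K"
  using K_hopf by (auto simp: hopf_subalgebra_def)

text \<open>The coproduct of \<open>z\<close> comes from the tensor square of \<open>K\<close>,
  formed with the carrier of \<open>H\<close> replaced by \<open>K\<close>. Induction there provides
  pure tensors with both entries in \<open>K\<close>.\<close>

lemma K_comul_induct:
  assumes z: "z \<in> K"
    and pure: "\<And>x y. x \<in> K \<Longrightarrow> y \<in> K \<Longrightarrow> Q (ptensor k H H x y)"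
    and add: "\<And>t u. t \<in> carrier HH \<Longrightarrow> u \<in> carrier HH \<Longrightarrow> Q t \<Longrightarrow> Q u \<Longrightarrow> Q (t \<oplus>\<^bsub>HH\<^esub> u)"
  shows "Q (comul H z)"
proof -
  let ?K = "H\<lparr>carrier := K\<rparr>"
  have mK: "module k ?K"
    by (rule submodule.submodule_is_module[OF K_submodule module_A])
  have HH: "module k HH" by (rule module_tensor[OF module_A module_A])
  have incl: "(\<lambda>x. x) \<in> linear_map k ?K H"
    by (rule linear_mapI) (simp_all add: K_sub)
  have bil: "(\<lambda>x y. ptensor k H H x y) \<in> bilinear k ?K ?K HH"
    by (intro bilinearI) (insert incl module_A, auto intro: K_sub ptensor_linear_left ptensor_linear_right)
  note lin = tensor_lift_linear[OF mK mK HH bil]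
  obtain t where t: "t \<in> carrier (tensor k ?K ?K)" "comul H z = tensor_map k H H (\<lambda>x. x) (\<lambda>x. x) t"
    using K_hopf z unfolding hopf_subalgebra_def by blast
  have "Q (tensor_lift HH (\<lambda>x y. ptensor k H H x y) t)"
    using mK mK t(1)
  proof (induction t rule: tensor_induct)
    case (pure x y)
    then show ?case using tensor_lift_ptensor[OF mK mK HH bil pure] assms(2) by simp
  next
    case (add t u)
    then show ?case using linear_map_add[OF lin] linear_map_closed[OF lin] assms(3) by simp
  qed
  then show ?thesis using t(2) by (simp add: tensor_map_def)
qed

lemma K_sweedler_induct [consumes 3, case_names pure add]:
  assumes P: "module k P" and \<phi>: "\<phi> \<in> bilinear k H H P" and z: "z \<in> K"
    and pure: "\<And>x y. x \<in> K \<Longrightarrow> y \<in> K \<Longrightarrow> Q (\<phi> x y)"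
    and add: "\<And>p q. p \<in> carrier P \<Longrightarrow> q \<in> carrier P \<Longrightarrow> Q p \<Longrightarrow> Q q \<Longrightarrow> Q (p \<oplus>\<^bsub>P\<^esub> q)"
  shows "Q (sw P \<phi> z)"
  unfolding sweedler_def using z
proof (rule K_comul_induct)
  note lin = tensor_lift_linear[OF module_A module_A P \<phi>]
  show "Q (tensor_lift P \<phi> (ptensor k H H x y))" if "x \<in> K" "y \<in> K" for x y
    using that tensor_lift_ptensor[OF module_A module_A P \<phi>] pure by (simp add: K_sub)
  show "Q (tensor_lift P \<phi> (t \<oplus>\<^bsub>HH\<^esub> u))"
    if "t \<in> carrier HH" "u \<in> carrier HH" "Q (tensor_lift P \<phi> t)" "Q (tensor_lift P \<phi> u)" for t u
    using that linear_map_add[OF lin] linear_map_closed[OF lin] add by simp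
qed

text \<open>Allows identities that hold only on \<open>K\<close>, such as \<open>pr_mult_K\<close>,
  to be used under the Sweedler sum of an element of \<open>K\<close>. Bilinearity is required of
  both sides, because agreement on \<open>K\<close> does not transfer it from one to the
  other.\<close>

lemma K_sweedler_cong:
  assumes P: "module k P" and \<phi>: "\<phi> \<in> bilinear k H H P" and \<psi>: "\<psi> \<in> bilinear k H H P" and z: "z \<in> K"
    and eq: "\<And>x y. x \<in> K \<Longrightarrow> y \<in> K \<Longrightarrow> \<phi> x y = \<psi> x y"
  shows "sw P \<phi> z = sw P \<psi> z"
  unfolding sweedler_def using z
proof (rule K_comul_induct)
  note lin = tensor_lift_linear[OF module_A module_A P \<phi>] tensor_lift_linear[OF module_A module_A P \<psi>]
  show "tensor_lift P \<phi> (ptensor k H H x y) = tensor_lift P \<psi> (ptensor k H H x y)" if "x \<in> K" "y \<in> K" for x y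
    using that tensor_lift_ptensor[OF module_A module_A P \<phi>] tensor_lift_ptensor[OF module_A module_A P \<psi>] eq
    by (simp add: K_sub)
  show "tensor_lift P \<phi> (t \<oplus>\<^bsub>HH\<^esub> u) = tensor_lift P \<psi> (t \<oplus>\<^bsub>HH\<^esub> u)"
    if "t \<in> carrier HH" "u \<in> carrier HH" "tensor_lift P \<phi> t = tensor_lift P \<psi> t" "tensor_lift P \<phi> u = tensor_lift P \<psi> u" for t u
    using that linear_map_add[OF lin(1)] linear_map_add[OF lin(2)] by simp
qed

abbreviation "Kp \<equiv> augmentation_part k H K"
abbreviation "I \<equiv> ideal_prod H (carrier H) Kp"
abbreviation "L \<equiv> quotient_by k H K"
abbreviation "pr \<equiv> a_r_coset H I"

lemma Kp_iff: "z \<in> Kp \<longleftrightarrow> z \<in> K \<and> e z = \<zero>\<^bsub>k\<^esub>"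
  using K_sub by (auto simp: augmentation_part_def a_kernel_def kernel_def)

lemma I_sub: "x \<in> I \<Longrightarrow> x \<in> carrier H"
  by (induction rule: ideal_prod.induct) (auto simp: Kp_iff K_sub)

lemma I_zero: "\<zero>\<^bsub>H\<^esub> \<in> I"
proof -
  have "e \<zero>\<^bsub>H\<^esub> = \<zero>\<^bsub>k\<^esub>"
    using linear_map_zero[OF counit_linear module_A K.module_ground_algebra] by (simp add: ground_algebra_def)
  then have "\<one>\<^bsub>H\<^esub> \<star> \<zero>\<^bsub>H\<^esub> \<in> I"
    by (intro ideal_prod.prod) (simp_all add: Kp_iff K_closed)
  then show ?thesis by simp
qed

lemma I_smult: "x \<in> I \<Longrightarrow> c \<in> carrier k \<Longrightarrow> c \<odot>\<^bsub>H\<^esub> x \<in> I"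
proof (induction rule: ideal_prod.induct)
  case (prod i j)
  then have "c \<odot>\<^bsub>H\<^esub> i \<star> j \<in> I" by (intro ideal_prod.prod) auto
  then show ?case using prod by (simp add: smult_mult_left Kp_iff K_sub)
next
  case (sum s t)
  then show ?case by (simp add: smult_r_distr I_sub ideal_prod.sum)
qed

lemma I_left: "x \<in> I \<Longrightarrow> a \<in> carrier H \<Longrightarrow> a \<star> x \<in> I"
proof (induction rule: ideal_prod.induct)
  case (prod i j)
  then have "a \<star> i \<star> j \<in> I" by (intro ideal_prod.prod) auto
  then show ?case using prod by (simp add: A.m_assoc Kp_iff K_sub)
next
  case (sum s t)
  then show ?case by (simp add: A.r_distr I_sub ideal_prod.sum)
qed

text \<open>\<open>z a = a\<^sub>1 (S(a\<^sub>2) z a\<^sub>3)\<close> shows \<open>K\<^sup>+ H \<subseteq> H K\<^sup>+\<close>.\<close>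

lemma Kp_mult:
  assumes z: "z \<in> Kp" and a: "a \<in> carrier H"
  shows "z \<star> a \<in> I"
proof -
  have zH: "z \<in> carrier H" and zK: "z \<in> K" and ez: "e z = \<zero>\<^bsub>k\<^esub>" using z by (simp_all add: Kp_iff K_sub)
  \<comment> \<open>The adjoint action keeps \<open>z\<close> in \<open>K\<close> by normality, and
    in the kernel of \<open>e\<close> because \<open>e\<close> is multiplicative.\<close>
  have ad: "sw H (\<lambda>b c. S b \<star> z \<star> c) y \<in> Kp" if y: "y \<in> carrier H" for y
  proof -
    have "e (sw H (\<lambda>b c. S b \<star> z \<star> c) y) = \<zero>\<^bsub>k\<^esub>"
      using module_A _ y
    proof (rule sweedler_induct)
      show "(\<lambda>b c. S b \<star> z \<star> c) \<in> bilinear k H H H"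
        by (insert zH, (assumption | rule sw_rules)+)
      show "e (S b \<star> z \<star> c) = \<zero>\<^bsub>k\<^esub>" if "b \<in> carrier H" "c \<in> carrier H" for b c
        using that zH by (simp add: counit_mult antipode_closed ez counit_closed)
      show "e (p \<oplus>\<^bsub>H\<^esub> q) = \<zero>\<^bsub>k\<^esub>"
        if "p \<in> carrier H" "q \<in> carrier H" "e p = \<zero>\<^bsub>k\<^esub>" "e q = \<zero>\<^bsub>k\<^esub>" for p q
        using that by (simp add: counit_add)
    qed
    then show ?thesis
      using normal zK y by (simp add: Kp_iff normal_hopf_subalgebra_def sweedler_def)
  qed
  have "z \<star> a = \<one>\<^bsub>H\<^esub> \<star> z \<star> a" using zH a by simp
  also have "\<dots> = sw H (\<lambda>x y. sw H (\<lambda>b c. x \<star> S b \<star> z \<star> c) y) a"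
    by (rule sweedler_cancel_left(2)[where \<psi> = "\<lambda>u c. u \<star> z \<star> c", OF module_A antipodal_right _ a, symmetric])
      (insert zH, (assumption | rule sw_rules)+)
  also have "\<dots> = sw H (\<lambda>x y. x \<star> sw H (\<lambda>b c. S b \<star> z \<star> c) y) a"
  proof (rule sweedler_cong[OF module_A _ a])
    show "(\<lambda>x y. sw H (\<lambda>b c. x \<star> S b \<star> z \<star> c) y) \<in> bilinear k H H H"
      by (insert zH, (assumption | rule sw_rules)+)
    fix x y assume x: "x \<in> carrier H" and y: "y \<in> carrier H"
    have "sw H (\<lambda>b c. x \<star> S b \<star> z \<star> c) y = sw H (\<lambda>b c. x \<star> (S b \<star> z \<star> c)) y"
      by (rule sweedler_cong[OF module_A _ y])
        (insert zH x, (assumption | rule sw_rules | simp add: A.m_assoc antipode_closed)+)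
    also have "\<dots> = x \<star> sw H (\<lambda>b c. S b \<star> z \<star> c) y"
      by (rule sweedler_fuse[OF module_A module_A _ _ y, symmetric]) (insert zH x, (assumption | rule sw_rules)+)
    finally show "sw H (\<lambda>b c. x \<star> S b \<star> z \<star> c) y = x \<star> sw H (\<lambda>b c. S b \<star> z \<star> c) y" .
  qed
  also have "\<dots> \<in> I"
    using module_A _ a
  proof (rule sweedler_induct)
    show "(\<lambda>x y. x \<star> sw H (\<lambda>b c. S b \<star> z \<star> c) y) \<in> bilinear k H H H"
      by (insert zH, (assumption | rule sw_rules)+)
    show "x \<star> sw H (\<lambda>b c. S b \<star> z \<star> c) y \<in> I" if "x \<in> carrier H" "y \<in> carrier H" for x y
      using that ad by (intro ideal_prod.prod)
  qed (rule ideal_prod.sum)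
  finally show ?thesis .
qed

lemma I_right: "x \<in> I \<Longrightarrow> a \<in> carrier H \<Longrightarrow> x \<star> a \<in> I"
proof (induction rule: ideal_prod.induct)
  case (prod i j)
  then have "i \<star> (j \<star> a) \<in> I" by (intro I_left Kp_mult)
  then show ?case using prod by (simp add: A.m_assoc Kp_iff K_sub)
next
  case (sum s t)
  then show ?case by (simp add: A.l_distr I_sub ideal_prod.sum)
qed

lemma I_minus: "x \<in> I \<Longrightarrow> \<ominus>\<^bsub>H\<^esub> x \<in> I"
  using I_smult[of x "\<ominus>\<^bsub>k\<^esub> \<one>\<^bsub>k\<^esub>"] smult_l_minus[of "\<one>\<^bsub>k\<^esub>" x] I_sub[of x] by simp

lemma I_ideal: "ideal I H"
proof (rule idealI)
  show "ring H" by (rule A.ring_axioms)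
  show "subgroup I (add_monoid H)"
    by (rule subgroup.intro) (auto intro: I_sub ideal_prod.sum I_zero simp: I_minus a_inv_def[symmetric])
qed (auto intro: I_left I_right)

text \<open>The antipode reverses products, so \<open>H K\<^sup>+\<close> goes to
  \<open>K\<^sup>+ H\<close>, which \<open>Kp_mult\<close> brings back into
  \<open>I\<close>.\<close>

lemma I_antipode: "x \<in> I \<Longrightarrow> S x \<in> I"
proof (induction rule: ideal_prod.induct)
  case (prod i j)
  then have "S j \<star> S i \<in> I"
    by (intro Kp_mult) (simp_all add: Kp_iff K_antipode counit_antipode K_sub antipode_closed)
  then show ?case using prod by (simp add: antipode_mult Kp_iff K_sub)
next
  case (sum s t)
  then show ?case using linear_map_add[OF antipode_linear] by (simp add: I_sub ideal_prod.sum)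
qed

lemma I_counit: "x \<in> I \<Longrightarrow> e x = \<zero>\<^bsub>k\<^esub>"
  by (induction rule: ideal_prod.induct) (simp_all add: counit_mult counit_add Kp_iff K_sub I_sub counit_closed)

section \<open>The quotient algebra and its projection\<close>

lemma pr_eq_iff: "x \<in> carrier H \<Longrightarrow> y \<in> carrier H \<Longrightarrow> pr x = pr y \<longleftrightarrow> x \<ominus>\<^bsub>H\<^esub> y \<in> I"
  using A.quotient_eq_iff_same_a_r_cos[OF I_ideal] by simp

lemma pr_self: "x \<in> carrier H \<Longrightarrow> x \<in> pr x"
  using abelian_subgroup.a_rcos_self[OF abelian_subgroupI3[OF ideal.axioms(1)[OF I_ideal] A.is_abelian_group]] .

lemma pr_rep: "x \<in> carrier H \<Longrightarrow> y \<in> pr x \<Longrightarrow> y \<in> carrier H \<and> pr y = pr x"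
  using abelian_subgroup.a_repr_independence'[OF abelian_subgroupI3[OF ideal.axioms(1)[OF I_ideal] A.is_abelian_group], of y x]
    ideal.Icarr[OF I_ideal] M.a_r_coset_subset_G[of I x] I_sub by auto

lemma the_elem_pr:
  assumes x: "x \<in> carrier H" and f: "\<And>y. y \<in> carrier H \<Longrightarrow> pr y = pr x \<Longrightarrow> f y = f x"
  shows "the_elem (f ` pr x) = f x"
proof -
  have "f ` pr x = {f x}"
    using pr_rep[OF x] pr_self[OF x] f by blast
  then show ?thesis by simp
qed

lemma L_sel:
  "carrier L = pr ` carrier H" "add L = add (H Quot I)" "monoid.mult L = monoid.mult (H Quot I)"
  "\<one>\<^bsub>L\<^esub> = pr \<one>\<^bsub>H\<^esub>" "\<zero>\<^bsub>L\<^esub> = I" "smult L = (\<lambda>c U. the_elem ((\<lambda>x. pr (c \<odot>\<^bsub>H\<^esub> x)) ` U))"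
  "counit L = (\<lambda>U. the_elem (e ` U))" "antipode L = (\<lambda>U. the_elem ((\<lambda>x. pr (S x)) ` U))"
  "comul L = (\<lambda>U. the_elem ((\<lambda>x. tensor_map k (quotient_module H I) (quotient_module H I) pr pr (comul H x)) ` U))"
  by (auto simp: quotient_by_def hopf_quotient_def quotient_module_def ring.defs module.defs hopf.defs FactRing_def
      A_RCOSETS_def')

lemma pr_closed: "x \<in> carrier H \<Longrightarrow> pr x \<in> carrier L"
  by (simp add: L_sel)

lemma L_cases:
  assumes "u \<in> carrier L"
  obtains x where "x \<in> carrier H" "u = pr x"
  using assms by (auto simp: L_sel)

lemma pr_add: "x \<in> carrier H \<Longrightarrow> y \<in> carrier H \<Longrightarrow> pr x \<oplus>\<^bsub>L\<^esub> pr y = pr (x \<oplus>\<^bsub>H\<^esub> y)"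
  using ring_hom_add[OF ideal.rcos_ring_hom[OF I_ideal]] by (simp add: L_sel)

lemma pr_mult: "x \<in> carrier H \<Longrightarrow> y \<in> carrier H \<Longrightarrow> pr x \<otimes>\<^bsub>L\<^esub> pr y = pr (x \<star> y)"
  using ring_hom_mult[OF ideal.rcos_ring_hom[OF I_ideal]] by (simp add: L_sel)

lemma pr_zero: "\<zero>\<^bsub>L\<^esub> = pr \<zero>\<^bsub>H\<^esub>"
proof -
  have "I \<subseteq> carrier H" using I_sub by blast
  then show ?thesis by (simp add: L_sel M.a_coset_add_zero)
qed

lemma pr_I: "x \<in> I \<Longrightarrow> pr x = \<zero>\<^bsub>L\<^esub>"
  using pr_eq_iff[of x "\<zero>\<^bsub>H\<^esub>"] by (simp add: pr_zero I_sub M.minus_eq)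

lemma pr_smult:
  assumes "c \<in> carrier k" "x \<in> carrier H"
  shows "c \<odot>\<^bsub>L\<^esub> pr x = pr (c \<odot>\<^bsub>H\<^esub> x)"
  unfolding L_sel
proof (rule the_elem_pr)
  fix y assume y: "y \<in> carrier H" "pr y = pr x"
  then have "c \<odot>\<^bsub>H\<^esub> (y \<ominus>\<^bsub>H\<^esub> x) \<in> I"
    using assms by (intro I_smult) (simp_all add: pr_eq_iff)
  then show "pr (c \<odot>\<^bsub>H\<^esub> y) = pr (c \<odot>\<^bsub>H\<^esub> x)"
    using assms y by (simp add: pr_eq_iff M.minus_eq smult_r_distr smult_r_minus)
qed (use assms in simp)

lemma pr_linear: "pr \<in> linear_map k H L"
  by (rule linear_mapI) (simp_all add: pr_closed pr_add pr_smult)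

lemma k_algebra_L: "k_algebra k L"
proof -
  have ab: "abelian_group L"
  proof (rule abelian_groupI)
    show "\<zero>\<^bsub>L\<^esub> \<in> carrier L" by (simp add: pr_zero pr_closed)
    fix u assume "u \<in> carrier L"
    then obtain x where x: "x \<in> carrier H" "u = pr x" by (rule L_cases)
    show "\<zero>\<^bsub>L\<^esub> \<oplus>\<^bsub>L\<^esub> u = u" using x by (simp add: pr_zero pr_add)
    have "pr (\<ominus>\<^bsub>H\<^esub> x) \<oplus>\<^bsub>L\<^esub> u = \<zero>\<^bsub>L\<^esub>" using x by (simp add: pr_zero pr_add M.l_neg)
    then show "\<exists>v\<in>carrier L. v \<oplus>\<^bsub>L\<^esub> u = \<zero>\<^bsub>L\<^esub>"
      using x by (intro bexI[of _ "pr (\<ominus>\<^bsub>H\<^esub> x)"]) (simp_all add: pr_closed)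
    fix v assume "v \<in> carrier L"
    then obtain y where y: "y \<in> carrier H" "v = pr y" by (rule L_cases)
    show "u \<oplus>\<^bsub>L\<^esub> v \<in> carrier L" using x y by (simp add: pr_add pr_closed)
    show "u \<oplus>\<^bsub>L\<^esub> v = v \<oplus>\<^bsub>L\<^esub> u" using x y by (simp add: pr_add M.a_comm)
    fix w assume "w \<in> carrier L"
    then obtain z where z: "z \<in> carrier H" "w = pr z" by (rule L_cases)
    show "u \<oplus>\<^bsub>L\<^esub> v \<oplus>\<^bsub>L\<^esub> w = u \<oplus>\<^bsub>L\<^esub> (v \<oplus>\<^bsub>L\<^esub> w)" using x y z by (simp add: pr_add M.a_assoc)
  qed
  have mon: "monoid L"
  proof (rule monoidI)
    show "\<one>\<^bsub>L\<^esub> \<in> carrier L" by (simp add: L_sel(4) pr_closed)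
    fix u assume "u \<in> carrier L"
    then obtain x where x: "x \<in> carrier H" "u = pr x" by (rule L_cases)
    show "\<one>\<^bsub>L\<^esub> \<otimes>\<^bsub>L\<^esub> u = u" "u \<otimes>\<^bsub>L\<^esub> \<one>\<^bsub>L\<^esub> = u" using x by (simp_all add: L_sel(4) pr_mult)
    fix v assume "v \<in> carrier L"
    then obtain y where y: "y \<in> carrier H" "v = pr y" by (rule L_cases)
    show "u \<otimes>\<^bsub>L\<^esub> v \<in> carrier L" using x y by (simp add: pr_mult pr_closed)
    fix w assume "w \<in> carrier L"
    then obtain z where z: "z \<in> carrier H" "w = pr z" by (rule L_cases)
    show "u \<otimes>\<^bsub>L\<^esub> v \<otimes>\<^bsub>L\<^esub> w = u \<otimes>\<^bsub>L\<^esub> (v \<otimes>\<^bsub>L\<^esub> w)" using x y z by (simp add: pr_mult A.m_assoc)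
  qed
  have ring: "ring L"
  proof (rule ringI[OF ab mon])
    fix u v w assume "u \<in> carrier L" "v \<in> carrier L" "w \<in> carrier L"
    then obtain x y z where x: "x \<in> carrier H" "u = pr x" and y: "y \<in> carrier H" "v = pr y"
      and z: "z \<in> carrier H" "w = pr z" by (elim L_cases)
    show "(u \<oplus>\<^bsub>L\<^esub> v) \<otimes>\<^bsub>L\<^esub> w = u \<otimes>\<^bsub>L\<^esub> w \<oplus>\<^bsub>L\<^esub> v \<otimes>\<^bsub>L\<^esub> w" using x y z by (simp add: pr_mult pr_add A.l_distr)
    show "w \<otimes>\<^bsub>L\<^esub> (u \<oplus>\<^bsub>L\<^esub> v) = w \<otimes>\<^bsub>L\<^esub> u \<oplus>\<^bsub>L\<^esub> w \<otimes>\<^bsub>L\<^esub> v" using x y z by (simp add: pr_mult pr_add A.r_distr)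
  qed
  have mod: "module k L"
  proof (rule moduleI[OF K.is_cring ab])
    fix u v assume "u \<in> carrier L" "v \<in> carrier L"
    then obtain x y where x: "x \<in> carrier H" "u = pr x" and y: "y \<in> carrier H" "v = pr y"
      by (elim L_cases)
    show "\<one>\<^bsub>k\<^esub> \<odot>\<^bsub>L\<^esub> u = u" using x by (simp add: pr_smult)
    fix c assume c: "c \<in> carrier k"
    show "c \<odot>\<^bsub>L\<^esub> u \<in> carrier L" using c x by (simp add: pr_smult pr_closed)
    show "c \<odot>\<^bsub>L\<^esub> (u \<oplus>\<^bsub>L\<^esub> v) = c \<odot>\<^bsub>L\<^esub> u \<oplus>\<^bsub>L\<^esub> c \<odot>\<^bsub>L\<^esub> v"
      using c x y by (simp add: pr_smult pr_add smult_r_distr)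
    fix d assume d: "d \<in> carrier k"
    show "(c \<oplus>\<^bsub>k\<^esub> d) \<odot>\<^bsub>L\<^esub> u = c \<odot>\<^bsub>L\<^esub> u \<oplus>\<^bsub>L\<^esub> d \<odot>\<^bsub>L\<^esub> u"
      using c d x by (simp add: pr_smult pr_add smult_l_distr)
    show "(c \<otimes>\<^bsub>k\<^esub> d) \<odot>\<^bsub>L\<^esub> u = c \<odot>\<^bsub>L\<^esub> (d \<odot>\<^bsub>L\<^esub> u)"
      using c d x by (simp add: pr_smult smult_assoc1)
  qed
  show ?thesis
  proof (rule k_algebra.intro[OF K.field_axioms mod ring k_algebra_axioms.intro])
    fix c u v assume c: "c \<in> carrier k" and "u \<in> carrier L" "v \<in> carrier L"
    then obtain x y where x: "x \<in> carrier H" "u = pr x" and y: "y \<in> carrier H" "v = pr y"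
      by (elim L_cases)
    show "(c \<odot>\<^bsub>L\<^esub> u) \<otimes>\<^bsub>L\<^esub> v = c \<odot>\<^bsub>L\<^esub> (u \<otimes>\<^bsub>L\<^esub> v)" "u \<otimes>\<^bsub>L\<^esub> (c \<odot>\<^bsub>L\<^esub> v) = c \<odot>\<^bsub>L\<^esub> (u \<otimes>\<^bsub>L\<^esub> v)"
      using c x y by (simp_all add: pr_smult pr_mult smult_mult_left smult_mult_right)
  qed
qed

lemma module_L: "module k L"
  by (rule k_algebra.module_A[OF k_algebra_L])

lemma pr_algebra_hom: "pr \<in> algebra_hom k H L"
  unfolding algebra_hom_def using pr_linear
  by (auto intro!: ring_hom_memI simp: pr_closed pr_mult pr_add L_sel(4))

text \<open>The structure maps of \<open>L\<close> are defined by \<open>the_elem\<close> of the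
  image of a coset. This is the common reason why they are well defined: a linear map on
  \<open>H\<close> that vanishes on \<open>I\<close> is constant on cosets. Counit, antipode,
  comultiplication and the coordinate functionals of \<open>L\<close> are all obtained from
  it.\<close>

lemma quotient_map_linear:
  assumes P: "module k P" and f: "f \<in> linear_map k H P" and I: "\<And>x. x \<in> I \<Longrightarrow> f x = \<zero>\<^bsub>P\<^esub>"
  shows quotient_map_pr: "x \<in> carrier H \<Longrightarrow> the_elem (f ` pr x) = f x"
    and "(\<lambda>u. the_elem (f ` u)) \<in> linear_map k L P"
proof -
  interpret P: module k P by fact
  note fD = linear_mapD[OF f]
  show *: "the_elem (f ` pr x) = f x" if x: "x \<in> carrier H" for x
  proof (rule the_elem_pr[OF x])
    fix y assume y: "y \<in> carrier H" "pr y = pr x"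
    then have "f (y \<ominus>\<^bsub>H\<^esub> x) = \<zero>\<^bsub>P\<^esub>" using x I by (simp add: pr_eq_iff)
    then have "f y \<ominus>\<^bsub>P\<^esub> f x = \<zero>\<^bsub>P\<^esub>"
      using x y fD linear_map_minus[OF f module_A P] by (simp add: M.minus_eq P.minus_eq)
    moreover have "f y = f y \<ominus>\<^bsub>P\<^esub> f x \<oplus>\<^bsub>P\<^esub> f x"
      using fD(1)[OF y(1)] fD(1)[OF x] by (simp add: P.M.minus_eq P.M.a_assoc P.M.l_neg)
    ultimately show "f y = f x" using fD(1)[OF x] by simp
  qed
  show "(\<lambda>u. the_elem (f ` u)) \<in> linear_map k L P"
    by (rule linear_mapI) (auto elim!: L_cases simp: pr_add pr_smult * fD)
qed

text \<open>The element \<open>z - e(z) 1\<close> lies in \<open>K\<close> and has counit zero, so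
  it belongs to \<open>I\<close>. Thus \<open>K\<close> becomes scalar in the quotient, and by
  \<open>pr_mult_K\<close> it acts there through the counit from either side.\<close>

lemma pr_K:
  assumes z: "z \<in> K"
  shows "pr z = e z \<odot>\<^bsub>L\<^esub> pr \<one>\<^bsub>H\<^esub>"
proof -
  have zH: "z \<in> carrier H" by (rule K_sub[OF z])
  have ez: "e z \<in> carrier k" by (rule counit_closed[OF zH])
  have "e (z \<ominus>\<^bsub>H\<^esub> e z \<odot>\<^bsub>H\<^esub> \<one>\<^bsub>H\<^esub>) = \<zero>\<^bsub>k\<^esub>"
  proof -
    have "e (z \<ominus>\<^bsub>H\<^esub> e z \<odot>\<^bsub>H\<^esub> \<one>\<^bsub>H\<^esub>) = e z \<oplus>\<^bsub>k\<^esub> e ((\<ominus>\<^bsub>k\<^esub> e z) \<odot>\<^bsub>H\<^esub> \<one>\<^bsub>H\<^esub>)"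
      using zH ez by (simp add: M.minus_eq counit_add smult_l_minus)
    also have "\<dots> = \<zero>\<^bsub>k\<^esub>"
      using ez by (simp add: counit_smult counit_one K.r_neg)
    finally show ?thesis .
  qed
  then have "\<one>\<^bsub>H\<^esub> \<star> (z \<ominus>\<^bsub>H\<^esub> e z \<odot>\<^bsub>H\<^esub> \<one>\<^bsub>H\<^esub>) \<in> I"
    using z ez by (intro ideal_prod.prod) (simp_all add: Kp_iff M.minus_eq K_closed)
  then have "pr z = pr (e z \<odot>\<^bsub>H\<^esub> \<one>\<^bsub>H\<^esub>)"
    using zH ez by (simp add: pr_eq_iff)
  then show ?thesis using ez by (simp add: pr_smult)
qed

lemma pr_mult_K:
  assumes x: "x \<in> carrier H" and z: "z \<in> K"
  shows "pr (x \<star> z) = e z \<odot>\<^bsub>L\<^esub> pr x" "pr (z \<star> x) = e z \<odot>\<^bsub>L\<^esub> pr x"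
proof -
  interpret L: k_algebra k L by (rule k_algebra_L)
  have zH: "z \<in> carrier H" by (rule K_sub[OF z])
  have ez: "e z \<in> carrier k" by (rule counit_closed[OF zH])
  have "pr x \<otimes>\<^bsub>L\<^esub> pr z = e z \<odot>\<^bsub>L\<^esub> (pr x \<otimes>\<^bsub>L\<^esub> pr \<one>\<^bsub>H\<^esub>)" "pr z \<otimes>\<^bsub>L\<^esub> pr x = e z \<odot>\<^bsub>L\<^esub> (pr \<one>\<^bsub>H\<^esub> \<otimes>\<^bsub>L\<^esub> pr x)"
    using x ez by (simp_all add: pr_K[OF z] L.smult_mult_right L.smult_mult_left pr_closed)
  then show "pr (x \<star> z) = e z \<odot>\<^bsub>L\<^esub> pr x" "pr (z \<star> x) = e z \<odot>\<^bsub>L\<^esub> pr x"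
    using x zH by (simp_all add: pr_mult)
qed

section \<open>The Hopf structure of the quotient\<close>

abbreviation "LL \<equiv> tensor k L L"

lemma module_LL: "module k LL"
  by (rule module_tensor[OF module_L module_L])

lemmas qrules = sw_rules module_L linear_map_comp[OF _ pr_linear] linear_map_closed[OF pr_linear]

text \<open>The comultiplication of \<open>L\<close> is defined with the tensor square of the bare
  quotient module, while the Hopf axioms mention that of \<open>L\<close>. The two coincide because
  the construction reads only the module fields, which \<open>L\<close> shares.\<close>

lemma quotient_module_tensor:
  "tensor k (quotient_module H I) (quotient_module H I) = LL"
  "ptensor k (quotient_module H I) (quotient_module H I) = ptensor k L L"
proof -
  have [simp]: "carrier L = carrier (quotient_module H I)" "add L = add (quotient_module H I)"
    "monoid.mult L = monoid.mult (quotient_module H I)" "\<one>\<^bsub>L\<^esub> = \<one>\<^bsub>quotient_module H I\<^esub>" "smult L = smult (quotient_module H I)"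
    by (simp_all add: quotient_by_def hopf_quotient_def module.defs hopf.defs)
  have rel: "balanced_relators (carrier k) (quotient_module H I) (\<lambda>x c. c \<odot>\<^bsub>quotient_module H I\<^esub> x) (quotient_module H I) (smult (quotient_module H I))
      = balanced_relators (carrier k) L (\<lambda>x c. c \<odot>\<^bsub>L\<^esub> x) L (smult L)"
    by (simp add: balanced_relators_def)
  show p: "ptensor k (quotient_module H I) (quotient_module H I) = ptensor k L L"
    by (intro ext) (simp add: ptensor_def pure_tensor_def balanced_subgroup_def rel)
  have "tensor_space k (quotient_module H I) (quotient_module H I) = tensor_space k L L"
    by (simp add: tensor_space_def balanced_tensor_def balanced_group_def balanced_subgroup_def rel)
  then show "tensor k (quotient_module H I) (quotient_module H I) = LL"
    by (simp add: tensor_def p)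
qed

lemma comul_L_rep: "tensor_map k (quotient_module H I) (quotient_module H I) pr pr (comul H x)
    = sw LL (\<lambda>a b. ptensor k L L (pr a) (pr b)) x"
  by (simp add: tensor_map_def quotient_module_tensor sweedler_def)

text \<open>For \<open>j\<close> in \<open>K\<^sup>+\<close> the components of \<open>j\<close> lie
  in \<open>K\<close> and act on the quotient through the counit. The summand for \<open>i j\<close>
  is therefore that for \<open>i\<close>, scaled by \<open>e(j\<^sub>1) e(j\<^sub>2)\<close>; this
  factor sums to \<open>e(j) = 0\<close>.\<close>

lemma comul_I:
  assumes "x \<in> I"
  shows "sw LL (\<lambda>a b. ptensor k L L (pr a) (pr b)) x = \<zero>\<^bsub>LL\<^esub>"
proof -
  interpret LL: module k LL by (rule module_LL)
  have bil: "(\<lambda>a b. ptensor k L L (pr a) (pr b)) \<in> bilinear k H H LL"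
    by (assumption | rule qrules)+
  have lin: "sw LL (\<lambda>a b. ptensor k L L (pr a) (pr b)) \<in> linear_map k H LL"
    by (rule sweedler_linear[OF module_LL bil])
  from assms show ?thesis
  proof (induction rule: ideal_prod.induct)
    case (prod i j)
    then have i: "i \<in> carrier H" and j: "j \<in> K" "e j = \<zero>\<^bsub>k\<^esub>" by (simp_all add: Kp_iff)
    note jH = K_sub[OF j(1)]
    have inner: "sw LL (\<lambda>c d. ptensor k L L (pr (a \<star> c)) (pr (b \<star> d))) j = \<zero>\<^bsub>LL\<^esub>"
      if a: "a \<in> carrier H" and b: "b \<in> carrier H" for a b
    proof -
      let ?p = "ptensor k L L (pr a) (pr b)"
      have p: "?p \<in> carrier LL" using a b by (intro ptensor_closed module_L pr_closed)
      have "sw LL (\<lambda>c d. ptensor k L L (pr (a \<star> c)) (pr (b \<star> d))) j = sw LL (\<lambda>c d. e c \<odot>\<^bsub>LL\<^esub> (e d \<odot>\<^bsub>LL\<^esub> ?p)) j"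
      proof (rule K_sweedler_cong[OF module_LL _ _ j(1)])
        show "(\<lambda>c d. ptensor k L L (pr (a \<star> c)) (pr (b \<star> d))) \<in> bilinear k H H LL"
          by (insert a b, (assumption | rule qrules)+)
        show "(\<lambda>c d. e c \<odot>\<^bsub>LL\<^esub> (e d \<odot>\<^bsub>LL\<^esub> ?p)) \<in> bilinear k H H LL"
          by (insert p module_LL, (assumption | rule qrules | simp add: counit_closed)+)
        fix c d assume c: "c \<in> K" and d: "d \<in> K"
        have "e d \<odot>\<^bsub>LL\<^esub> (e c \<odot>\<^bsub>LL\<^esub> ?p) = e c \<odot>\<^bsub>LL\<^esub> (e d \<odot>\<^bsub>LL\<^esub> ?p)"
          using p c d by (simp add: LL.smult_assoc1[symmetric] K.m_comm counit_closed K_sub)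
        then show "ptensor k L L (pr (a \<star> c)) (pr (b \<star> d)) = e c \<odot>\<^bsub>LL\<^esub> (e d \<odot>\<^bsub>LL\<^esub> ?p)"
          using a b c d linear_map_smult[OF bilinear_left[OF ptensor_bilinear[OF module_L module_L]]]
            linear_map_smult[OF bilinear_right[OF ptensor_bilinear[OF module_L module_L]]]
          by (simp add: pr_mult_K pr_closed counit_closed K_sub module.smult_closed[OF module_L])
      qed
      also have "\<dots> = e j \<odot>\<^bsub>LL\<^esub> ?p"
        by (rule sweedler_counit_left[OF module_LL _ jH]) (insert p module_LL, (assumption | rule qrules)+)
      finally show ?thesis using p j(2) by simp
    qed
    have "sw LL (\<lambda>a b. sw LL (\<lambda>c d. ptensor k L L (pr (a \<star> c)) (pr (b \<star> d))) j) i = \<zero>\<^bsub>LL\<^esub>"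
      using module_LL _ i
    proof (rule sweedler_induct)
      show "(\<lambda>a b. sw LL (\<lambda>c d. ptensor k L L (pr (a \<star> c)) (pr (b \<star> d))) j) \<in> bilinear k H H LL"
        by (insert jH, (assumption | rule qrules)+)
    qed (simp_all add: inner)
    then show ?case using sweedler_mult[OF module_LL bil i jH] by simp
  next
    case (sum s t)
    then show ?case by (simp add: linear_map_add[OF lin] I_sub)
  qed
qed

lemma comul_L: "x \<in> carrier H \<Longrightarrow> comul L (pr x) = sw LL (\<lambda>a b. ptensor k L L (pr a) (pr b)) x"
  and comul_L_linear: "comul L \<in> linear_map k L LL"
proof -
  have lin: "(\<lambda>x. tensor_map k (quotient_module H I) (quotient_module H I) pr pr (comul H x)) \<in> linear_map k H LL"
    unfolding comul_L_rep by (assumption | rule sweedler_linear qrules)+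
  have zero: "tensor_map k (quotient_module H I) (quotient_module H I) pr pr (comul H x) = \<zero>\<^bsub>LL\<^esub>" if "x \<in> I" for x
    unfolding comul_L_rep by (rule comul_I[OF that])
  show "comul L (pr x) = sw LL (\<lambda>a b. ptensor k L L (pr a) (pr b)) x" if "x \<in> carrier H"
    using quotient_map_pr[OF module_LL lin zero that] unfolding L_sel(9) comul_L_rep .
  show "comul L \<in> linear_map k L LL"
    unfolding L_sel(9) by (rule quotient_map_linear[OF module_LL lin zero])
qed

lemma counit_L: "x \<in> carrier H \<Longrightarrow> counit L (pr x) = e x"
  and counit_L_linear: "counit L \<in> linear_map k L (ground_algebra k)"
proof -
  have G: "module k (ground_algebra k)" by (rule K.module_ground_algebra)
  have zero: "e x = \<zero>\<^bsub>ground_algebra k\<^esub>" if "x \<in> I" for x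
    using I_counit[OF that] by (simp add: ground_algebra_def)
  show "counit L (pr x) = e x" if "x \<in> carrier H"
    unfolding L_sel(7) by (rule quotient_map_pr[OF G counit_linear zero that])
  show "counit L \<in> linear_map k L (ground_algebra k)"
    unfolding L_sel(7) by (rule quotient_map_linear[OF G counit_linear zero])
qed

lemma antipode_L: "x \<in> carrier H \<Longrightarrow> antipode L (pr x) = pr (S x)"
  and antipode_L_linear: "antipode L \<in> linear_map k L L"
proof -
  have lin: "(\<lambda>x. pr (S x)) \<in> linear_map k H L"
    by (rule linear_map_comp[OF antipode_linear pr_linear])
  have zero: "pr (S x) = \<zero>\<^bsub>L\<^esub>" if "x \<in> I" for x
    by (rule pr_I[OF I_antipode[OF that]])
  show "antipode L (pr x) = pr (S x)" if "x \<in> carrier H"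
    unfolding L_sel(8) by (rule quotient_map_pr[OF module_L lin zero that])
  show "antipode L \<in> linear_map k L L"
    unfolding L_sel(8) by (rule quotient_map_linear[OF module_L lin zero])
qed

text \<open>\<open>f\<close> is the projection for the comultiplication of \<open>L\<close> and the identity for the coaction.\<close>

lemma tensor_lift_sweedler:
  assumes A: "module k A" and P: "module k P" and f: "f \<in> linear_map k H A" and \<phi>: "\<phi> \<in> bilinear k A L P"
    and x: "x \<in> carrier H"
  shows "tensor_lift P \<phi> (sw (tensor k A L) (\<lambda>a b. ptensor k A L (f a) (pr b)) x) = sw P (\<lambda>a b. \<phi> (f a) (pr b)) x"
proof -
  have AL: "module k (tensor k A L)" by (rule module_tensor[OF A module_L])
  note rs = qrules A P linear_map_comp[OF _ f] linear_map_closed[OF f] bilinear_app_left[OF \<phi>] bilinear_app_right[OF \<phi>]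
  have lin: "tensor_lift P \<phi> \<in> linear_map k (tensor k A L) P"
    by (rule tensor_lift_linear[OF A module_L P \<phi>])
  have bil: "(\<lambda>a b. ptensor k A L (f a) (pr b)) \<in> bilinear k H H (tensor k A L)"
    by (assumption | rule rs)+
  have "tensor_lift P \<phi> (sw (tensor k A L) (\<lambda>a b. ptensor k A L (f a) (pr b)) x)
      = sw P (\<lambda>a b. tensor_lift P \<phi> (ptensor k A L (f a) (pr b))) x"
    by (rule sweedler_fuse[OF AL P bil lin x])
  also have "\<dots> = sw P (\<lambda>a b. \<phi> (f a) (pr b)) x"
    by (rule sweedler_cong[OF P bilinear_comp[OF bil lin] x])
      (rule tensor_lift_ptensor[OF A module_L P \<phi>]; (assumption | rule rs)+)
  finally show ?thesis .
qed

lemma sweedler_L: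
  assumes "module k P" "\<phi> \<in> bilinear k L L P" "x \<in> carrier H"
  shows "sweedler L P \<phi> (pr x) = sw P (\<lambda>a b. \<phi> (pr a) (pr b)) x"
  unfolding sweedler_def[of L] comul_L[OF assms(3)]
  by (rule tensor_lift_sweedler[OF module_L assms(1) pr_linear assms(2,3)])

text \<open>With three components both sides are
  \<open>f x\<^sub>1 \<otimes> (pr x\<^sub>2 \<otimes> pr x\<^sub>3)\<close>, in different nestings,
  so coassociativity of \<open>H\<close> suffices. The two choices of \<open>f\<close> give
  coassociativity of \<open>L\<close> and that of the coaction.\<close>

lemma coaction_coassoc_aux:
  assumes A: "module k A" and f: "f \<in> linear_map k H A"
    and \<delta>: "\<delta> \<in> linear_map k A (tensor k A L)"
    and \<delta>_f: "\<And>x. x \<in> carrier H \<Longrightarrow> \<delta> (f x) = sw (tensor k A L) (\<lambda>a b. ptensor k A L (f a) (pr b)) x"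
    and x: "x \<in> carrier H"
  shows "tensor_assoc k A L L (tensor_map k (tensor k A L) L \<delta> (\<lambda>l. l) (\<delta> (f x)))
       = tensor_map k A LL (\<lambda>a. a) (comul L) (\<delta> (f x))"
proof -
  let ?AL = "tensor k A L"
  let ?T3 = "tensor k A LL"
  let ?assoc = "\<lambda>t z. tensor_lift ?T3 (\<lambda>x y. ptensor k A LL x (ptensor k L L y z)) t"
  have AL: "module k ?AL" by (rule module_tensor[OF A module_L])
  have T3: "module k ?T3" by (rule module_tensor[OF A module_LL])
  have T': "module k (tensor k ?AL L)" by (rule module_tensor[OF AL module_L])
  note rs = qrules A linear_map_comp[OF _ f] linear_map_closed[OF f] linear_map_comp[OF _ \<delta>] linear_map_closed[OF \<delta>]
    linear_map_comp[OF _ comul_L_linear] linear_map_closed[OF comul_L_linear]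
  have assoc: "(\<lambda>t z. ?assoc t z) \<in> bilinear k ?AL L ?T3"
    by (rule bilinearI) (assumption | rule rs tensor_lift_linear[OF A module_L] tensor_lift_linear_parameter[OF A module_L])+
  have assoc_lin: "tensor_assoc k A L L \<in> linear_map k (tensor k ?AL L) ?T3"
    unfolding tensor_assoc_def by (rule tensor_lift_linear[OF AL module_L T3 assoc])
  have "tensor_map k ?AL L \<delta> (\<lambda>l. l) (\<delta> (f x)) = sw (tensor k ?AL L) (\<lambda>a b. ptensor k ?AL L (\<delta> (f a)) (pr b)) x"
    unfolding tensor_map_def \<delta>_f[OF x]
    by (rule tensor_lift_sweedler[OF A T' f _ x]) (assumption | rule rs)+
  then have "tensor_assoc k A L L (tensor_map k ?AL L \<delta> (\<lambda>l. l) (\<delta> (f x)))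
      = tensor_assoc k A L L (sw (tensor k ?AL L) (\<lambda>a b. ptensor k ?AL L (\<delta> (f a)) (pr b)) x)" by simp
  also have "\<dots> = sw ?T3 (\<lambda>a b. tensor_assoc k A L L (ptensor k ?AL L (\<delta> (f a)) (pr b))) x"
    by (rule sweedler_fuse[OF T' T3 _ assoc_lin x]) (assumption | rule rs)+
  also have "\<dots> = sw ?T3 (\<lambda>a b. sw ?T3 (\<lambda>c d. ptensor k A LL (f c) (ptensor k L L (pr d) (pr b))) a) x"
  proof (rule sweedler_cong[OF T3 _ x])
    show "(\<lambda>a b. tensor_assoc k A L L (ptensor k ?AL L (\<delta> (f a)) (pr b))) \<in> bilinear k H H ?T3"
      by (assumption | rule rs linear_map_comp[OF _ assoc_lin])+
    fix a b assume a: "a \<in> carrier H" and b: "b \<in> carrier H"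
    have "tensor_assoc k A L L (ptensor k ?AL L (\<delta> (f a)) (pr b)) = ?assoc (\<delta> (f a)) (pr b)"
      unfolding tensor_assoc_def
      by (rule tensor_lift_ptensor[OF AL module_L T3 assoc]) (insert a b, (assumption | rule rs)+)
    also have "\<dots> = sw ?T3 (\<lambda>c d. ptensor k A LL (f c) (ptensor k L L (pr d) (pr b))) a"
      unfolding \<delta>_f[OF a]
      by (rule tensor_lift_sweedler[OF A T3 f _ a]) (insert b, (assumption | rule rs)+)
    finally show "tensor_assoc k A L L (ptensor k ?AL L (\<delta> (f a)) (pr b))
      = sw ?T3 (\<lambda>c d. ptensor k A LL (f c) (ptensor k L L (pr d) (pr b))) a" .
  qed
  also have "\<dots> = sw ?T3 (\<lambda>a b. sw ?T3 (\<lambda>c d. ptensor k A LL (f a) (ptensor k L L (pr c) (pr d))) b) x"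
    by (rule sweedler_coassoc[OF T3 trilinearI x]) (assumption | rule rs)+
  also have "\<dots> = sw ?T3 (\<lambda>a b. ptensor k A LL (f a) (comul L (pr b))) x"
  proof (rule sweedler_cong[OF T3 _ x, symmetric])
    show "(\<lambda>a b. ptensor k A LL (f a) (comul L (pr b))) \<in> bilinear k H H ?T3"
      by (assumption | rule rs)+
    fix a b assume a: "a \<in> carrier H" and b: "b \<in> carrier H"
    show "ptensor k A LL (f a) (comul L (pr b)) = sw ?T3 (\<lambda>c d. ptensor k A LL (f a) (ptensor k L L (pr c) (pr d))) b"
      unfolding comul_L[OF b]
      by (rule sweedler_fuse[OF module_LL T3 _ _ b]) (insert a, (assumption | rule rs)+)
  qed
  also have "\<dots> = tensor_map k A LL (\<lambda>a. a) (comul L) (\<delta> (f x))"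
    unfolding tensor_map_def \<delta>_f[OF x]
    by (rule tensor_lift_sweedler[OF A T3 f _ x, symmetric]) (assumption | rule rs)+
  finally show ?thesis .
qed

text \<open>Every axiom is checked at a representative \<open>pr x\<close>:
  \<open>sweedler_L\<close> rewrites a Sweedler sum in \<open>L\<close> as one in \<open>H\<close>
  whose components are projected, and the corresponding axiom of \<open>H\<close> applies.\<close>

lemma hopf_algebra_L: "hopf_algebra k L"
proof (rule hopf_algebra.intro[OF k_algebra_L hopf_algebra_axioms.intro])
  interpret L: k_algebra k L by (rule k_algebra_L)
  have D: "(\<lambda>h. sw LL (\<lambda>a b. ptensor k L L (pr a) (pr b)) h) \<in> ring_hom H LL"
    using sweedler_algebra_hom[OF k_algebra_L k_algebra_L pr_algebra_hom pr_algebra_hom]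
    by (simp add: algebra_hom_def)
  have "comul L \<in> ring_hom L LL"
  proof (rule ring_hom_memI)
    fix u v assume "u \<in> carrier L" "v \<in> carrier L"
    then obtain x y where x: "x \<in> carrier H" "u = pr x" and y: "y \<in> carrier H" "v = pr y"
      by (elim L_cases)
    show "comul L u \<in> carrier LL" by (rule linear_map_closed[OF comul_L_linear]) fact
    show "comul L (u \<oplus>\<^bsub>L\<^esub> v) = comul L u \<oplus>\<^bsub>LL\<^esub> comul L v" by (rule linear_map_add[OF comul_L_linear]) fact+
    show "comul L (u \<otimes>\<^bsub>L\<^esub> v) = comul L u \<otimes>\<^bsub>LL\<^esub> comul L v"
      using x y ring_hom_mult[OF D x(1) y(1)] by (simp add: pr_mult comul_L)
  next
    show "comul L \<one>\<^bsub>L\<^esub> = \<one>\<^bsub>LL\<^esub>"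
      unfolding L_sel(4) comul_L[OF A.one_closed] by (rule ring_hom_one[OF D])
  qed
  then show "comul L \<in> algebra_hom k L LL"
    by (simp add: algebra_hom_def comul_L_linear)
  have "counit L \<in> ring_hom L (ground_algebra k)"
  proof (rule ring_hom_memI)
    fix u v assume "u \<in> carrier L" "v \<in> carrier L"
    then obtain x y where x: "x \<in> carrier H" "u = pr x" and y: "y \<in> carrier H" "v = pr y"
      by (elim L_cases)
    show "counit L u \<in> carrier (ground_algebra k)" by (rule linear_map_closed[OF counit_L_linear]) fact
    show "counit L (u \<oplus>\<^bsub>L\<^esub> v) = counit L u \<oplus>\<^bsub>ground_algebra k\<^esub> counit L v" by (rule linear_map_add[OF counit_L_linear]) fact+
    show "counit L (u \<otimes>\<^bsub>L\<^esub> v) = counit L u \<otimes>\<^bsub>ground_algebra k\<^esub> counit L v"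
      using x y by (simp add: pr_mult counit_L counit_mult ground_algebra_def)
  next
    show "counit L \<one>\<^bsub>L\<^esub> = \<one>\<^bsub>ground_algebra k\<^esub>"
      by (simp add: L_sel(4) counit_L counit_one ground_algebra_def)
  qed
  then show "counit L \<in> algebra_hom k L (ground_algebra k)"
    by (simp add: algebra_hom_def counit_L_linear)
  show "antipode L \<in> linear_map k L L" by (rule antipode_L_linear)
  fix u assume "u \<in> carrier L"
  then obtain x where x: "x \<in> carrier H" "u = pr x" by (rule L_cases)
  show "tensor_assoc k L L L (tensor_map k LL L (comul L) (\<lambda>x. x) (comul L u))
      = tensor_map k L LL (\<lambda>x. x) (comul L) (comul L u)"
    unfolding x(2) by (rule coaction_coassoc_aux[OF module_L pr_linear comul_L_linear comul_L x(1)])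
  have cl: "counit L v \<in> carrier k" if "v \<in> carrier L" for v
    using linear_map_closed[OF counit_L_linear that] by (simp add: ground_algebra_def)
  have scaleL: "(\<lambda>u. counit L u \<odot>\<^bsub>L\<^esub> p) \<in> linear_map k L L" if "p \<in> carrier L" for p
  proof (rule linear_mapI)
    show "counit L (a \<oplus>\<^bsub>L\<^esub> b) \<odot>\<^bsub>L\<^esub> p = counit L a \<odot>\<^bsub>L\<^esub> p \<oplus>\<^bsub>L\<^esub> counit L b \<odot>\<^bsub>L\<^esub> p"
      if "a \<in> carrier L" "b \<in> carrier L" for a b
      using that \<open>p \<in> carrier L\<close> linear_map_add[OF counit_L_linear] cl by (simp add: ground_algebra_def L.smult_l_distr)
    show "counit L (c \<odot>\<^bsub>L\<^esub> a) \<odot>\<^bsub>L\<^esub> p = c \<odot>\<^bsub>L\<^esub> (counit L a \<odot>\<^bsub>L\<^esub> p)"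
      if "c \<in> carrier k" "a \<in> carrier L" for c a
      using that \<open>p \<in> carrier L\<close> linear_map_smult[OF counit_L_linear] cl by (simp add: ground_algebra_def L.smult_assoc1)
  qed (simp add: cl that)
  note rs = qrules linear_map_id scaleL cl linear_map_smult_const[OF module_L]
  show "tensor_lift L (\<lambda>x y. counit L x \<odot>\<^bsub>L\<^esub> y) (comul L u) = u"
  proof -
    have "(\<lambda>x y. counit L x \<odot>\<^bsub>L\<^esub> y) \<in> bilinear k L L L"
      by (rule bilinearI) (assumption | rule rs)+
    then have "sweedler L L (\<lambda>x y. counit L x \<odot>\<^bsub>L\<^esub> y) u = sw L (\<lambda>a b. counit L (pr a) \<odot>\<^bsub>L\<^esub> pr b) x"
      unfolding x(2) by (rule sweedler_L[OF module_L _ x(1)])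
    also have "\<dots> = sw L (\<lambda>a b. e a \<odot>\<^bsub>L\<^esub> pr b) x"
      by (rule sweedler_cong[OF module_L _ x(1), symmetric]) (assumption | rule rs | simp add: counit_L)+
    also have "\<dots> = pr x" by (rule sweedler_counit_left[OF module_L pr_linear x(1)])
    finally show ?thesis using x(2) by (simp add: sweedler_def)
  qed
  show "tensor_lift L (\<lambda>x y. counit L y \<odot>\<^bsub>L\<^esub> x) (comul L u) = u"
  proof -
    have "(\<lambda>x y. counit L y \<odot>\<^bsub>L\<^esub> x) \<in> bilinear k L L L"
      by (rule bilinearI) (assumption | rule rs)+
    then have "sweedler L L (\<lambda>x y. counit L y \<odot>\<^bsub>L\<^esub> x) u = sw L (\<lambda>a b. counit L (pr b) \<odot>\<^bsub>L\<^esub> pr a) x"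
      unfolding x(2) by (rule sweedler_L[OF module_L _ x(1)])
    also have "\<dots> = sw L (\<lambda>a b. e b \<odot>\<^bsub>L\<^esub> pr a) x"
      by (rule sweedler_cong[OF module_L _ x(1), symmetric]) (assumption | rule rs | simp add: counit_L)+
    also have "\<dots> = pr x" by (rule sweedler_counit_right[OF module_L pr_linear x(1)])
    finally show ?thesis using x(2) by (simp add: sweedler_def)
  qed
  note rs' = qrules linear_map_id L.mult_linear_left L.mult_linear_right linear_map_comp[OF _ antipode_L_linear]
    linear_map_closed[OF antipode_L_linear] antipode_L_linear
  have \<epsilon>: "pr (e x \<odot>\<^bsub>H\<^esub> \<one>\<^bsub>H\<^esub>) = counit L u \<odot>\<^bsub>L\<^esub> \<one>\<^bsub>L\<^esub>"
    using x by (simp add: counit_L L_sel(4) pr_smult counit_closed)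
  show "tensor_lift L (\<lambda>x y. antipode L x \<otimes>\<^bsub>L\<^esub> y) (comul L u) = counit L u \<odot>\<^bsub>L\<^esub> \<one>\<^bsub>L\<^esub>"
  proof -
    have "(\<lambda>x y. antipode L x \<otimes>\<^bsub>L\<^esub> y) \<in> bilinear k L L L"
      by (rule bilinearI) (assumption | rule rs')+
    then have "sweedler L L (\<lambda>x y. antipode L x \<otimes>\<^bsub>L\<^esub> y) u = sw L (\<lambda>a b. antipode L (pr a) \<otimes>\<^bsub>L\<^esub> pr b) x"
      unfolding x(2) by (rule sweedler_L[OF module_L _ x(1)])
    also have "\<dots> = sw L (\<lambda>a b. pr (S a \<star> b)) x"
      by (rule sweedler_cong[OF module_L _ x(1), symmetric]) (assumption | rule rs' | simp add: antipode_L pr_mult antipode_closed)+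
    also have "\<dots> = pr (sw H (\<lambda>a b. S a \<star> b) x)"
      by (rule sweedler_fuse[OF module_A module_L _ pr_linear x(1), symmetric]) (assumption | rule rs')+
    finally show ?thesis using x(1) antipodal_left \<epsilon> by (simp add: sweedler_def antipodal_def)
  qed
  show "tensor_lift L (\<lambda>x y. x \<otimes>\<^bsub>L\<^esub> antipode L y) (comul L u) = counit L u \<odot>\<^bsub>L\<^esub> \<one>\<^bsub>L\<^esub>"
  proof -
    have "(\<lambda>x y. x \<otimes>\<^bsub>L\<^esub> antipode L y) \<in> bilinear k L L L"
      by (rule bilinearI) (assumption | rule rs')+
    then have "sweedler L L (\<lambda>x y. x \<otimes>\<^bsub>L\<^esub> antipode L y) u = sw L (\<lambda>a b. pr a \<otimes>\<^bsub>L\<^esub> antipode L (pr b)) x"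
      unfolding x(2) by (rule sweedler_L[OF module_L _ x(1)])
    also have "\<dots> = sw L (\<lambda>a b. pr (a \<star> S b)) x"
      by (rule sweedler_cong[OF module_L _ x(1), symmetric]) (assumption | rule rs' | simp add: antipode_L pr_mult antipode_closed)+
    also have "\<dots> = pr (sw H (\<lambda>a b. a \<star> S b) x)"
      by (rule sweedler_fuse[OF module_A module_L _ pr_linear x(1), symmetric]) (assumption | rule rs')+
    finally show ?thesis using x(1) antipodal_right \<epsilon> by (simp add: sweedler_def antipodal_def)
  qed
qed

section \<open>The coaction of the quotient\<close>

abbreviation "HL \<equiv> tensor k H L"
abbreviation "coact \<equiv> quotient_coaction k H K"

lemma module_HL: "module k HL"
  by (rule module_tensor[OF module_A module_L])

lemma coact_eq: "coact x = sw HL (\<lambda>a b. ptensor k H L a (pr b)) x"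
  by (simp add: quotient_coaction_def tensor_map_def sweedler_def)

lemma coact_fun: "coact = (\<lambda>x. sw HL (\<lambda>a b. ptensor k H L a (pr b)) x)"
  by (rule ext) (rule coact_eq)

lemma coact_lift:
  assumes "module k P" "\<phi> \<in> bilinear k H L P" "x \<in> carrier H"
  shows "tensor_lift P \<phi> (coact x) = sw P (\<lambda>a b. \<phi> a (pr b)) x"
  unfolding coact_eq
  using tensor_lift_sweedler[OF module_A assms(1) linear_map_id assms(2,3)] by simp

lemma comodule_algebra_H: "comodule_algebra k L H coact"
proof (rule comodule_algebra.intro[OF hopf_algebra_L k_algebra_axioms comodule_algebra_axioms.intro])
  have id: "(\<lambda>x. x) \<in> algebra_hom k H H"
    by (simp add: algebra_hom_def linear_map_id ring_hom_def)
  show hom: "coact \<in> algebra_hom k H HL"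
    unfolding coact_fun using sweedler_algebra_hom[OF k_algebra_axioms k_algebra_L id pr_algebra_hom] .
  fix a assume a: "a \<in> carrier H"
  have lin: "coact \<in> linear_map k H HL" using hom by (simp add: algebra_hom_def)
  show "tensor_assoc k H L L (tensor_map k HL L coact (\<lambda>l. l) (coact a)) = tensor_map k H LL (\<lambda>a. a) (comul L) (coact a)"
    by (rule coaction_coassoc_aux[OF module_A linear_map_id lin coact_eq a])
  have bil: "(\<lambda>x l. counit L l \<odot>\<^bsub>H\<^esub> x) \<in> bilinear k H L H"
    by (rule bilinearI)
      (assumption | rule base_rules hopf_algebra.counit_scale_linear[OF hopf_algebra_L] hopf_algebra.counit_closed[OF hopf_algebra_L])+
  have "tensor_lift H (\<lambda>x l. counit L l \<odot>\<^bsub>H\<^esub> x) (coact a) = sw H (\<lambda>x y. counit L (pr y) \<odot>\<^bsub>H\<^esub> x) a"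
    by (rule coact_lift[OF module_A bil a])
  also have "\<dots> = sw H (\<lambda>x y. e y \<odot>\<^bsub>H\<^esub> x) a"
    by (rule sweedler_cong[OF module_A _ a, symmetric]) (assumption | rule qrules | simp add: counit_L)+
  also have "\<dots> = a"
    by (rule sweedler_counit_right[OF module_A linear_map_id a])
  finally show "tensor_lift H (\<lambda>x l. counit L l \<odot>\<^bsub>H\<^esub> x) (coact a) = a" .
qed

end

section \<open>The Galois maps\<close>

context normal_subalgebra
begin

text \<open>\<open>a z = (a\<^sub>1 z S(a\<^sub>2)) a\<^sub>3\<close> shows \<open>H K\<^sup>+ \<subseteq> K\<^sup>+ H\<close>.\<close>

lemma I_induct_left [consumes 1, case_names prod add]:
  assumes x: "x \<in> I"
    and prod: "\<And>z a. z \<in> K \<Longrightarrow> e z = \<zero>\<^bsub>k\<^esub> \<Longrightarrow> a \<in> carrier H \<Longrightarrow> Q (z \<star> a)"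
    and add: "\<And>p q. p \<in> carrier H \<Longrightarrow> q \<in> carrier H \<Longrightarrow> Q p \<Longrightarrow> Q q \<Longrightarrow> Q (p \<oplus>\<^bsub>H\<^esub> q)"
  shows "Q x"
  using x
proof (induction rule: ideal_prod.induct)
  case (sum s t)
  then show ?case by (intro add) (simp_all add: I_sub)
next
  case (prod a z)
  then have a: "a \<in> carrier H" and zK: "z \<in> K" and ez: "e z = \<zero>\<^bsub>k\<^esub>" by (simp_all add: Kp_iff)
  have zH: "z \<in> carrier H" by (rule K_sub[OF zK])
  have ad: "sw H (\<lambda>b c. b \<star> z \<star> S c) y \<in> K \<and> e (sw H (\<lambda>b c. b \<star> z \<star> S c) y) = \<zero>\<^bsub>k\<^esub>"
    if y: "y \<in> carrier H" for y
  proof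
    show "e (sw H (\<lambda>b c. b \<star> z \<star> S c) y) = \<zero>\<^bsub>k\<^esub>"
      using module_A _ y
    proof (rule sweedler_induct)
      show "(\<lambda>b c. b \<star> z \<star> S c) \<in> bilinear k H H H"
        by (insert zH, (assumption | rule sw_rules)+)
      show "e (b \<star> z \<star> S c) = \<zero>\<^bsub>k\<^esub>" if "b \<in> carrier H" "c \<in> carrier H" for b c
        using that zH by (simp add: counit_mult antipode_closed ez counit_closed)
      show "e (p \<oplus>\<^bsub>H\<^esub> q) = \<zero>\<^bsub>k\<^esub>"
        if "p \<in> carrier H" "q \<in> carrier H" "e p = \<zero>\<^bsub>k\<^esub>" "e q = \<zero>\<^bsub>k\<^esub>" for p q
        using that by (simp add: counit_add)
    qed
    show "sw H (\<lambda>b c. b \<star> z \<star> S c) y \<in> K"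
      using normal zK y by (simp add: normal_hopf_subalgebra_def sweedler_def)
  qed
  have "a \<star> z = a \<star> z \<star> \<one>\<^bsub>H\<^esub>" using zH a by simp
  also have "\<dots> = sw H (\<lambda>x y. sw H (\<lambda>b c. b \<star> z \<star> (S c \<star> y)) x) a"
    by (rule sweedler_cancel_right(2)[where \<psi> = "\<lambda>b u. b \<star> z \<star> u", OF module_A antipodal_left _ a, symmetric])
      (insert zH, (assumption | rule sw_rules)+)
  also have "\<dots> = sw H (\<lambda>x y. sw H (\<lambda>b c. b \<star> z \<star> S c) x \<star> y) a"
  proof (rule sweedler_cong[OF module_A _ a])
    show "(\<lambda>x y. sw H (\<lambda>b c. b \<star> z \<star> (S c \<star> y)) x) \<in> bilinear k H H H"
      by (insert zH, (assumption | rule sw_rules)+)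
    fix x y assume x: "x \<in> carrier H" and y: "y \<in> carrier H"
    have "sw H (\<lambda>b c. b \<star> z \<star> (S c \<star> y)) x = sw H (\<lambda>b c. b \<star> z \<star> S c \<star> y) x"
      by (rule sweedler_cong[OF module_A _ x])
        (insert zH y, (assumption | rule sw_rules | simp add: A.m_assoc antipode_closed)+)
    also have "\<dots> = sw H (\<lambda>b c. b \<star> z \<star> S c) x \<star> y"
      by (rule sweedler_fuse[OF module_A module_A _ _ x, symmetric, where f = "\<lambda>w. w \<star> y"])
        (insert zH y, (assumption | rule sw_rules)+)
    finally show "sw H (\<lambda>b c. b \<star> z \<star> (S c \<star> y)) x = sw H (\<lambda>b c. b \<star> z \<star> S c) x \<star> y" .
  qed
  finally have eq: "a \<star> z = sw H (\<lambda>x y. sw H (\<lambda>b c. b \<star> z \<star> S c) x \<star> y) a" .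
  show ?case
    unfolding eq using module_A _ a
  proof (rule sweedler_induct)
    show "(\<lambda>x y. sw H (\<lambda>b c. b \<star> z \<star> S c) x \<star> y) \<in> bilinear k H H H"
      by (insert zH, (assumption | rule sw_rules)+)
    show "Q (sw H (\<lambda>b c. b \<star> z \<star> S c) x \<star> y)" if "x \<in> carrier H" "y \<in> carrier H" for x y
      using that ad assms(2) by blast
  qed (rule add)
qed

text \<open>The tensor product of \<open>H\<close> with itself over \<open>K\<close> comes only as
  an additive group. Adding the scalars of \<open>k\<close> makes it a vector space, so that linear
  maps into and out of it fall under the Sweedler calculus.\<close>

definition RT :: "('k, ('h, 'h) tens) module" where
  "RT = ring.extend (ring_tensor H K)
     (module.fields (\<lambda>c. tensor_lift (ring_tensor H K) (\<lambda>x y. ring_ptensor H K (c \<odot>\<^bsub>H\<^esub> x) y)))"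

abbreviation "rpt \<equiv> ring_ptensor H K"

lemma carrier_RT: "carrier RT = carrier (ring_tensor H K)"
  and add_RT: "add RT = add (ring_tensor H K)"
  and zero_RT: "\<zero>\<^bsub>RT\<^esub> = \<zero>\<^bsub>ring_tensor H K\<^esub>"
  by (simp_all add: RT_def ring.defs module.defs)

lemma linear_tensor_RT: "linear_tensor k H H K (monoid.mult H) (monoid.mult H) RT"
proof unfold_locales
  show "x \<star> c \<in> carrier H" if "x \<in> carrier H" "c \<in> K" for x c using that by (simp add: K_sub)
  show "c \<star> y \<in> carrier H" if "y \<in> carrier H" "c \<in> K" for y c using that by (simp add: K_sub)
  show "\<exists>d\<in>K. (\<forall>x\<in>carrier H. x \<star> d = c \<odot>\<^bsub>H\<^esub> x) \<and> (\<forall>y\<in>carrier H. d \<star> y = c \<odot>\<^bsub>H\<^esub> y)"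
    if "c \<in> carrier k" for c
    \<comment> \<open>A scalar \<open>c\<close> of the field acts on both factors as the element
      \<open>c 1\<close> of \<open>K\<close>.\<close>
    using that by (intro bexI[of _ "c \<odot>\<^bsub>H\<^esub> \<one>\<^bsub>H\<^esub>"]) (simp_all add: smult_mult_left smult_mult_right K_closed)
  show "(c \<odot>\<^bsub>H\<^esub> x) \<star> d = c \<odot>\<^bsub>H\<^esub> (x \<star> d)" if "c \<in> carrier k" "x \<in> carrier H" "d \<in> K" for c x d
    using that by (simp add: smult_mult_left K_sub)
qed (simp_all add: RT_def ring.defs module.defs ring_tensor_def ring_ptensor_def)

lemma module_RT: "module k RT"
  by (rule linear_tensor.module_T[OF linear_tensor_RT])

lemma rpt_bilinear: "(\<lambda>x y. rpt x y) \<in> bilinear k H H RT"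
  unfolding ring_ptensor_def by (rule linear_tensor.pt_bilinear[OF linear_tensor_RT])

lemma rpt_balanced: "x \<in> carrier H \<Longrightarrow> z \<in> K \<Longrightarrow> y \<in> carrier H \<Longrightarrow> rpt (x \<star> z) y = rpt x (z \<star> y)"
  unfolding ring_ptensor_def by (rule balanced_product.pt_balanced[OF linear_tensor.axioms(3)[OF linear_tensor_RT]])

lemma RT_lift_linear:
  assumes "module k P" "\<phi> \<in> bilinear k H H P"
    and "\<And>x z y. x \<in> carrier H \<Longrightarrow> z \<in> K \<Longrightarrow> y \<in> carrier H \<Longrightarrow> \<phi> (x \<star> z) y = \<phi> x (z \<star> y)"
  shows "tensor_lift P \<phi> \<in> linear_map k RT P"
  by (rule linear_tensor.lift_linear[OF linear_tensor_RT assms(1,2)]) (rule assms(3))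

lemma RT_lift_rpt:
  assumes "module k P" "\<phi> \<in> bilinear k H H P"
    and "\<And>x z y. x \<in> carrier H \<Longrightarrow> z \<in> K \<Longrightarrow> y \<in> carrier H \<Longrightarrow> \<phi> (x \<star> z) y = \<phi> x (z \<star> y)"
    and "x \<in> carrier H" "y \<in> carrier H"
  shows "tensor_lift P \<phi> (rpt x y) = \<phi> x y"
  unfolding ring_ptensor_def by (rule linear_tensor.lift_pure[OF linear_tensor_RT assms(1,2) _ assms(4,5)]) (rule assms(3))

lemma RT_ext:
  assumes "f \<in> linear_map k RT P" "g \<in> linear_map k RT P" "t \<in> carrier RT"
    and "\<And>x y. x \<in> carrier H \<Longrightarrow> y \<in> carrier H \<Longrightarrow> f (rpt x y) = g (rpt x y)"
  shows "f t = g t"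
  using linear_tensor.T_ext[OF linear_tensor_RT assms(1-3)] assms(4) by (simp add: ring_ptensor_def)

lemmas grules = qrules module_RT module_HL bilinear_app_left[OF rpt_bilinear] bilinear_app_right[OF rpt_bilinear]
  bilinear_closed[OF rpt_bilinear]

text \<open>The universal property of \<open>H \<otimes> H / I\<close> in terms of representatives.
  A map out of it is given by a bilinear expression in elements of \<open>H\<close>, and
  well-definedness becomes a vanishing statement on \<open>I\<close>.\<close>

lemma HL_descend:
  assumes P: "module k P" and \<phi>: "\<phi> \<in> bilinear k H H P"
    and I: "\<And>x y. x \<in> carrier H \<Longrightarrow> y \<in> I \<Longrightarrow> \<phi> x y = \<zero>\<^bsub>P\<^esub>"
  shows "\<exists>g. g \<in> linear_map k HL P \<and> (\<forall>x\<in>carrier H. \<forall>y\<in>carrier H. g (ptensor k H L x (pr y)) = \<phi> x y)"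
proof -
  let ?\<psi> = "\<lambda>x u. the_elem ((\<lambda>y. \<phi> x y) ` u)"
  have q: "the_elem ((\<lambda>y. \<phi> x y) ` pr y) = \<phi> x y" if "x \<in> carrier H" "y \<in> carrier H" for x y
    by (rule quotient_map_pr[OF P bilinear_right[OF \<phi> that(1)] I[OF that(1)] that(2)])
  have \<psi>: "?\<psi> \<in> bilinear k H L P"
  proof (rule bilinearI)
    show "(\<lambda>u. ?\<psi> x u) \<in> linear_map k L P" if "x \<in> carrier H" for x
      by (rule quotient_map_linear[OF P bilinear_right[OF \<phi> that] I[OF that]])
    fix u assume "u \<in> carrier L"
    then obtain y where y: "y \<in> carrier H" "u = pr y" by (rule L_cases)
    show "(\<lambda>x. ?\<psi> x u) \<in> linear_map k H P"
      by (rule linear_map_cong[OF bilinear_left[OF \<phi> y(1)] module_A]) (simp add: y q)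
  qed
  have "tensor_lift P ?\<psi> \<in> linear_map k HL P"
    by (rule tensor_lift_linear[OF module_A module_L P \<psi>])
  moreover have "tensor_lift P ?\<psi> (ptensor k H L x (pr y)) = \<phi> x y" if "x \<in> carrier H" "y \<in> carrier H" for x y
    using tensor_lift_ptensor[OF module_A module_L P \<psi> that(1) pr_closed[OF that(2)]] q[OF that] by simp
  ultimately show ?thesis by blast
qed

lemma HL_ext:
  assumes "f \<in> linear_map k HL P" "g \<in> linear_map k HL P" "t \<in> carrier HL"
    and "\<And>x y. x \<in> carrier H \<Longrightarrow> y \<in> carrier H \<Longrightarrow> f (ptensor k H L x (pr y)) = g (ptensor k H L x (pr y))"
  shows "f t = g t"
  by (rule tensor_ext[OF module_A module_L assms(1,2) _ assms(3)]) (auto elim!: L_cases simp: assms(4))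

section \<open>The Galois map of the right coaction\<close>

definition gal :: "'h \<Rightarrow> 'h \<Rightarrow> ('h, 'h set) tens" where
  "gal x y = sw HL (\<lambda>a b. ptensor k H L (x \<star> a) (pr b)) y"

lemma gal_bilinear: "(\<lambda>x y. gal x y) \<in> bilinear k H H HL"
  unfolding gal_def by (assumption | rule grules)+

lemma HL_scalar:
  assumes "c \<in> carrier k" "x \<in> carrier H" "u \<in> carrier L"
  shows "ptensor k H L x (c \<odot>\<^bsub>L\<^esub> u) = c \<odot>\<^bsub>HL\<^esub> ptensor k H L x u"
  using linear_map_smult[OF bilinear_right[OF ptensor_bilinear[OF module_A module_L] assms(2)] assms(1,3)] .

text \<open>The components of \<open>z\<close> lie in \<open>K\<close>, so the one that lands under
  the projection contributes only its counit, and the counit axiom restores \<open>z\<close> in the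
  other factor. The first equation is balancedness over \<open>K\<close>, the second becomes right
  \<open>K\<close>-linearity.\<close>

lemma gal_K:
  assumes x: "x \<in> carrier H" and z: "z \<in> K" and y: "y \<in> carrier H"
  shows "gal x (z \<star> y) = gal (x \<star> z) y" "gal x (y \<star> z) = sw HL (\<lambda>a b. ptensor k H L (x \<star> a \<star> z) (pr b)) y"
proof -
  have zH: "z \<in> carrier H" by (rule K_sub[OF z])
  have bil: "(\<lambda>a b. ptensor k H L (x \<star> a) (pr b)) \<in> bilinear k H H HL"
    by (insert x, (assumption | rule grules)+)
  have "gal x (z \<star> y) = sw HL (\<lambda>u v. sw HL (\<lambda>a b. ptensor k H L (x \<star> (u \<star> a)) (pr (v \<star> b))) y) z"
    unfolding gal_def by (rule sweedler_mult[OF module_HL bil zH y])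
  also have "\<dots> = sw HL (\<lambda>u v. e v \<odot>\<^bsub>HL\<^esub> gal (x \<star> u) y) z"
  proof (rule K_sweedler_cong[OF module_HL _ _ z])
    show "(\<lambda>u v. sw HL (\<lambda>a b. ptensor k H L (x \<star> (u \<star> a)) (pr (v \<star> b))) y) \<in> bilinear k H H HL"
      by (insert x y, (assumption | rule grules)+)
    show "(\<lambda>u v. e v \<odot>\<^bsub>HL\<^esub> gal (x \<star> u) y) \<in> bilinear k H H HL"
      by (insert x y, (assumption | rule grules bilinear_app_left[OF gal_bilinear] bilinear_closed[OF gal_bilinear])+)
    fix u v assume u: "u \<in> K" and v: "v \<in> K"
    have "sw HL (\<lambda>a b. ptensor k H L (x \<star> (u \<star> a)) (pr (v \<star> b))) y
        = sw HL (\<lambda>a b. e v \<odot>\<^bsub>HL\<^esub> ptensor k H L (x \<star> u \<star> a) (pr b)) y"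
      by (rule sweedler_cong[OF module_HL _ y])
        (insert x K_sub[OF u] K_sub[OF v], (assumption | rule grules | simp add: A.m_assoc pr_mult_K v HL_scalar counit_closed pr_closed)+)
    also have "\<dots> = e v \<odot>\<^bsub>HL\<^esub> gal (x \<star> u) y"
      unfolding gal_def
      by (rule sweedler_fuse[OF module_HL module_HL _ _ y, symmetric])
        (insert x K_sub[OF u] K_sub[OF v], (assumption | rule grules)+)
    finally show "sw HL (\<lambda>a b. ptensor k H L (x \<star> (u \<star> a)) (pr (v \<star> b))) y = e v \<odot>\<^bsub>HL\<^esub> gal (x \<star> u) y" .
  qed
  also have "\<dots> = gal (x \<star> z) y"
    by (rule sweedler_counit_right[OF module_HL _ zH])
      (insert x y, (assumption | rule grules bilinear_app_left[OF gal_bilinear])+)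
  finally show "gal x (z \<star> y) = gal (x \<star> z) y" .
  have "gal x (y \<star> z) = sw HL (\<lambda>a b. sw HL (\<lambda>u v. ptensor k H L (x \<star> (a \<star> u)) (pr (b \<star> v))) z) y"
    unfolding gal_def by (rule sweedler_mult[OF module_HL bil y zH])
  also have "\<dots> = sw HL (\<lambda>a b. ptensor k H L (x \<star> a \<star> z) (pr b)) y"
  proof (rule sweedler_cong[OF module_HL _ y])
    show "(\<lambda>a b. sw HL (\<lambda>u v. ptensor k H L (x \<star> (a \<star> u)) (pr (b \<star> v))) z) \<in> bilinear k H H HL"
      by (insert x zH, (assumption | rule grules)+)
    fix a b assume a: "a \<in> carrier H" and b: "b \<in> carrier H"
    have "sw HL (\<lambda>u v. ptensor k H L (x \<star> (a \<star> u)) (pr (b \<star> v))) z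
        = sw HL (\<lambda>u v. e v \<odot>\<^bsub>HL\<^esub> ptensor k H L (x \<star> a \<star> u) (pr b)) z"
      by (rule K_sweedler_cong[OF module_HL _ _ z])
        (insert x a b, (assumption | rule grules | simp add: A.m_assoc pr_mult_K K_sub HL_scalar counit_closed pr_closed)+)
    also have "\<dots> = ptensor k H L (x \<star> a \<star> z) (pr b)"
      by (rule sweedler_counit_right[OF module_HL _ zH]) (insert x a b, (assumption | rule grules)+)
    finally show "sw HL (\<lambda>u v. ptensor k H L (x \<star> (a \<star> u)) (pr (b \<star> v))) z
      = ptensor k H L (x \<star> a \<star> z) (pr b)" .
  qed
  finally show "gal x (y \<star> z) = sw HL (\<lambda>a b. ptensor k H L (x \<star> a \<star> z) (pr b)) y" .
qed

abbreviation "\<beta> \<equiv> tensor_lift HL (\<lambda>x y. gal x y)"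

lemma \<beta>_linear: "\<beta> \<in> linear_map k RT HL"
  by (rule RT_lift_linear[OF module_HL gal_bilinear]) (simp add: gal_K)

lemma \<beta>_rpt: "x \<in> carrier H \<Longrightarrow> y \<in> carrier H \<Longrightarrow> \<beta> (rpt x y) = gal x y"
  by (rule RT_lift_rpt[OF module_HL gal_bilinear]) (simp_all add: gal_K)

text \<open>Elements of \<open>I\<close> must be written with \<open>K\<^sup>+\<close> on the left:
  for \<open>z\<close> in \<open>K\<^sup>+\<close>,
  \<open>x S(z\<^sub>1 h\<^sub>1) \<otimes> z\<^sub>2 h\<^sub>2\<close> is
  \<open>x S(h\<^sub>1) S(z\<^sub>1) z\<^sub>2 \<otimes> h\<^sub>2\<close> because
  \<open>z\<^sub>2\<close> stands next to the tensor sign and may cross it. The antipode axiom then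
  leaves the factor \<open>e(z) = 0\<close>.\<close>

lemma \<beta>_inverse:
  "\<exists>g. g \<in> linear_map k HL RT \<and> (\<forall>x\<in>carrier H. \<forall>y\<in>carrier H.
      g (ptensor k H L x (pr y)) = sw RT (\<lambda>a b. rpt (x \<star> S a) b) y)"
proof (rule HL_descend[OF module_RT])
  show bil: "(\<lambda>x y. sw RT (\<lambda>a b. rpt (x \<star> S a) b) y) \<in> bilinear k H H RT"
    by (assumption | rule grules)+
  interpret RT: module k RT by (rule module_RT)
  fix x y assume x: "x \<in> carrier H" and "y \<in> I"
  from this(2) show "sw RT (\<lambda>a b. rpt (x \<star> S a) b) y = \<zero>\<^bsub>RT\<^esub>"
  proof (induction y rule: I_induct_left)
    case (prod z h)
    note zH = K_sub[OF prod(1)] and h = prod(3)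
    have "sw RT (\<lambda>a b. rpt (x \<star> S a) b) (z \<star> h)
        = sw RT (\<lambda>u v. sw RT (\<lambda>a b. rpt (x \<star> S (u \<star> a)) (v \<star> b)) h) z"
      by (rule sweedler_mult[OF module_RT _ zH h]) (insert x, (assumption | rule grules)+)
    also have "\<dots> = sw RT (\<lambda>u v. sw RT (\<lambda>a b. rpt (x \<star> S a \<star> (S u \<star> v)) b) h) z"
    proof (rule K_sweedler_cong[OF module_RT _ _ prod(1)])
      show "(\<lambda>u v. sw RT (\<lambda>a b. rpt (x \<star> S (u \<star> a)) (v \<star> b)) h) \<in> bilinear k H H RT"
        "(\<lambda>u v. sw RT (\<lambda>a b. rpt (x \<star> S a \<star> (S u \<star> v)) b) h) \<in> bilinear k H H RT"
        by (insert x h, (assumption | rule grules)+)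
      fix u v assume u: "u \<in> K" and v: "v \<in> K"
      show "sw RT (\<lambda>a b. rpt (x \<star> S (u \<star> a)) (v \<star> b)) h = sw RT (\<lambda>a b. rpt (x \<star> S a \<star> (S u \<star> v)) b) h"
        by (rule sweedler_cong[OF module_RT _ h])
          (insert x K_sub[OF u] K_sub[OF v], (assumption | rule grules |
            simp add: rpt_balanced[symmetric] v antipode_mult A.m_assoc[symmetric] antipode_closed)+)
    qed
    also have "\<dots> = sw RT (\<lambda>a b. rpt (x \<star> S a \<star> sw H (\<lambda>u v. S u \<star> v) z) b) h"
      by (rule sweedler_fuse[OF module_A module_RT _ _ zH, symmetric, where f = "\<lambda>w. sw RT (\<lambda>a b. rpt (x \<star> S a \<star> w) b) h"])
        (insert x h, (assumption | rule grules)+)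
    also have "sw H (\<lambda>u v. S u \<star> v) z = \<zero>\<^bsub>H\<^esub>"
      using antipodal_left zH prod(2) by (simp add: antipodal_def)
    also have "sw RT (\<lambda>a b. rpt (x \<star> S a \<star> \<zero>\<^bsub>H\<^esub>) b) h = \<zero>\<^bsub>RT\<^esub>"
      by (rule linear_map_zero[OF _ module_A module_RT, where f = "\<lambda>w. sw RT (\<lambda>a b. rpt (x \<star> S a \<star> w) b) h"])
        (insert x h, (assumption | rule grules)+)
    finally show ?case .
  next
    case (add p q)
    then show ?case by (simp add: linear_map_add[OF bilinear_right[OF bil x]])
  qed
qed

text \<open>The two composites produce \<open>x y\<^sub>1 S(y\<^sub>2) \<otimes> y\<^sub>3\<close>
  and \<open>x S(y\<^sub>1) y\<^sub>2 \<otimes> pr y\<^sub>3\<close>, so each of the antipode axioms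
  is used for one direction.\<close>

lemma \<beta>_bijective:
  obtains g where "g \<in> linear_map k HL RT" "\<And>t. t \<in> carrier RT \<Longrightarrow> g (\<beta> t) = t" "\<And>t. t \<in> carrier HL \<Longrightarrow> \<beta> (g t) = t"
proof -
  obtain g where g: "g \<in> linear_map k HL RT" and
    g_pt: "\<And>x y. x \<in> carrier H \<Longrightarrow> y \<in> carrier H \<Longrightarrow> g (ptensor k H L x (pr y)) = sw RT (\<lambda>a b. rpt (x \<star> S a) b) y"
    using \<beta>_inverse by blast
  note rs = grules linear_map_comp[OF _ g] linear_map_comp[OF _ \<beta>_linear] bilinear_app_left[OF gal_bilinear] bilinear_app_right[OF gal_bilinear]
  have "g (\<beta> t) = t" if "t \<in> carrier RT" for t
  proof (rule RT_ext[OF linear_map_comp[OF \<beta>_linear g] linear_map_id that])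
    fix x y assume x: "x \<in> carrier H" and y: "y \<in> carrier H"
    have "g (\<beta> (rpt x y)) = g (gal x y)" by (simp only: \<beta>_rpt[OF x y])
    also have "\<dots> = sw RT (\<lambda>a b. g (ptensor k H L (x \<star> a) (pr b))) y"
      unfolding gal_def
      by (rule sweedler_fuse[OF module_HL module_RT _ g y]) (insert x, (assumption | rule rs)+)
    also have "\<dots> = sw RT (\<lambda>a b. sw RT (\<lambda>c d. rpt (x \<star> (a \<star> S c)) d) b) y"
      by (rule sweedler_cong[OF module_RT _ y])
        (insert x, (assumption | rule rs | simp add: g_pt A.m_assoc antipode_closed)+, rule sweedler_cong, (assumption | rule rs | simp add: A.m_assoc antipode_closed)+)
    also have "\<dots> = rpt (x \<star> \<one>\<^bsub>H\<^esub>) y"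
      by (rule sweedler_cancel_left(2)[where \<psi> = "\<lambda>u d. rpt (x \<star> u) d", OF module_RT antipodal_right _ y])
        (insert x, (assumption | rule rs)+)
    finally show "g (\<beta> (rpt x y)) = rpt x y" using x by simp
  qed
  moreover have "\<beta> (g t) = t" if "t \<in> carrier HL" for t
  proof (rule HL_ext[OF linear_map_comp[OF g \<beta>_linear] linear_map_id that])
    fix x y assume x: "x \<in> carrier H" and y: "y \<in> carrier H"
    have "\<beta> (g (ptensor k H L x (pr y))) = sw HL (\<lambda>a b. \<beta> (rpt (x \<star> S a) b)) y"
      unfolding g_pt[OF x y]
      by (rule sweedler_fuse[OF module_RT module_HL _ \<beta>_linear y]) (insert x, (assumption | rule rs)+)
    also have "\<dots> = sw HL (\<lambda>a b. gal (x \<star> S a) b) y"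
      by (rule sweedler_cong[OF module_HL _ y])
        (insert x, (assumption | rule rs \<beta>_rpt)+)
    also have "\<dots> = sw HL (\<lambda>a b. sw HL (\<lambda>c d. ptensor k H L (x \<star> (S a \<star> c)) (pr d)) b) y"
      unfolding gal_def
      by (intro sweedler_cong module_HL y)
        (insert x, (assumption | rule rs | simp add: A.m_assoc antipode_closed)+)
    also have "\<dots> = ptensor k H L (x \<star> \<one>\<^bsub>H\<^esub>) (pr y)"
      by (rule sweedler_cancel_left(2)[where \<psi> = "\<lambda>u d. ptensor k H L (x \<star> u) (pr d)", OF module_HL antipodal_left _ y])
        (insert x, (assumption | rule rs)+)
    finally show "\<beta> (g (ptensor k H L x (pr y))) = ptensor k H L x (pr y)" using x by simp
  qed
  ultimately show thesis using g that by blast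
qed

lemma galois_map_eq:
  assumes "t \<in> carrier RT"
  shows "galois_map k L H coact t = \<beta> t"
proof -
  interpret R: linear_tensor k H H K "monoid.mult H" "monoid.mult H" RT by (rule linear_tensor_RT)
  have ab: "abelian_group HL" using module_HL by (simp add: module_def)
  have eq: "gal x y = tensor_lift HL (\<lambda>y0 y1. ptensor k H L (x \<star> y0) y1) (coact y)"
    if x: "x \<in> carrier H" and y: "y \<in> carrier H" for x y
    unfolding gal_def by (rule coact_lift[OF module_HL _ y, symmetric]) (insert x, (assumption | rule grules)+)
  have bal: "(\<lambda>x y. gal x y) \<in> balanced_maps K H (monoid.mult H) H (monoid.mult H) HL"
    by (rule bilinear_balanced[OF gal_bilinear]) (simp add: gal_K)
  show ?thesis
    unfolding galois_map_def
    by (rule R.lift_cong[OF ab ab refl refl bal eq, symmetric])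
      (use assms in \<open>simp_all add: R.carrier_T\<close>)
qed

lemma galois_map_bij: "bij_betw (galois_map k L H coact) (carrier (ring_tensor H K)) (carrier HL)"
proof -
  obtain g where g: "g \<in> linear_map k HL RT" "\<And>t. t \<in> carrier RT \<Longrightarrow> g (\<beta> t) = t" "\<And>t. t \<in> carrier HL \<Longrightarrow> \<beta> (g t) = t"
    using \<beta>_bijective by blast
  have "bij_betw \<beta> (carrier RT) (carrier HL)"
    by (rule bij_betw_byWitness[where f' = g])
      (use g linear_map_closed[OF \<beta>_linear] linear_map_closed[OF g(1)] in auto)
  then show ?thesis
    unfolding carrier_RT[symmetric] using bij_betw_cong[of "carrier RT" "galois_map k L H coact" \<beta>] galois_map_eq by blast
qed

end

section \<open>Linear algebra\<close>

text \<open>Coordinates are linear because they are unique: the sum of two coordinate families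
  represents the sum of the vectors, and likewise for multiples. Afterwards only the resulting
  expansion formula is used.\<close>

lemma basis_functionals:
  assumes k: "field k" and V: "module k V" and B: "finite_basis k V B"
  obtains co where "\<And>b. b \<in> B \<Longrightarrow> co b \<in> linear_map k V (ground_algebra k)"
    "\<And>v. v \<in> carrier V \<Longrightarrow> (\<Oplus>\<^bsub>V\<^esub>b\<in>B. co b v \<odot>\<^bsub>V\<^esub> b) = v"
proof -
  interpret k: field k by fact
  interpret V: module k V by fact
  have fin: "finite B" and BV: "\<And>b. b \<in> B \<Longrightarrow> b \<in> carrier V"
    and ex1: "\<And>v. v \<in> carrier V \<Longrightarrow> \<exists>!c. c \<in> B \<rightarrow>\<^sub>E carrier k \<and> v = (\<Oplus>\<^bsub>V\<^esub>b\<in>B. c b \<odot>\<^bsub>V\<^esub> b)"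
    using B by (auto simp: finite_basis_def)
  define C where "C v = (THE c. c \<in> B \<rightarrow>\<^sub>E carrier k \<and> v = (\<Oplus>\<^bsub>V\<^esub>b\<in>B. c b \<odot>\<^bsub>V\<^esub> b))" for v
  have C: "C v \<in> B \<rightarrow>\<^sub>E carrier k \<and> v = (\<Oplus>\<^bsub>V\<^esub>b\<in>B. C v b \<odot>\<^bsub>V\<^esub> b)" if "v \<in> carrier V" for v
    unfolding C_def by (rule theI'[OF ex1[OF that]])
  have C_closed: "C v b \<in> carrier k" if "v \<in> carrier V" "b \<in> B" for v b
    using C[OF that(1)] that(2) by (auto simp: PiE_def)
  have C_eq: "C v b = c b"
    if "v \<in> carrier V" "b \<in> B" "\<And>b. b \<in> B \<Longrightarrow> c b \<in> carrier k" "v = (\<Oplus>\<^bsub>V\<^esub>b\<in>B. c b \<odot>\<^bsub>V\<^esub> b)" for v b c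
  proof -
    \<comment> \<open>Uniqueness in \<open>finite_basis\<close> concerns extensional families, so
      \<open>c\<close> is first restricted to \<open>B\<close>.\<close>
    have "(\<Oplus>\<^bsub>V\<^esub>b\<in>B. (\<lambda>b\<in>B. c b) b \<odot>\<^bsub>V\<^esub> b) = (\<Oplus>\<^bsub>V\<^esub>b\<in>B. c b \<odot>\<^bsub>V\<^esub> b)"
      by (rule V.M.finsum_cong') (auto simp: that BV)
    with that have "(\<lambda>b\<in>B. c b) \<in> B \<rightarrow>\<^sub>E carrier k \<and> v = (\<Oplus>\<^bsub>V\<^esub>b\<in>B. (\<lambda>b\<in>B. c b) b \<odot>\<^bsub>V\<^esub> b)"
      by simp
    with ex1[OF that(1)] C[OF that(1)] have "C v = (\<lambda>b\<in>B. c b)" by blast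
    then show ?thesis using that(2) by simp
  qed
  show thesis
  proof (rule that)
    show "(\<Oplus>\<^bsub>V\<^esub>b\<in>B. C v b \<odot>\<^bsub>V\<^esub> b) = v" if "v \<in> carrier V" for v
      using C[OF that] by simp
    fix b assume b: "b \<in> B"
    show "(\<lambda>v. C v b) \<in> linear_map k V (ground_algebra k)"
    proof (rule linear_mapI)
      fix v assume v: "v \<in> carrier V"
      show "C v b \<in> carrier (ground_algebra k)" using C_closed[OF v b] by (simp add: ground_algebra_def)
      fix w assume w: "w \<in> carrier V"
      have "v \<oplus>\<^bsub>V\<^esub> w = (\<Oplus>\<^bsub>V\<^esub>b\<in>B. C v b \<odot>\<^bsub>V\<^esub> b) \<oplus>\<^bsub>V\<^esub> (\<Oplus>\<^bsub>V\<^esub>b\<in>B. C w b \<odot>\<^bsub>V\<^esub> b)"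
        using C[OF v] C[OF w] by simp
      also have "\<dots> = (\<Oplus>\<^bsub>V\<^esub>b\<in>B. C v b \<odot>\<^bsub>V\<^esub> b \<oplus>\<^bsub>V\<^esub> C w b \<odot>\<^bsub>V\<^esub> b)"
        by (rule V.M.finsum_addf[symmetric]) (simp_all add: C_closed v w BV)
      also have "\<dots> = (\<Oplus>\<^bsub>V\<^esub>b\<in>B. (C v b \<oplus>\<^bsub>k\<^esub> C w b) \<odot>\<^bsub>V\<^esub> b)"
        by (rule V.M.finsum_cong') (simp_all add: C_closed v w BV V.smult_l_distr)
      finally have "C (v \<oplus>\<^bsub>V\<^esub> w) b = C v b \<oplus>\<^bsub>k\<^esub> C w b"
        by (intro C_eq[OF V.M.a_closed[OF v w] b]) (simp_all add: C_closed v w)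
      then show "C (v \<oplus>\<^bsub>V\<^esub> w) b = C v b \<oplus>\<^bsub>ground_algebra k\<^esub> C w b" by (simp add: ground_algebra_def)
    next
      fix a v assume a: "a \<in> carrier k" and v: "v \<in> carrier V"
      have "a \<odot>\<^bsub>V\<^esub> v = a \<odot>\<^bsub>V\<^esub> (\<Oplus>\<^bsub>V\<^esub>b\<in>B. C v b \<odot>\<^bsub>V\<^esub> b)"
        using C[OF v] by simp
      also have "\<dots> = (\<Oplus>\<^bsub>V\<^esub>b\<in>B. a \<odot>\<^bsub>V\<^esub> (C v b \<odot>\<^bsub>V\<^esub> b))"
        by (rule V.finsum_smult_ldistr) (simp_all add: fin a C_closed v BV)
      also have "\<dots> = (\<Oplus>\<^bsub>V\<^esub>b\<in>B. (a \<otimes>\<^bsub>k\<^esub> C v b) \<odot>\<^bsub>V\<^esub> b)"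
        by (rule V.M.finsum_cong') (simp_all add: C_closed v a BV V.smult_assoc1)
      finally have "C (a \<odot>\<^bsub>V\<^esub> v) b = a \<otimes>\<^bsub>k\<^esub> C v b"
        by (intro C_eq[OF V.smult_closed[OF a v] b]) (simp_all add: C_closed v a)
      then show "C (a \<odot>\<^bsub>V\<^esub> v) b = a \<odot>\<^bsub>ground_algebra k\<^esub> C v b" by (simp add: ground_algebra_def)
    qed
  qed
qed

lemma submodule_props:
  assumes "module k V" "submodule W k V"
  shows "\<And>x. x \<in> W \<Longrightarrow> x \<in> carrier V" "\<zero>\<^bsub>V\<^esub> \<in> W" "\<And>x y. x \<in> W \<Longrightarrow> y \<in> W \<Longrightarrow> x \<oplus>\<^bsub>V\<^esub> y \<in> W"
    "\<And>x. x \<in> W \<Longrightarrow> \<ominus>\<^bsub>V\<^esub> x \<in> W" "\<And>c x. c \<in> carrier k \<Longrightarrow> x \<in> W \<Longrightarrow> c \<odot>\<^bsub>V\<^esub> x \<in> W"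
  using module.submoduleE[OF assms] subgroup.one_closed[OF submodule.axioms(1)[OF assms(2)]] by auto

text \<open>By Zorn there is a subspace \<open>W\<close> maximal among those meeting
  \<open>N\<close> trivially. It is a complement: a vector \<open>v\<close> outside the sum of
  \<open>N\<close> and \<open>W\<close> would allow \<open>W\<close> to be enlarged by the line of
  \<open>v\<close>. The result is applied both to \<open>K\<close> and to \<open>I\<close>.\<close>

lemma subspace_projection:
  assumes k: "field k" and V: "module k V" and N: "submodule N k V"
  obtains p where "p \<in> linear_map k V V" "\<And>v. v \<in> carrier V \<Longrightarrow> p v \<in> N" "\<And>v. v \<in> N \<Longrightarrow> p v = v"
proof -
  interpret k: field k by fact
  interpret V: module k V by fact
  note Np = submodule_props[OF V N]
  let ?A = "{W. submodule W k V \<and> W \<inter> N \<subseteq> {\<zero>\<^bsub>V\<^esub>}}"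
  have A_ne: "{\<zero>\<^bsub>V\<^esub>} \<in> ?A"
    by (auto intro!: V.submoduleI)
  have A_chain: "\<Union>C \<in> ?A" if C: "C \<noteq> {}" "subset.chain ?A C" for C
  proof -
    have CA: "\<And>W. W \<in> C \<Longrightarrow> submodule W k V \<and> W \<inter> N \<subseteq> {\<zero>\<^bsub>V\<^esub>}" and
      chain: "\<And>W W'. W \<in> C \<Longrightarrow> W' \<in> C \<Longrightarrow> W \<subseteq> W' \<or> W' \<subseteq> W"
      using C(2) by (auto simp: subset_chain_def)
    have "submodule (\<Union>C) k V"
    proof (rule V.submoduleI)
      show "\<Union>C \<subseteq> carrier V" using CA submodule_props(1)[OF V] by blast
      show "\<zero>\<^bsub>V\<^esub> \<in> \<Union>C" using C(1) CA submodule_props(2)[OF V] by blast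
      show "\<ominus>\<^bsub>V\<^esub> a \<in> \<Union>C" if "a \<in> \<Union>C" for a using that CA submodule_props(4)[OF V] by blast
      show "c \<odot>\<^bsub>V\<^esub> a \<in> \<Union>C" if "c \<in> carrier k" "a \<in> \<Union>C" for c a using that CA submodule_props(5)[OF V] by blast
      fix a b assume "a \<in> \<Union>C" "b \<in> \<Union>C"
      then obtain W W' where W: "W \<in> C" "a \<in> W" "W' \<in> C" "b \<in> W'" by blast
      from chain[OF W(1,3)] show "a \<oplus>\<^bsub>V\<^esub> b \<in> \<Union>C"
      proof
        assume "W \<subseteq> W'"
        then have "a \<oplus>\<^bsub>V\<^esub> b \<in> W'" using W CA submodule_props(3)[OF V, of W' a b] by blast
        then show ?thesis using W by blast
      next
        assume "W' \<subseteq> W"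
        then have "a \<oplus>\<^bsub>V\<^esub> b \<in> W" using W CA submodule_props(3)[OF V, of W a b] by blast
        then show ?thesis using W by blast
      qed
    qed
    moreover have "\<Union>C \<inter> N \<subseteq> {\<zero>\<^bsub>V\<^esub>}" using CA by blast
    ultimately show ?thesis by blast
  qed
  have "?A \<noteq> {}" using A_ne by blast
  have "\<exists>W\<in>?A. \<forall>Y\<in>?A. W \<subseteq> Y \<longrightarrow> Y = W"
    by (rule subset_Zorn_nonempty[OF \<open>?A \<noteq> {}\<close>]) (rule A_chain)
  then obtain W where W_max: "W \<in> ?A" "\<forall>Y\<in>?A. W \<subseteq> Y \<longrightarrow> Y = W"
    by (elim bexE)
  from W_max have W: "submodule W k V" "W \<inter> N \<subseteq> {\<zero>\<^bsub>V\<^esub>}"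
    and max: "\<And>Y. submodule Y k V \<Longrightarrow> Y \<inter> N \<subseteq> {\<zero>\<^bsub>V\<^esub>} \<Longrightarrow> W \<subseteq> Y \<Longrightarrow> Y = W"
    by simp_all
  note Wp = submodule_props[OF V W(1)]
  have sum: "\<exists>n\<in>N. \<exists>w\<in>W. v = n \<oplus>\<^bsub>V\<^esub> w" if v: "v \<in> carrier V" for v
  proof (rule ccontr)
    assume neg: "\<not> ?thesis"
    let ?X = "{w \<oplus>\<^bsub>V\<^esub> c \<odot>\<^bsub>V\<^esub> v | w c. w \<in> W \<and> c \<in> carrier k}"
    have XI: "w \<oplus>\<^bsub>V\<^esub> c \<odot>\<^bsub>V\<^esub> v \<in> ?X" if "w \<in> W" "c \<in> carrier k" for w c using that by blast
    have "submodule ?X k V"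
    proof (rule V.submoduleI)
      show "?X \<subseteq> carrier V" using Wp(1) v by auto
      show "\<zero>\<^bsub>V\<^esub> \<in> ?X" using XI[OF Wp(2) k.zero_closed] v by simp
      fix a assume "a \<in> ?X"
      then obtain w c where a: "a = w \<oplus>\<^bsub>V\<^esub> c \<odot>\<^bsub>V\<^esub> v" "w \<in> W" "c \<in> carrier k" by blast
      have "\<ominus>\<^bsub>V\<^esub> a = \<ominus>\<^bsub>V\<^esub> w \<oplus>\<^bsub>V\<^esub> (\<ominus>\<^bsub>k\<^esub> c) \<odot>\<^bsub>V\<^esub> v"
        using a v Wp(1) by (simp add: V.M.minus_add V.smult_l_minus)
      then show "\<ominus>\<^bsub>V\<^esub> a \<in> ?X" using XI[OF Wp(4)[OF a(2)] k.a_inv_closed[OF a(3)]] by simp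
      show "d \<odot>\<^bsub>V\<^esub> a \<in> ?X" if d: "d \<in> carrier k" for d
      proof -
        have "d \<odot>\<^bsub>V\<^esub> a = d \<odot>\<^bsub>V\<^esub> w \<oplus>\<^bsub>V\<^esub> (d \<otimes>\<^bsub>k\<^esub> c) \<odot>\<^bsub>V\<^esub> v"
          using a v Wp(1) d by (simp add: V.smult_r_distr V.smult_assoc1)
        then show ?thesis using XI[OF Wp(5)[OF d a(2)] k.m_closed[OF d a(3)]] by simp
      qed
      fix b assume "b \<in> ?X"
      then obtain w' c' where b: "b = w' \<oplus>\<^bsub>V\<^esub> c' \<odot>\<^bsub>V\<^esub> v" "w' \<in> W" "c' \<in> carrier k" by blast
      have "a \<oplus>\<^bsub>V\<^esub> b = (w \<oplus>\<^bsub>V\<^esub> w') \<oplus>\<^bsub>V\<^esub> (c \<oplus>\<^bsub>k\<^esub> c') \<odot>\<^bsub>V\<^esub> v"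
        using a b v Wp(1) by (simp add: V.smult_l_distr V.M.a_ac)
      then show "a \<oplus>\<^bsub>V\<^esub> b \<in> ?X" using XI[OF Wp(3)[OF a(2) b(2)] k.a_closed[OF a(3) b(3)]] by simp
    qed
    moreover have "?X \<inter> N \<subseteq> {\<zero>\<^bsub>V\<^esub>}"
    proof
      fix n assume "n \<in> ?X \<inter> N"
      then obtain w c where n: "n = w \<oplus>\<^bsub>V\<^esub> c \<odot>\<^bsub>V\<^esub> v" "w \<in> W" "c \<in> carrier k" "n \<in> N" by blast
      show "n \<in> {\<zero>\<^bsub>V\<^esub>}"
      proof (cases "c = \<zero>\<^bsub>k\<^esub>")
        case True
        then have "n = w" using n v Wp(1) by simp
        then show ?thesis using n W(2) by blast
      next
        case False
        then have c: "inv\<^bsub>k\<^esub> c \<in> carrier k" "inv\<^bsub>k\<^esub> c \<otimes>\<^bsub>k\<^esub> c = \<one>\<^bsub>k\<^esub>"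
          using n(3) k.field_Units k.Units_l_inv by auto
        \<comment> \<open>Division by the nonzero coefficient of \<open>v\<close> would place
          \<open>v\<close> in the sum of \<open>N\<close> and \<open>W\<close>, against the choice
          of \<open>v\<close>.\<close>
        have "inv\<^bsub>k\<^esub> c \<odot>\<^bsub>V\<^esub> n = inv\<^bsub>k\<^esub> c \<odot>\<^bsub>V\<^esub> w \<oplus>\<^bsub>V\<^esub> v"
          using n c v Wp(1) by (simp add: V.smult_r_distr V.smult_assoc1[symmetric])
        then have "v = inv\<^bsub>k\<^esub> c \<odot>\<^bsub>V\<^esub> n \<oplus>\<^bsub>V\<^esub> \<ominus>\<^bsub>V\<^esub> (inv\<^bsub>k\<^esub> c \<odot>\<^bsub>V\<^esub> w)"
          using n c v Wp(1) V.M.a_comm[of _ v] by (simp add: V.M.a_assoc V.M.r_neg)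
        then show ?thesis
          using neg Np(5)[OF c(1) n(4)] Wp(4)[OF Wp(5)[OF c(1) n(2)]] by blast
      qed
    qed
    moreover have "W \<subseteq> ?X"
    proof
      fix w assume w: "w \<in> W"
      show "w \<in> ?X" using XI[OF w k.zero_closed] v Wp(1)[OF w] by simp
    qed
    ultimately have "?X = W" by (rule max)
    moreover have "v \<in> ?X" using XI[OF Wp(2) k.one_closed] v by simp
    ultimately have "v \<in> W" by simp
    then show False using neg Np(2) v by force
  qed
  have uniq: "n = n'" if "n \<in> N" "n' \<in> N" "w \<in> W" "w' \<in> W" "n \<oplus>\<^bsub>V\<^esub> w = n' \<oplus>\<^bsub>V\<^esub> w'" for n n' w w'
  proof -
    note cl = Np(1)[OF that(1)] Np(1)[OF that(2)] Wp(1)[OF that(3)] Wp(1)[OF that(4)]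
    have "n \<oplus>\<^bsub>V\<^esub> \<ominus>\<^bsub>V\<^esub> n' = n \<oplus>\<^bsub>V\<^esub> w \<oplus>\<^bsub>V\<^esub> \<ominus>\<^bsub>V\<^esub> w \<oplus>\<^bsub>V\<^esub> \<ominus>\<^bsub>V\<^esub> n'"
      using cl by (simp add: V.M.a_assoc V.M.r_neg)
    also have "\<dots> = n' \<oplus>\<^bsub>V\<^esub> (w' \<oplus>\<^bsub>V\<^esub> \<ominus>\<^bsub>V\<^esub> w) \<oplus>\<^bsub>V\<^esub> \<ominus>\<^bsub>V\<^esub> n'"
      unfolding that(5) using cl by (simp add: V.M.a_assoc)
    also have "\<dots> = w' \<oplus>\<^bsub>V\<^esub> \<ominus>\<^bsub>V\<^esub> w"
      using cl V.M.a_comm[of n' "w' \<oplus>\<^bsub>V\<^esub> \<ominus>\<^bsub>V\<^esub> w"] by (simp add: V.M.a_assoc V.M.r_neg)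
    finally have "n \<oplus>\<^bsub>V\<^esub> \<ominus>\<^bsub>V\<^esub> n' \<in> W"
      using Wp(3)[OF that(4) Wp(4)[OF that(3)]] by simp
    moreover have "n \<oplus>\<^bsub>V\<^esub> \<ominus>\<^bsub>V\<^esub> n' \<in> N"
      by (rule Np(3)[OF that(1) Np(4)[OF that(2)]])
    ultimately have "n \<oplus>\<^bsub>V\<^esub> \<ominus>\<^bsub>V\<^esub> n' \<in> W \<inter> N" by blast
    then have "n \<oplus>\<^bsub>V\<^esub> \<ominus>\<^bsub>V\<^esub> n' = \<zero>\<^bsub>V\<^esub>" using W(2) by blast
    then have "n \<oplus>\<^bsub>V\<^esub> \<ominus>\<^bsub>V\<^esub> n' \<oplus>\<^bsub>V\<^esub> n' = n'" using cl by simp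
    then show ?thesis using cl by (simp add: V.M.a_assoc V.M.l_neg)
  qed
  define p where "p v = (THE n. n \<in> N \<and> (\<exists>w\<in>W. v = n \<oplus>\<^bsub>V\<^esub> w))" for v
  have p_eq: "p (n \<oplus>\<^bsub>V\<^esub> w) = n" if "n \<in> N" "w \<in> W" for n w
    unfolding p_def by (rule the_equality) (use that uniq in blast)+
  show thesis
  proof (rule that)
    show "p v \<in> N" if "v \<in> carrier V" for v
      using sum[OF that] p_eq by auto
    show "p v = v" if "v \<in> N" for v
      using p_eq[OF that Wp(2)] Np(1)[OF that] by simp
    show "p \<in> linear_map k V V"
    proof (rule linear_mapI)
      fix v assume v: "v \<in> carrier V"
      then obtain n w where nw: "n \<in> N" "w \<in> W" "v = n \<oplus>\<^bsub>V\<^esub> w" using sum by blast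
      show "p v \<in> carrier V" using nw p_eq Np(1) by simp
      show "p (c \<odot>\<^bsub>V\<^esub> v) = c \<odot>\<^bsub>V\<^esub> p v" if c: "c \<in> carrier k" for c
        using p_eq[OF Np(5)[OF c nw(1)] Wp(5)[OF c nw(2)]] p_eq[OF nw(1,2)] nw Np(1) Wp(1) c
        by (simp add: V.smult_r_distr)
      fix v' assume v': "v' \<in> carrier V"
      then obtain n' w' where nw': "n' \<in> N" "w' \<in> W" "v' = n' \<oplus>\<^bsub>V\<^esub> w'" using sum by blast
      have "v \<oplus>\<^bsub>V\<^esub> v' = (n \<oplus>\<^bsub>V\<^esub> n') \<oplus>\<^bsub>V\<^esub> (w \<oplus>\<^bsub>V\<^esub> w')"
        using nw nw' Np(1) Wp(1) by (simp add: V.M.a_ac)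
      then show "p (v \<oplus>\<^bsub>V\<^esub> v') = p v \<oplus>\<^bsub>V\<^esub> p v'"
        using p_eq[OF Np(3)[OF nw(1) nw'(1)] Wp(3)[OF nw(2) nw'(2)]] p_eq[OF nw(1,2)] p_eq[OF nw'(1,2)] nw nw' by simp
    qed
  qed
qed

lemma (in abelian_group) finsum_swap:
  assumes "finite B" "finite C" "\<And>b c. b \<in> B \<Longrightarrow> c \<in> C \<Longrightarrow> f b c \<in> carrier G"
  shows "(\<Oplus>b\<in>B. \<Oplus>c\<in>C. f b c) = (\<Oplus>c\<in>C. \<Oplus>b\<in>B. f b c)"
  using assms(1,3)
proof (induction B rule: finite_induct)
  case empty
  then show ?case using finsum_zero by simp
next
  case (insert x F)
  have cl: "\<And>b. b \<in> insert x F \<Longrightarrow> (\<Oplus>c\<in>C. f b c) \<in> carrier G" "\<And>c. c \<in> C \<Longrightarrow> (\<Oplus>b\<in>F. f b c) \<in> carrier G"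
    using insert.prems by (auto intro!: finsum_closed)
  have "(\<Oplus>b\<in>insert x F. \<Oplus>c\<in>C. f b c) = (\<Oplus>c\<in>C. f x c) \<oplus> (\<Oplus>c\<in>C. \<Oplus>b\<in>F. f b c)"
    using insert cl by (subst finsum_insert) (auto simp: insert.IH)
  also have "\<dots> = (\<Oplus>c\<in>C. f x c \<oplus> (\<Oplus>b\<in>F. f b c))"
    using insert.prems cl by (intro finsum_addf[symmetric]) auto
  also have "\<dots> = (\<Oplus>c\<in>C. \<Oplus>b\<in>insert x F. f b c)"
    using insert cl by (intro finsum_cong') (auto intro!: finsum_closed)
  finally show ?case .
qed

text \<open>These are the rank-one maps from which dual basis expansions are summed up.\<close>

lemma functional_scale_linear:
  assumes "module k P" "\<xi> \<in> linear_map k M (ground_algebra k)" "g \<in> linear_map k B M" "p \<in> carrier P"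
  shows "(\<lambda>b. \<xi> (g b) \<odot>\<^bsub>P\<^esub> p) \<in> linear_map k B P"
proof -
  interpret P: module k P by fact
  have "(\<lambda>c. c \<odot>\<^bsub>P\<^esub> p) \<in> linear_map k (ground_algebra k) P"
    using assms(4) by (intro linear_mapI) (simp_all add: ground_algebra_def P.smult_l_distr P.smult_assoc1)
  with linear_map_comp[OF assms(3,2)] show ?thesis by (rule linear_map_comp)
qed

lemma functional_closed:
  "\<xi> \<in> linear_map k M (ground_algebra k) \<Longrightarrow> x \<in> carrier M \<Longrightarrow> \<xi> x \<in> carrier k"
  using linear_map_closed[of \<xi> k M "ground_algebra k" x] by (simp add: ground_algebra_def)

section \<open>The linear splitting of \<open>K \<subseteq> H\<close> and the coinvariants\<close>

lemma (in hopf_algebra) sweedler_sum: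
  assumes P: "module k P" and B: "finite B" and \<phi>: "\<And>b. b \<in> B \<Longrightarrow> (\<lambda>x y. \<phi> b x y) \<in> bilinear k H H P"
    and h: "h \<in> carrier H"
  shows "(\<Oplus>\<^bsub>P\<^esub>b\<in>B. sw P (\<lambda>x y. \<phi> b x y) h) = sw P (\<lambda>x y. \<Oplus>\<^bsub>P\<^esub>b\<in>B. \<phi> b x y) h"
proof -
  interpret P: module k P by fact
  have bil: "(\<lambda>x y. \<Oplus>\<^bsub>P\<^esub>b\<in>B. \<phi> b x y) \<in> bilinear k H H P"
    by (intro bilinearI linear_map_sum[OF P B] bilinear_left[OF \<phi>] bilinear_right[OF \<phi>])
  have "(\<Oplus>\<^bsub>P\<^esub>b\<in>B. tensor_lift P (\<lambda>x y. \<phi> b x y) (comul H h)) = tensor_lift P (\<lambda>x y. \<Oplus>\<^bsub>P\<^esub>b\<in>B. \<phi> b x y) (comul H h)"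
  proof (rule tensor_ext[OF module_A module_A _ _ _ comul_closed[OF h]])
    show "(\<lambda>t. \<Oplus>\<^bsub>P\<^esub>b\<in>B. tensor_lift P (\<lambda>x y. \<phi> b x y) t) \<in> linear_map k HH P"
      by (intro linear_map_sum[OF P B] tensor_lift_linear[OF module_A module_A P] \<phi>)
    show "tensor_lift P (\<lambda>x y. \<Oplus>\<^bsub>P\<^esub>b\<in>B. \<phi> b x y) \<in> linear_map k HH P"
      by (rule tensor_lift_linear[OF module_A module_A P bil])
    fix x y assume x: "x \<in> carrier H" and y: "y \<in> carrier H"
    have "(\<Oplus>\<^bsub>P\<^esub>b\<in>B. tensor_lift P (\<lambda>x y. \<phi> b x y) (ptensor k H H x y)) = (\<Oplus>\<^bsub>P\<^esub>b\<in>B. \<phi> b x y)"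
      by (rule P.M.finsum_cong') (auto simp: tensor_lift_ptensor[OF module_A module_A P \<phi>] bilinear_closed[OF \<phi>] x y)
    then show "(\<Oplus>\<^bsub>P\<^esub>b\<in>B. tensor_lift P (\<lambda>x y. \<phi> b x y) (ptensor k H H x y))
        = tensor_lift P (\<lambda>x y. \<Oplus>\<^bsub>P\<^esub>b\<in>B. \<phi> b x y) (ptensor k H H x y)"
      using tensor_lift_ptensor[OF module_A module_A P bil x y] by simp
  qed
  then show ?thesis by (simp add: sweedler_def)
qed

text \<open>
  A finite dual basis of \<open>H\<close> and a linear projection \<open>P\<close> onto \<open>K\<close>. The vectors \<open>P b\<close> with the
  functionals \<open>co b\<close> then form a dual basis of \<open>K\<close>.
\<close>

locale split_subalgebra = normal_subalgebra k H K
  for k :: "('k, 'x) ring_scheme" (structure) and H :: "('k, 'h, 'y) hopf_scheme" (structure) and K :: "'h set" +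
  fixes B :: "'h set" and co :: "'h \<Rightarrow> 'h \<Rightarrow> 'k" and P :: "'h \<Rightarrow> 'h"
  assumes finite_B: "finite B" and B_closed: "b \<in> B \<Longrightarrow> b \<in> carrier H"
    and co_linear: "b \<in> B \<Longrightarrow> co b \<in> linear_map k H (ground_algebra k)"
    and co_sum: "v \<in> carrier H \<Longrightarrow> (\<Oplus>\<^bsub>H\<^esub>b\<in>B. co b v \<odot>\<^bsub>H\<^esub> b) = v"
    and P_linear: "P \<in> linear_map k H H"
    and P_in_K: "v \<in> carrier H \<Longrightarrow> P v \<in> K"
    and P_K: "z \<in> K \<Longrightarrow> P z = z"
begin

lemma P_closed: "v \<in> carrier H \<Longrightarrow> P v \<in> carrier H"
  by (rule K_sub[OF P_in_K])

lemma co_closed: "b \<in> B \<Longrightarrow> v \<in> carrier H \<Longrightarrow> co b v \<in> carrier k"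
  by (rule functional_closed[OF co_linear])

lemma K_expand:
  assumes "z \<in> K"
  shows "(\<Oplus>\<^bsub>H\<^esub>b\<in>B. co b z \<odot>\<^bsub>H\<^esub> P b) = z"
proof -
  have z: "z \<in> carrier H" by (rule K_sub[OF assms])
  have "z = P (\<Oplus>\<^bsub>H\<^esub>b\<in>B. co b z \<odot>\<^bsub>H\<^esub> b)"
    using co_sum[OF z] P_K[OF assms] by simp
  also have "\<dots> = (\<Oplus>\<^bsub>H\<^esub>b\<in>B. P (co b z \<odot>\<^bsub>H\<^esub> b))"
    by (rule linear_map_finsum[OF P_linear module_A module_A finite_B]) (simp add: co_closed z B_closed)
  also have "\<dots> = (\<Oplus>\<^bsub>H\<^esub>b\<in>B. co b z \<odot>\<^bsub>H\<^esub> P b)"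
    by (rule M.finsum_cong') (simp_all add: linear_map_smult[OF P_linear] co_closed z B_closed P_closed)
  finally show ?thesis ..
qed

text \<open>The form in which the dual basis of \<open>K\<close> is used. Read from left to right it
  collapses a sum over \<open>B\<close>; read from right to left it introduces one.\<close>

lemma linear_K_expand:
  assumes f: "f \<in> linear_map k H V" and V: "module k V" and z: "z \<in> K"
  shows "(\<Oplus>\<^bsub>V\<^esub>b\<in>B. co b z \<odot>\<^bsub>V\<^esub> f (P b)) = f z"
proof -
  interpret V: module k V by fact
  have zH: "z \<in> carrier H" by (rule K_sub[OF z])
  have "f z = (\<Oplus>\<^bsub>V\<^esub>b\<in>B. f (co b z \<odot>\<^bsub>H\<^esub> P b))"
    using linear_map_finsum[OF f module_A V finite_B, of "\<lambda>b. co b z \<odot>\<^bsub>H\<^esub> P b"] K_expand[OF z]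
    by (simp add: co_closed zH B_closed P_closed)
  also have "\<dots> = (\<Oplus>\<^bsub>V\<^esub>b\<in>B. co b z \<odot>\<^bsub>V\<^esub> f (P b))"
    by (rule V.M.finsum_cong')
      (simp_all add: linear_map_smult[OF f] linear_map_closed[OF f] co_closed zH B_closed P_closed)
  finally show ?thesis ..
qed

lemma K_finsum: "finite A \<Longrightarrow> (\<And>i. i \<in> A \<Longrightarrow> f i \<in> K) \<Longrightarrow> (\<Oplus>\<^bsub>H\<^esub>i\<in>A. f i) \<in> K"
proof (induction A rule: finite_induct)
  case empty
  then show ?case by (simp add: K_closed)
next
  case (insert a A)
  have "f \<in> A \<rightarrow> carrier H" "f a \<in> carrier H" using insert.prems by (auto intro: K_sub)
  then show ?case using insert by (simp add: K_closed)
qed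

text \<open>
  The splitting below is \<open>h \<mapsto> \<Sum>\<^sub>b co\<^sub>b(S(f(P b)\<^sub>1)) f(P b)\<^sub>2\<close> with \<open>f = twist h\<close>. It is obtained by
  writing out the isomorphisms between the coinduced \<open>K\<close>-module of linear maps \<open>K \<rightarrow> K\<close>, its
  diagonal form and a sum of copies of \<open>K\<close>, which show that \<open>K\<close> is a self-injective ring; for
  \<open>h = 1\<close> the map \<open>f\<close> is \<open>y \<mapsto> \<epsilon>(y) 1\<close>.
\<close>

definition twist :: "'h \<Rightarrow> 'h \<Rightarrow> 'h" where
  "twist h y = sw H (\<lambda>a c. P (h \<star> a) \<star> S c) y"

text \<open>The functional \<open>\<xi>\<close> contracts the first factor of
  \<open>S(w\<^sub>1) \<otimes> w\<^sub>2\<close>. With \<open>\<xi> = co b\<close>,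
  \<open>w = twist h (P b)\<close> and a sum over \<open>b\<close> it becomes the partial trace,
  over the first factor, of a linear map from \<open>K\<close> to
  \<open>K \<otimes> K\<close>.\<close>

definition ev :: "('h \<Rightarrow> 'k) \<Rightarrow> 'h \<Rightarrow> 'h" where
  "ev \<xi> w = sw H (\<lambda>u v. \<xi> (S u) \<odot>\<^bsub>H\<^esub> v) w"

lemmas srules = sw_rules linear_map_comp[OF _ P_linear] P_closed co_closed functional_scale_linear[OF module_A co_linear]
  linear_map_sum[OF module_A finite_B]

lemma twist_linear: "h \<in> carrier H \<Longrightarrow> (\<lambda>y. twist h y) \<in> linear_map k H H"
  and twist_linear_left: "y \<in> carrier H \<Longrightarrow> (\<lambda>h. twist h y) \<in> linear_map k H H"
  unfolding twist_def by (assumption | rule srules)+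

lemma twist_K:
  assumes h: "h \<in> carrier H" and y: "y \<in> K"
  shows "twist h y \<in> K"
  unfolding twist_def using module_A _ y
proof (rule K_sweedler_induct)
  show "(\<lambda>a c. P (h \<star> a) \<star> S c) \<in> bilinear k H H H"
    by (insert h, (assumption | rule srules)+)
  show "P (h \<star> a) \<star> S c \<in> K" if "a \<in> K" "c \<in> K" for a c
    using that h by (simp add: K_closed P_in_K K_antipode K_sub)
qed (rule K_closed)

text \<open>The right-hand side is
  \<open>P(h x\<^sub>1 y\<^sub>1) S(x\<^sub>2 y\<^sub>2) x\<^sub>3\<close>. Since \<open>S\<close>
  reverses products, \<open>S(x\<^sub>2)\<close> meets \<open>x\<^sub>3\<close> and both cancel,
  leaving \<open>P(h x y\<^sub>1) S(y\<^sub>2)\<close>.\<close>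

lemma twist_mult:
  assumes h: "h \<in> carrier H" and x: "x \<in> carrier H" and y: "y \<in> carrier H"
  shows "twist (h \<star> x) y = sw H (\<lambda>a c. twist h (a \<star> y) \<star> c) x"
proof -
  note H = module_A
  have "sw H (\<lambda>a c. twist h (a \<star> y) \<star> c) x
      = sw H (\<lambda>a c. sw H (\<lambda>r s. sw H (\<lambda>t u. P (h \<star> (r \<star> t)) \<star> (S u \<star> (S s \<star> c))) y) a) x"
  proof (rule sweedler_cong[OF H _ x])
    show "(\<lambda>a c. twist h (a \<star> y) \<star> c) \<in> bilinear k H H H"
      unfolding twist_def by (insert h y, (assumption | rule srules)+)
    fix a c assume a: "a \<in> carrier H" and c: "c \<in> carrier H"
    have "twist h (a \<star> y) = sw H (\<lambda>r s. sw H (\<lambda>t u. P (h \<star> (r \<star> t)) \<star> S (s \<star> u)) y) a"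
      unfolding twist_def by (rule sweedler_mult[OF H _ a y]) (insert h, (assumption | rule srules)+)
    then have "twist h (a \<star> y) \<star> c = sw H (\<lambda>r s. sw H (\<lambda>t u. P (h \<star> (r \<star> t)) \<star> S (s \<star> u)) y) a \<star> c"
      by simp
    also have "\<dots> = sw H (\<lambda>r s. sw H (\<lambda>t u. P (h \<star> (r \<star> t)) \<star> S (s \<star> u)) y \<star> c) a"
      by (rule sweedler_fuse[OF H H _ _ a, where f = "\<lambda>z. z \<star> c"]) (insert h c y, (assumption | rule srules)+)
    also have "\<dots> = sw H (\<lambda>r s. sw H (\<lambda>t u. P (h \<star> (r \<star> t)) \<star> S (s \<star> u) \<star> c) y) a"
      by (rule sweedler_cong[OF H _ a])
        (insert h c y, (assumption | rule srules sweedler_fuse[OF H H _ _ y, where f = "\<lambda>z. z \<star> c"])+)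
    also have "\<dots> = sw H (\<lambda>r s. sw H (\<lambda>t u. P (h \<star> (r \<star> t)) \<star> (S u \<star> (S s \<star> c))) y) a"
      by (intro sweedler_cong H a y)
        (insert h c y, (assumption | rule srules | simp add: antipode_mult antipode_closed P_closed A.m_assoc)+)
    finally show "twist h (a \<star> y) \<star> c
      = sw H (\<lambda>r s. sw H (\<lambda>t u. P (h \<star> (r \<star> t)) \<star> (S u \<star> (S s \<star> c))) y) a" .
  qed
  also have "\<dots> = sw H (\<lambda>t u. P (h \<star> (x \<star> t)) \<star> (S u \<star> \<one>\<^bsub>H\<^esub>)) y"
    by (rule sweedler_cancel_right(2)[where \<psi> = "\<lambda>r w. sw H (\<lambda>t u. P (h \<star> (r \<star> t)) \<star> (S u \<star> w)) y",
          OF H antipodal_left _ x])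
      (insert h y, (assumption | rule srules)+)
  also have "\<dots> = twist (h \<star> x) y"
    unfolding twist_def
    by (rule sweedler_cong[OF H _ y]) (insert h x, (assumption | rule srules | simp add: A.m_assoc antipode_closed)+)
  finally show ?thesis ..
qed

lemma ev_linear:
  assumes "\<xi> \<in> linear_map k H (ground_algebra k)"
  shows "(\<lambda>w. ev \<xi> w) \<in> linear_map k H H"
  unfolding ev_def
  by (assumption | rule srules linear_map_id functional_scale_linear[OF module_A assms] functional_closed[OF assms])+

lemma functional_mult:
  "\<xi> \<in> linear_map k H (ground_algebra k) \<Longrightarrow> a \<in> carrier H \<Longrightarrow> (\<lambda>y. \<xi> (a \<star> y)) \<in> linear_map k H (ground_algebra k)"
  by (rule linear_map_comp[OF bilinear_right[OF mult_bilinear]])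

text \<open>The left-hand side is
  \<open>\<xi>(x\<^sub>1 S(w\<^sub>1 x\<^sub>2)) w\<^sub>2 x\<^sub>3\<close>, and
  \<open>S(w\<^sub>1 x\<^sub>2) = S(x\<^sub>2) S(w\<^sub>1)\<close> lets
  \<open>x\<^sub>1 S(x\<^sub>2)\<close> cancel. So left multiplication inside the functional is
  traded for right multiplication outside.\<close>

lemma ev_mult:
  assumes \<xi>: "\<xi> \<in> linear_map k H (ground_algebra k)" and w: "w \<in> carrier H" and x: "x \<in> carrier H"
  shows "sw H (\<lambda>a c. ev (\<lambda>y. \<xi> (a \<star> y)) (w \<star> c)) x = ev \<xi> w \<star> x"
proof -
  note H = module_A
  note rs = srules functional_scale_linear[OF module_A \<xi>] functional_closed[OF \<xi>]
  have "sw H (\<lambda>a c. ev (\<lambda>y. \<xi> (a \<star> y)) (w \<star> c)) x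
      = sw H (\<lambda>a c. sw H (\<lambda>u v. sw H (\<lambda>s t. \<xi> (a \<star> S (u \<star> s)) \<odot>\<^bsub>H\<^esub> (v \<star> t)) c) w) x"
    unfolding ev_def
    by (rule sweedler_cong[OF H _ x]) (insert w, (assumption | rule rs sweedler_mult)+)
  also have "\<dots> = sw H (\<lambda>a c. sw H (\<lambda>u v. sw H (\<lambda>s t. \<xi> (a \<star> S s \<star> S u) \<odot>\<^bsub>H\<^esub> (v \<star> t)) c) w) x"
    by (intro sweedler_cong H x w) (insert w, (assumption | rule rs | simp add: antipode_mult A.m_assoc antipode_closed)+)
  also have "\<dots> = sw H (\<lambda>u v. sw H (\<lambda>a c. sw H (\<lambda>s t. \<xi> (a \<star> S s \<star> S u) \<odot>\<^bsub>H\<^esub> (v \<star> t)) c) x) w"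
    by (rule sweedler_swap[OF H x w]) (insert w, (assumption | rule rs)+)
  also have "\<dots> = sw H (\<lambda>u v. \<xi> (S u) \<odot>\<^bsub>H\<^esub> v \<star> x) w"
  proof (rule sweedler_cong[OF H _ w])
    show "(\<lambda>u v. sw H (\<lambda>a c. sw H (\<lambda>s t. \<xi> (a \<star> S s \<star> S u) \<odot>\<^bsub>H\<^esub> (v \<star> t)) c) x) \<in> bilinear k H H H"
      by (insert x, (assumption | rule rs)+)
    fix u v assume u: "u \<in> carrier H" and v: "v \<in> carrier H"
    have "sw H (\<lambda>a c. sw H (\<lambda>s t. \<xi> (a \<star> S s \<star> S u) \<odot>\<^bsub>H\<^esub> (v \<star> t)) c) x
        = \<xi> (\<one>\<^bsub>H\<^esub> \<star> S u) \<odot>\<^bsub>H\<^esub> (v \<star> x)"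
      by (rule sweedler_cancel_left(2)[where \<psi> = "\<lambda>g t. \<xi> (g \<star> S u) \<odot>\<^bsub>H\<^esub> (v \<star> t)", OF H antipodal_right _ x])
        (insert u v, (assumption | rule rs)+)
    then show "sw H (\<lambda>a c. sw H (\<lambda>s t. \<xi> (a \<star> S s \<star> S u) \<odot>\<^bsub>H\<^esub> (v \<star> t)) c) x = \<xi> (S u) \<odot>\<^bsub>H\<^esub> v \<star> x"
      using u v x by (simp add: antipode_closed smult_mult_left functional_closed[OF \<xi>])
  qed
  also have "\<dots> = ev \<xi> w \<star> x"
    unfolding ev_def
    by (rule sweedler_fuse[OF H H _ _ w, symmetric, where f = "\<lambda>z. z \<star> x"]) (insert x, (assumption | rule rs)+)
  finally show ?thesis .
qed

text \<open>For \<open>z\<close> in \<open>K\<close> the functional is evaluated only at elements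
  \<open>S z\<^sub>1\<close> of \<open>K\<close>, and these can be expanded in the dual basis of
  \<open>K\<close>.\<close>

lemma ev_dual:
  assumes \<xi>: "\<xi> \<in> linear_map k H (ground_algebra k)" and z: "z \<in> K"
  shows "(\<Oplus>\<^bsub>H\<^esub>b\<in>B. \<xi> (P b) \<odot>\<^bsub>H\<^esub> ev (co b) z) = ev \<xi> z"
proof -
  note H = module_A
  note rs = srules functional_scale_linear[OF module_A \<xi>] functional_closed[OF \<xi>] B_closed
  have zH: "z \<in> carrier H" by (rule K_sub[OF z])
  have "(\<Oplus>\<^bsub>H\<^esub>b\<in>B. \<xi> (P b) \<odot>\<^bsub>H\<^esub> ev (co b) z) = (\<Oplus>\<^bsub>H\<^esub>b\<in>B. sw H (\<lambda>u v. \<xi> (P b) \<odot>\<^bsub>H\<^esub> (co b (S u) \<odot>\<^bsub>H\<^esub> v)) z)"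
  proof (rule M.finsum_cong')
    show "(\<lambda>b. sw H (\<lambda>u v. \<xi> (P b) \<odot>\<^bsub>H\<^esub> (co b (S u) \<odot>\<^bsub>H\<^esub> v)) z) \<in> B \<rightarrow> carrier H"
      by (rule Pi_I) (insert zH, (assumption | rule rs)+)
    show "\<xi> (P b) \<odot>\<^bsub>H\<^esub> ev (co b) z = sw H (\<lambda>u v. \<xi> (P b) \<odot>\<^bsub>H\<^esub> (co b (S u) \<odot>\<^bsub>H\<^esub> v)) z" if "b \<in> B" for b
      unfolding ev_def by (rule sweedler_fuse[OF H H _ _ zH]) (insert that, (assumption | rule rs)+)
  qed simp
  also have "\<dots> = sw H (\<lambda>u v. \<Oplus>\<^bsub>H\<^esub>b\<in>B. \<xi> (P b) \<odot>\<^bsub>H\<^esub> (co b (S u) \<odot>\<^bsub>H\<^esub> v)) z"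
    by (rule sweedler_sum[OF H finite_B _ zH]) (assumption | rule rs)+
  also have "\<dots> = ev \<xi> z"
    unfolding ev_def
  proof (rule K_sweedler_cong[OF H _ _ z])
    show "(\<lambda>u v. \<Oplus>\<^bsub>H\<^esub>b\<in>B. \<xi> (P b) \<odot>\<^bsub>H\<^esub> (co b (S u) \<odot>\<^bsub>H\<^esub> v)) \<in> bilinear k H H H"
      "(\<lambda>u v. \<xi> (S u) \<odot>\<^bsub>H\<^esub> v) \<in> bilinear k H H H"
      by (assumption | rule rs)+
    fix u v assume u: "u \<in> K" and v: "v \<in> K"
    have Su: "S u \<in> K" by (rule K_antipode[OF u])
    have lin: "(\<lambda>y. \<xi> y \<odot>\<^bsub>H\<^esub> v) \<in> linear_map k H H"
      by (insert K_sub[OF v], (assumption | rule rs)+)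
    have "(\<Oplus>\<^bsub>H\<^esub>b\<in>B. \<xi> (P b) \<odot>\<^bsub>H\<^esub> (co b (S u) \<odot>\<^bsub>H\<^esub> v)) = (\<Oplus>\<^bsub>H\<^esub>b\<in>B. co b (S u) \<odot>\<^bsub>H\<^esub> (\<xi> (P b) \<odot>\<^bsub>H\<^esub> v))"
      by (rule M.finsum_cong')
        (simp_all add: co_closed K_sub[OF Su] K_sub[OF v] functional_closed[OF \<xi>] P_closed B_closed smult_assoc1[symmetric] K.m_comm)
    also have "\<dots> = \<xi> (S u) \<odot>\<^bsub>H\<^esub> v"
      by (rule linear_K_expand[OF lin H Su])
    finally show "(\<Oplus>\<^bsub>H\<^esub>b\<in>B. \<xi> (P b) \<odot>\<^bsub>H\<^esub> (co b (S u) \<odot>\<^bsub>H\<^esub> v)) = \<xi> (S u) \<odot>\<^bsub>H\<^esub> v" .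
  qed
  finally show ?thesis .
qed

text \<open>Cyclicity of the trace over \<open>K\<close>.\<close>

lemma trace_shift:
  assumes h: "h \<in> carrier H" and a: "a \<in> K" and c: "c \<in> K"
  shows "(\<Oplus>\<^bsub>H\<^esub>b\<in>B. ev (co b) (twist h (a \<star> P b) \<star> c))
       = (\<Oplus>\<^bsub>H\<^esub>d\<in>B. ev (\<lambda>y. co d (a \<star> y)) (twist h (P d) \<star> c))"
proof -
  note H = module_A
  have aH: "a \<in> carrier H" and cH: "c \<in> carrier H" using a c by (simp_all add: K_sub)
  have aP: "a \<star> P b \<in> K" if "b \<in> B" for b using a that by (simp add: K_closed P_in_K B_closed)
  have lin: "(\<lambda>y. ev (co b) (twist h y \<star> c)) \<in> linear_map k H H" if "b \<in> B" for b
    by (rule linear_map_comp[OF _ ev_linear[OF co_linear[OF that]]], rule mult_linear_left[OF twist_linear[OF h] cH])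
  have cl: "co d (a \<star> P b) \<odot>\<^bsub>H\<^esub> ev (co b) (twist h (P d) \<star> c) \<in> carrier H" if "b \<in> B" "d \<in> B" for b d
    using that linear_map_closed[OF lin[OF that(1)] P_closed[OF B_closed[OF that(2)]]] aP[OF that(1)]
    by (simp add: co_closed K_sub)
  \<comment> \<open>Expanding \<open>a \<star> P b\<close> in the dual basis gives a double sum.
    After the exchange the sum over \<open>b\<close> collapses by \<open>ev_dual\<close>, applied to
    the functional \<open>y \<mapsto> co d (a y)\<close>.\<close>
  have "(\<Oplus>\<^bsub>H\<^esub>b\<in>B. ev (co b) (twist h (a \<star> P b) \<star> c))
      = (\<Oplus>\<^bsub>H\<^esub>b\<in>B. \<Oplus>\<^bsub>H\<^esub>d\<in>B. co d (a \<star> P b) \<odot>\<^bsub>H\<^esub> ev (co b) (twist h (P d) \<star> c))"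
    by (rule M.finsum_cong') (simp_all add: linear_K_expand[OF lin H aP] linear_map_closed[OF lin] K_sub[OF aP])
  also have "\<dots> = (\<Oplus>\<^bsub>H\<^esub>d\<in>B. \<Oplus>\<^bsub>H\<^esub>b\<in>B. co d (a \<star> P b) \<odot>\<^bsub>H\<^esub> ev (co b) (twist h (P d) \<star> c))"
    by (rule M.finsum_swap[OF finite_B finite_B cl])
  also have "\<dots> = (\<Oplus>\<^bsub>H\<^esub>d\<in>B. ev (\<lambda>y. co d (a \<star> y)) (twist h (P d) \<star> c))"
  proof (rule M.finsum_cong')
    fix d assume d: "d \<in> B"
    have "twist h (P d) \<star> c \<in> K" using twist_K[OF h P_in_K[OF B_closed[OF d]]] c by (simp add: K_closed)
    then show "(\<Oplus>\<^bsub>H\<^esub>b\<in>B. co d (a \<star> P b) \<odot>\<^bsub>H\<^esub> ev (co b) (twist h (P d) \<star> c))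
        = ev (\<lambda>y. co d (a \<star> y)) (twist h (P d) \<star> c)"
      by (rule ev_dual[OF functional_mult[OF co_linear[OF d] aH]])
  next
    show "(\<lambda>d. ev (\<lambda>y. co d (a \<star> y)) (twist h (P d) \<star> c)) \<in> B \<rightarrow> carrier H"
    proof (rule Pi_I)
      fix d assume d: "d \<in> B"
      show "ev (\<lambda>y. co d (a \<star> y)) (twist h (P d) \<star> c) \<in> carrier H"
        by (rule linear_map_closed[OF ev_linear[OF functional_mult[OF co_linear[OF d] aH]]])
          (use linear_map_closed[OF twist_linear[OF h]] d cH in \<open>simp add: P_closed B_closed\<close>)
    qed
  qed simp
  finally show ?thesis .
qed

definition splitting :: "'h \<Rightarrow> 'h" where
  "splitting h = (\<Oplus>\<^bsub>H\<^esub>b\<in>B. ev (co b) (twist h (P b)))"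

lemma splitting_linear: "splitting \<in> linear_map k H H"
  unfolding splitting_def
  by (rule linear_map_sum[OF module_A finite_B])
    (rule linear_map_comp[OF twist_linear_left[OF P_closed[OF B_closed]] ev_linear[OF co_linear]])

lemma ev_K:
  assumes \<xi>: "\<xi> \<in> linear_map k H (ground_algebra k)" and z: "z \<in> K"
  shows "ev \<xi> z \<in> K"
  unfolding ev_def using module_A _ z
proof (rule K_sweedler_induct)
  show "(\<lambda>u v. \<xi> (S u) \<odot>\<^bsub>H\<^esub> v) \<in> bilinear k H H H"
    by (assumption | rule srules functional_scale_linear[OF module_A \<xi>] functional_closed[OF \<xi>])+
  show "\<xi> (S u) \<odot>\<^bsub>H\<^esub> v \<in> K" if "u \<in> K" "v \<in> K" for u v
    using that by (simp add: K_closed functional_closed[OF \<xi>] K_sub antipode_closed)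
qed (rule K_closed)

lemma splitting_in_K: "h \<in> carrier H \<Longrightarrow> splitting h \<in> K"
  unfolding splitting_def
  by (rule K_finsum[OF finite_B]) (simp add: ev_K co_linear twist_K P_in_K B_closed)

text \<open>\<open>twist_mult\<close> places \<open>x\<^sub>1\<close> in the argument of
  \<open>twist h\<close> and \<open>x\<^sub>2\<close> to the right of its value;
  \<open>trace_shift\<close> moves \<open>x\<^sub>1\<close> into the functional, which is possible
  because the components of \<open>x\<close> lie in \<open>K\<close>; finally \<open>ev_mult\<close>
  recombines both into a factor \<open>x\<close> on the right.\<close>

lemma splitting_mult:
  assumes h: "h \<in> carrier H" and x: "x \<in> K"
  shows "splitting (h \<star> x) = splitting h \<star> x"
proof -
  note H = module_A
  have xH: "x \<in> carrier H" by (rule K_sub[OF x])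
  note twist_rules = linear_map_comp[OF _ twist_linear[OF h]] linear_map_closed[OF twist_linear[OF h]] B_closed
  note rs = srules twist_rules linear_map_comp[OF _ ev_linear[OF co_linear]] linear_map_closed[OF ev_linear[OF co_linear]]
  have ev_rs: "(\<lambda>a. ev (\<lambda>y. co b (a \<star> y)) w) \<in> linear_map k H H"
    if "b \<in> B" "w \<in> carrier H" for b w
    unfolding ev_def by (insert that, (assumption | rule srules)+)
  have bil2: "(\<lambda>a c. ev (\<lambda>y. co b (a \<star> y)) (twist h (P b) \<star> c)) \<in> bilinear k H H H" if "b \<in> B" for b
    by (insert that, (assumption | rule rs ev_rs linear_map_comp[OF _ ev_linear[OF functional_mult[OF co_linear]]])+)
  have "splitting (h \<star> x) = (\<Oplus>\<^bsub>H\<^esub>b\<in>B. sw H (\<lambda>a c. ev (co b) (twist h (a \<star> P b) \<star> c)) x)"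
    unfolding splitting_def
  proof (rule M.finsum_cong')
    show "(\<lambda>b. sw H (\<lambda>a c. ev (co b) (twist h (a \<star> P b) \<star> c)) x) \<in> B \<rightarrow> carrier H"
      by (rule Pi_I) (insert xH, (assumption | rule rs)+)
    fix b assume b: "b \<in> B"
    show "ev (co b) (twist (h \<star> x) (P b)) = sw H (\<lambda>a c. ev (co b) (twist h (a \<star> P b) \<star> c)) x"
      unfolding twist_mult[OF h xH P_closed[OF B_closed[OF b]]]
      by (rule sweedler_fuse[OF H H _ ev_linear[OF co_linear[OF b]] xH]) (insert b, (assumption | rule rs)+)
  qed simp
  also have "\<dots> = sw H (\<lambda>a c. \<Oplus>\<^bsub>H\<^esub>b\<in>B. ev (co b) (twist h (a \<star> P b) \<star> c)) x"
    by (rule sweedler_sum[OF H finite_B _ xH]) (assumption | rule rs)+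
  also have "\<dots> = sw H (\<lambda>a c. \<Oplus>\<^bsub>H\<^esub>b\<in>B. ev (\<lambda>y. co b (a \<star> y)) (twist h (P b) \<star> c)) x"
    by (rule K_sweedler_cong[OF H _ _ x])
      (assumption | rule rs trace_shift[OF h] bilinear_left[OF bil2] bilinear_right[OF bil2])+
  also have "\<dots> = (\<Oplus>\<^bsub>H\<^esub>b\<in>B. sw H (\<lambda>a c. ev (\<lambda>y. co b (a \<star> y)) (twist h (P b) \<star> c)) x)"
    by (rule sweedler_sum[OF H finite_B bil2 xH, symmetric])
  also have "\<dots> = (\<Oplus>\<^bsub>H\<^esub>b\<in>B. ev (co b) (twist h (P b)) \<star> x)"
    by (rule M.finsum_cong')
      (simp_all add: ev_mult[OF co_linear _ xH] linear_map_closed[OF twist_linear[OF h]] P_closed B_closed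
        linear_map_closed[OF ev_linear[OF co_linear]] xH)
  also have "\<dots> = splitting h \<star> x"
    unfolding splitting_def
    by (rule linear_map_finsum[OF bilinear_left[OF mult_bilinear xH] H H finite_B, symmetric])
      (simp add: linear_map_closed[OF twist_linear[OF h]] P_closed B_closed linear_map_closed[OF ev_linear[OF co_linear]])
  finally show ?thesis .
qed

text \<open>\<open>P\<close> is the identity on \<open>K\<close>, so \<open>twist 1\<close> sends
  \<open>y\<close> in \<open>K\<close> to \<open>e(y) 1\<close>. What remains is the trace of this
  rank-one map, namely \<open>e(1) = 1\<close>, evaluated with the dual basis.\<close>

lemma splitting_one: "splitting \<one>\<^bsub>H\<^esub> = \<one>\<^bsub>H\<^esub>"
proof -
  note H = module_A
  have tw: "twist \<one>\<^bsub>H\<^esub> z = e z \<odot>\<^bsub>H\<^esub> \<one>\<^bsub>H\<^esub>" if z: "z \<in> K" for z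
  proof -
    have "twist \<one>\<^bsub>H\<^esub> z = sw H (\<lambda>a c. a \<star> S c) z"
      unfolding twist_def
      by (rule K_sweedler_cong[OF H _ _ z]) (assumption | rule srules | simp add: P_K K_sub)+
    then show ?thesis using antipodal_right K_sub[OF z] by (simp add: antipodal_def)
  qed
  have summand: "ev (co b) (twist \<one>\<^bsub>H\<^esub> (P b)) = co b \<one>\<^bsub>H\<^esub> \<odot>\<^bsub>H\<^esub> (e (P b) \<odot>\<^bsub>H\<^esub> \<one>\<^bsub>H\<^esub>)" if b: "b \<in> B" for b
  proof -
    have "ev (co b) \<one>\<^bsub>H\<^esub> = co b (S \<one>\<^bsub>H\<^esub>) \<odot>\<^bsub>H\<^esub> \<one>\<^bsub>H\<^esub>"
      unfolding ev_def by (rule sweedler_one[OF H]) (insert b, (assumption | rule srules)+)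
    then show ?thesis
      using b by (simp add: tw P_in_K B_closed linear_map_smult[OF ev_linear[OF co_linear]] antipode_one
          counit_closed P_closed co_closed smult_assoc1[symmetric] K.m_comm)
  qed
  have one: "\<one>\<^bsub>H\<^esub> \<in> K" by (simp add: K_closed)
  have lin: "(\<lambda>y. e y \<odot>\<^bsub>H\<^esub> \<one>\<^bsub>H\<^esub>) \<in> linear_map k H H"
    by (assumption | rule srules)+
  have "splitting \<one>\<^bsub>H\<^esub> = (\<Oplus>\<^bsub>H\<^esub>b\<in>B. co b \<one>\<^bsub>H\<^esub> \<odot>\<^bsub>H\<^esub> (e (P b) \<odot>\<^bsub>H\<^esub> \<one>\<^bsub>H\<^esub>))"
    unfolding splitting_def
    by (rule M.finsum_cong') (simp_all add: summand co_closed counit_closed P_closed B_closed)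
  also have "\<dots> = e \<one>\<^bsub>H\<^esub> \<odot>\<^bsub>H\<^esub> \<one>\<^bsub>H\<^esub>"
    by (rule linear_K_expand[OF lin H one])
  finally show ?thesis by (simp add: counit_one)
qed

section \<open>The coinvariants of the coaction\<close>

lemma coinvariants_eq: "coinvariants k L H coact = K"
proof
  show "K \<subseteq> coinvariants k L H coact"
  proof
    fix z assume z: "z \<in> K"
    note zH = K_sub[OF z]
    have "coact z = sw HL (\<lambda>a b. e b \<odot>\<^bsub>HL\<^esub> ptensor k H L a (pr \<one>\<^bsub>H\<^esub>)) z"
      unfolding coact_eq
      by (rule K_sweedler_cong[OF module_HL _ _ z])
        (assumption | rule grules | simp add: pr_K HL_scalar counit_closed K_sub pr_closed)+
    also have "\<dots> = ptensor k H L z (pr \<one>\<^bsub>H\<^esub>)"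
      by (rule sweedler_counit_right[OF module_HL _ zH]) (assumption | rule grules)+
    finally show "z \<in> coinvariants k L H coact"
      using zH by (simp add: coinvariants_def L_sel(4))
  qed
  show "coinvariants k L H coact \<subseteq> K"
  proof
    fix h assume "h \<in> coinvariants k L H coact"
    then have h: "h \<in> carrier H" and co: "coact h = ptensor k H L h \<one>\<^bsub>L\<^esub>" by (simp_all add: coinvariants_def)
    have one: "\<one>\<^bsub>H\<^esub> \<in> carrier H" by simp
    have "gal \<one>\<^bsub>H\<^esub> h = coact h"
      unfolding gal_def coact_eq
      by (rule sweedler_cong[OF module_HL _ h]) (assumption | rule grules | simp)+
    moreover have "gal h \<one>\<^bsub>H\<^esub> = ptensor k H L (h \<star> \<one>\<^bsub>H\<^esub>) (pr \<one>\<^bsub>H\<^esub>)"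
      unfolding gal_def by (rule sweedler_one[OF module_HL]) (insert h, (assumption | rule grules)+)
    ultimately have "\<beta> (rpt \<one>\<^bsub>H\<^esub> h) = \<beta> (rpt h \<one>\<^bsub>H\<^esub>)"
      using co h by (simp add: \<beta>_rpt L_sel(4))
    \<comment> \<open>Injectivity of the Galois map turns coinvariance into an equation over
      \<open>K\<close>.\<close>
    then have eq: "rpt \<one>\<^bsub>H\<^esub> h = rpt h \<one>\<^bsub>H\<^esub>"
      using \<beta>_bijective bilinear_closed[OF rpt_bilinear one h] bilinear_closed[OF rpt_bilinear h one] by metis
    have bil: "(\<lambda>x y. splitting x \<star> y) \<in> bilinear k H H H"
      by (assumption | rule srules linear_map_comp[OF _ splitting_linear] linear_map_closed[OF splitting_linear])+
    \<comment> \<open>Right \<open>K\<close>-linearity of \<open>splitting\<close> makes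
      \<open>x \<otimes> y \<mapsto> splitting(x) y\<close> well defined over \<open>K\<close>; this
      map is then evaluated on both sides of \<open>eq\<close>.\<close>
    have bal: "splitting (x \<star> z) \<star> y = splitting x \<star> (z \<star> y)"
      if "x \<in> carrier H" "z \<in> K" "y \<in> carrier H" for x z y
      using that by (simp add: splitting_mult linear_map_closed[OF splitting_linear] K_sub A.m_assoc)
    have "splitting \<one>\<^bsub>H\<^esub> \<star> h = splitting h \<star> \<one>\<^bsub>H\<^esub>"
      using RT_lift_rpt[OF module_A bil bal one h] RT_lift_rpt[OF module_A bil bal h one] eq by simp
    then have "h = splitting h"
      using h linear_map_closed[OF splitting_linear h] by (simp add: splitting_one)
    then show "h \<in> K" using splitting_in_K[OF h] by simp
  qed
qed

end

lemma (in normal_subalgebra) split_subalgebra_exists: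
  assumes "finite_dimensional k H"
  obtains B co P where "split_subalgebra k H K B co P"
proof -
  obtain B where B: "finite_basis k H B" using assms by (auto simp: finite_dimensional_def)
  obtain co where co: "\<And>b. b \<in> B \<Longrightarrow> co b \<in> linear_map k H (ground_algebra k)"
    "\<And>v. v \<in> carrier H \<Longrightarrow> (\<Oplus>\<^bsub>H\<^esub>b\<in>B. co b v \<odot>\<^bsub>H\<^esub> b) = v"
    by (rule basis_functionals[OF K.field_axioms module_A B]) blast
  obtain P where P: "P \<in> linear_map k H H" "\<And>v. v \<in> carrier H \<Longrightarrow> P v \<in> K" "\<And>v. v \<in> K \<Longrightarrow> P v = v"
    by (rule subspace_projection[OF K.field_axioms module_A K_submodule]) blast
  have "split_subalgebra k H K B co P"
    by unfold_locales (use B co P in \<open>auto simp: finite_basis_def\<close>)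
  then show thesis by (rule that)
qed

section \<open>Depth two\<close>

text \<open>A bimodule embedding \<open>F\<close> with an additive retraction \<open>\<rho>\<close>
  splits \<open>N\<close> into the image of \<open>F\<close> and the kernel of
  \<open>\<rho>\<close>. The actions interact with \<open>\<rho>\<close> through the stability of
  its kernel.\<close>

lemma iso_to_summandI:
  assumes M: "abelian_group M" and N: "abelian_group N"
    and F: "\<And>x. x \<in> carrier M \<Longrightarrow> F x \<in> carrier N"
      "\<And>x y. x \<in> carrier M \<Longrightarrow> y \<in> carrier M \<Longrightarrow> F (x \<oplus>\<^bsub>M\<^esub> y) = F x \<oplus>\<^bsub>N\<^esub> F y"
    and \<rho>: "\<And>x. x \<in> carrier N \<Longrightarrow> \<rho> x \<in> carrier M"
      "\<And>x y. x \<in> carrier N \<Longrightarrow> y \<in> carrier N \<Longrightarrow> \<rho> (x \<oplus>\<^bsub>N\<^esub> y) = \<rho> x \<oplus>\<^bsub>M\<^esub> \<rho> y"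
      "\<And>x. x \<in> carrier M \<Longrightarrow> \<rho> (F x) = x"
    and F_act: "\<And>r x. r \<in> R \<Longrightarrow> x \<in> carrier M \<Longrightarrow> lact M r x \<in> carrier M \<and> F (lact M r x) = lact N r (F x)"
      "\<And>s x. s \<in> S \<Longrightarrow> x \<in> carrier M \<Longrightarrow> ract M x s \<in> carrier M \<and> F (ract M x s) = ract N (F x) s"
    and \<rho>_act: "\<And>r x. r \<in> R \<Longrightarrow> x \<in> carrier N \<Longrightarrow> \<rho> x = \<zero>\<^bsub>M\<^esub> \<Longrightarrow> lact N r x \<in> carrier N \<and> \<rho> (lact N r x) = \<zero>\<^bsub>M\<^esub>"
      "\<And>s x. s \<in> S \<Longrightarrow> x \<in> carrier N \<Longrightarrow> \<rho> x = \<zero>\<^bsub>M\<^esub> \<Longrightarrow> ract N x s \<in> carrier N \<and> \<rho> (ract N x s) = \<zero>\<^bsub>M\<^esub>"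
  shows "iso_to_summand R S M N"
proof -
  interpret M: abelian_group M by fact
  interpret N: abelian_group N by fact
  have F0: "F \<zero>\<^bsub>M\<^esub> = \<zero>\<^bsub>N\<^esub>"
    using F(2)[of "\<zero>\<^bsub>M\<^esub>" "\<zero>\<^bsub>M\<^esub>"] F(1)[of "\<zero>\<^bsub>M\<^esub>"] by simp
  have \<rho>0: "\<rho> \<zero>\<^bsub>N\<^esub> = \<zero>\<^bsub>M\<^esub>"
    using \<rho>(2)[of "\<zero>\<^bsub>N\<^esub>" "\<zero>\<^bsub>N\<^esub>"] \<rho>(1)[of "\<zero>\<^bsub>N\<^esub>"] by simp
  have Fm: "F (\<ominus>\<^bsub>M\<^esub> x) = \<ominus>\<^bsub>N\<^esub> F x" if "x \<in> carrier M" for x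
    using F(2)[of "\<ominus>\<^bsub>M\<^esub> x" x] F(1) that F0 N.minus_equality[of "F (\<ominus>\<^bsub>M\<^esub> x)" "F x"] by (simp add: M.l_neg)
  have \<rho>m: "\<rho> (\<ominus>\<^bsub>N\<^esub> x) = \<ominus>\<^bsub>M\<^esub> \<rho> x" if "x \<in> carrier N" for x
    using \<rho>(2)[of "\<ominus>\<^bsub>N\<^esub> x" x] \<rho>(1) that \<rho>0 M.minus_equality[of "\<rho> (\<ominus>\<^bsub>N\<^esub> x)" "\<rho> x"] by (simp add: N.l_neg)
  let ?P = "F ` carrier M"
  let ?Q = "{x \<in> carrier N. \<rho> x = \<zero>\<^bsub>M\<^esub>}"
  have "additive_subgroup ?P N"
  proof (rule additive_subgroupI, rule subgroup.intro)
    show "?P \<subseteq> carrier (add_monoid N)" using F(1) by auto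
    show "\<one>\<^bsub>add_monoid N\<^esub> \<in> ?P" using F0 M.zero_closed by force
    show "x \<otimes>\<^bsub>add_monoid N\<^esub> y \<in> ?P" if "x \<in> ?P" "y \<in> ?P" for x y
      using that by (auto simp: F(2)[symmetric])
    show "inv\<^bsub>add_monoid N\<^esub> x \<in> ?P" if "x \<in> ?P" for x
      using that by (auto simp: Fm[symmetric] a_inv_def[symmetric])
  qed
  moreover have "lact N r p \<in> ?P" if "p \<in> ?P" "r \<in> R" for p r
    using that F_act(1) by (metis (no_types, lifting) imageE imageI)
  moreover have "ract N p s \<in> ?P" if "p \<in> ?P" "s \<in> S" for p s
    using that F_act(2) by (metis (no_types, lifting) imageE imageI)
  ultimately have P: "subbimodule R S ?P N"
    unfolding subbimodule_def by blast
  have "additive_subgroup ?Q N"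
  proof (rule additive_subgroupI, rule subgroup.intro)
    show "inv\<^bsub>add_monoid N\<^esub> x \<in> ?Q" if "x \<in> ?Q" for x
      using that by (auto simp: \<rho>m a_inv_def[symmetric])
  qed (auto simp: \<rho>0 \<rho>(2))
  then have Q: "subbimodule R S ?Q N"
    using \<rho>_act unfolding subbimodule_def by auto
  have "?P \<inter> ?Q = {\<zero>\<^bsub>N\<^esub>}"
  proof
    show "?P \<inter> ?Q \<subseteq> {\<zero>\<^bsub>N\<^esub>}" using \<rho>(3) F0 by auto
    show "{\<zero>\<^bsub>N\<^esub>} \<subseteq> ?P \<inter> ?Q" using F0 \<rho>0 M.zero_closed by force
  qed
  moreover have "?P <+>\<^bsub>N\<^esub> ?Q = carrier N"
  proof
    show "?P <+>\<^bsub>N\<^esub> ?Q \<subseteq> carrier N" using F(1) by (auto simp: set_add_def' )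
    show "carrier N \<subseteq> ?P <+>\<^bsub>N\<^esub> ?Q"
    proof
      fix x assume x: "x \<in> carrier N"
      let ?y = "F (\<rho> x)"
      have y: "?y \<in> carrier N" using x \<rho>(1) F(1) by blast
      have "x = ?y \<oplus>\<^bsub>N\<^esub> (\<ominus>\<^bsub>N\<^esub> ?y \<oplus>\<^bsub>N\<^esub> x)"
        using x y by (simp add: N.a_assoc[symmetric] N.r_neg)
      moreover have "\<ominus>\<^bsub>N\<^esub> ?y \<oplus>\<^bsub>N\<^esub> x \<in> ?Q"
        using x y \<rho> by (simp add: \<rho>m M.l_neg)
      moreover have "?y \<in> ?P" using x \<rho>(1) by blast
      ultimately show "x \<in> ?P <+>\<^bsub>N\<^esub> ?Q" unfolding set_add_def' by blast
    qed
  qed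
  ultimately have "direct_summand R S ?P N"
    unfolding direct_summand_def using P Q by blast
  moreover have "F \<in> bimodule_iso R S M (N\<lparr>carrier := ?P\<rparr>)"
  proof -
    have "inj_on F (carrier M)" using \<rho>(3) by (rule inj_on_inverseI)
    then have "bij_betw F (carrier M) ?P" by (rule inj_on_imp_bij_betw)
    then show ?thesis
      using F F_act by (auto simp: bimodule_iso_def iso_def hom_def)
  qed
  ultimately show ?thesis unfolding iso_to_summand_def by blast
qed

lemma abelian_group_power_bimodule:
  assumes "ring A"
  shows "abelian_group (power_bimodule A n)"
proof -
  interpret A: ring A by fact
  show ?thesis
  proof (rule abelian_groupI)
    fix u assume u: "u \<in> carrier (power_bimodule A n)"
    show "\<zero>\<^bsub>power_bimodule A n\<^esub> \<oplus>\<^bsub>power_bimodule A n\<^esub> u = u"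
      using u by (auto simp: power_bimodule_def PiE_iff extensional_def fun_eq_iff)
    have "(\<lambda>i\<in>{..<n}. \<ominus>\<^bsub>A\<^esub> u i) \<oplus>\<^bsub>power_bimodule A n\<^esub> u = \<zero>\<^bsub>power_bimodule A n\<^esub>"
      using u by (auto simp: power_bimodule_def PiE_iff fun_eq_iff A.l_neg)
    moreover have "(\<lambda>i\<in>{..<n}. \<ominus>\<^bsub>A\<^esub> u i) \<in> carrier (power_bimodule A n)"
      using u by (auto simp: power_bimodule_def PiE_iff)
    ultimately show "\<exists>v\<in>carrier (power_bimodule A n). v \<oplus>\<^bsub>power_bimodule A n\<^esub> u = \<zero>\<^bsub>power_bimodule A n\<^esub>"
      by blast
  qed (auto simp: power_bimodule_def PiE_iff fun_eq_iff A.a_ac)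
qed

section \<open>Bimodule structures and the Galois map of the left coaction\<close>

context normal_subalgebra
begin

text \<open>Like \<open>right_mult\<close>, this acts on the factor \<open>H\<close> only. The
  factor \<open>L\<close> merely counts copies of \<open>H\<close>, which is why
  \<open>H \<otimes> L\<close> can be compared with a power of \<open>H\<close> for both kinds of
  bimodules.\<close>

definition left_mult :: "'h \<Rightarrow> ('h, 'h set) tens \<Rightarrow> ('h, 'h set) tens" where
  "left_mult r = tensor_lift HL (\<lambda>x u. ptensor k H L (r \<star> x) u)"

definition right_mult :: "'h \<Rightarrow> ('h, 'h set) tens \<Rightarrow> ('h, 'h set) tens" where
  "right_mult s = tensor_lift HL (\<lambda>x u. ptensor k H L (x \<star> s) u)"

lemma left_mult_bilinear: "r \<in> carrier H \<Longrightarrow> (\<lambda>x u. ptensor k H L (r \<star> x) u) \<in> bilinear k H L HL"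
  and right_mult_bilinear: "s \<in> carrier H \<Longrightarrow> (\<lambda>x u. ptensor k H L (x \<star> s) u) \<in> bilinear k H L HL"
  by (assumption | rule grules)+

lemma left_mult_linear: "r \<in> carrier H \<Longrightarrow> left_mult r \<in> linear_map k HL HL"
  and right_mult_linear: "s \<in> carrier H \<Longrightarrow> right_mult s \<in> linear_map k HL HL"
  unfolding left_mult_def right_mult_def
  by (rule tensor_lift_linear[OF module_A module_L module_HL left_mult_bilinear], assumption,
      rule tensor_lift_linear[OF module_A module_L module_HL right_mult_bilinear], assumption)

lemma left_mult_ptensor: "r \<in> carrier H \<Longrightarrow> x \<in> carrier H \<Longrightarrow> u \<in> carrier L \<Longrightarrow>
    left_mult r (ptensor k H L x u) = ptensor k H L (r \<star> x) u"
  unfolding left_mult_def by (rule tensor_lift_ptensor[OF module_A module_L module_HL left_mult_bilinear])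

lemma right_mult_ptensor: "s \<in> carrier H \<Longrightarrow> x \<in> carrier H \<Longrightarrow> u \<in> carrier L \<Longrightarrow>
    right_mult s (ptensor k H L x u) = ptensor k H L (x \<star> s) u"
  unfolding right_mult_def by (rule tensor_lift_ptensor[OF module_A module_L module_HL right_mult_bilinear])

lemma gal_left:
  assumes "r \<in> carrier H" "x \<in> carrier H" "y \<in> carrier H"
  shows "gal (r \<star> x) y = left_mult r (gal x y)"
proof -
  have "left_mult r (gal x y) = sw HL (\<lambda>a b. left_mult r (ptensor k H L (x \<star> a) (pr b))) y"
    unfolding gal_def
    by (rule sweedler_fuse[OF module_HL module_HL _ left_mult_linear assms(3)]) (insert assms, (assumption | rule grules)+)
  also have "\<dots> = gal (r \<star> x) y"
    unfolding gal_def
    by (rule sweedler_cong[OF module_HL _ assms(3)])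
      (insert assms, (assumption | rule grules linear_map_comp[OF _ left_mult_linear] | simp add: left_mult_ptensor pr_closed A.m_assoc)+)
  finally show ?thesis ..
qed

text \<open>For a general right factor the projected component would change as well. For
  \<open>z\<close> in \<open>K\<close> it changes only by a counit, so the action stays on the
  factor \<open>H\<close>.\<close>

lemma gal_right:
  assumes "x \<in> carrier H" "y \<in> carrier H" "z \<in> K"
  shows "gal x (y \<star> z) = right_mult z (gal x y)"
proof -
  have zH: "z \<in> carrier H" by (rule K_sub[OF assms(3)])
  have "right_mult z (gal x y) = sw HL (\<lambda>a b. right_mult z (ptensor k H L (x \<star> a) (pr b))) y"
    unfolding gal_def
    by (rule sweedler_fuse[OF module_HL module_HL _ right_mult_linear[OF zH] assms(2)]) (insert assms, (assumption | rule grules)+)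
  also have "\<dots> = sw HL (\<lambda>a b. ptensor k H L (x \<star> a \<star> z) (pr b)) y"
    by (rule sweedler_cong[OF module_HL _ assms(2)])
      (insert assms zH, (assumption | rule grules linear_map_comp[OF _ right_mult_linear] | simp add: right_mult_ptensor pr_closed)+)
  also have "\<dots> = gal x (y \<star> z)"
    by (rule gal_K(2)[OF assms(1,3,2), symmetric])
  finally show ?thesis ..
qed

text \<open>
  The Galois map of the left coaction, with the tensor factors of the codomain exchanged. Using it
  for the \<open>K\<close>-\<open>H\<close>-bimodule structure avoids the bijectivity of the antipode.
\<close>

definition gal' :: "'h \<Rightarrow> 'h \<Rightarrow> ('h, 'h set) tens" where
  "gal' x y = sw HL (\<lambda>a b. ptensor k H L (b \<star> y) (pr a)) x"

lemma gal'_bilinear: "(\<lambda>x y. gal' x y) \<in> bilinear k H H HL"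
  unfolding gal'_def by (assumption | rule grules)+

text \<open>As for \<open>gal\<close>, but here the first component is projected, so the left
  version of the counit axiom restores \<open>z\<close>. The second equation becomes left
  \<open>K\<close>-linearity.\<close>

lemma gal'_K:
  assumes x: "x \<in> carrier H" and z: "z \<in> K" and y: "y \<in> carrier H"
  shows "gal' (x \<star> z) y = gal' x (z \<star> y)"
    and "gal' (z \<star> x) y = sw HL (\<lambda>a b. ptensor k H L (z \<star> (b \<star> y)) (pr a)) x"
proof -
  have zH: "z \<in> carrier H" by (rule K_sub[OF z])
  have bil: "(\<lambda>a b. ptensor k H L (b \<star> y) (pr a)) \<in> bilinear k H H HL"
    by (insert y, (assumption | rule grules)+)
  have "gal' (x \<star> z) y = sw HL (\<lambda>a b. sw HL (\<lambda>u v. ptensor k H L (b \<star> v \<star> y) (pr (a \<star> u))) z) x"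
    unfolding gal'_def by (rule sweedler_mult[OF module_HL bil x zH])
  also have "\<dots> = gal' x (z \<star> y)"
    unfolding gal'_def
  proof (rule sweedler_cong[OF module_HL _ x])
    show "(\<lambda>a b. sw HL (\<lambda>u v. ptensor k H L (b \<star> v \<star> y) (pr (a \<star> u))) z) \<in> bilinear k H H HL"
      by (insert y zH, (assumption | rule grules)+)
    fix a b assume a: "a \<in> carrier H" and b: "b \<in> carrier H"
    have "sw HL (\<lambda>u v. ptensor k H L (b \<star> v \<star> y) (pr (a \<star> u))) z
        = sw HL (\<lambda>u v. e u \<odot>\<^bsub>HL\<^esub> ptensor k H L (b \<star> (v \<star> y)) (pr a)) z"
      by (rule K_sweedler_cong[OF module_HL _ _ z])
        (insert a b y, (assumption | rule grules | simp add: A.m_assoc pr_mult_K K_sub HL_scalar counit_closed pr_closed)+)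
    also have "\<dots> = ptensor k H L (b \<star> (z \<star> y)) (pr a)"
      by (rule sweedler_counit_left[OF module_HL _ zH]) (insert a b y, (assumption | rule grules)+)
    finally show "sw HL (\<lambda>u v. ptensor k H L (b \<star> v \<star> y) (pr (a \<star> u))) z
      = ptensor k H L (b \<star> (z \<star> y)) (pr a)" .
  qed
  finally show "gal' (x \<star> z) y = gal' x (z \<star> y)" .
  let ?f = "\<lambda>w. sw HL (\<lambda>a b. ptensor k H L (w \<star> (b \<star> y)) (pr a)) x"
  have "gal' (z \<star> x) y = sw HL (\<lambda>u v. sw HL (\<lambda>a b. ptensor k H L (v \<star> b \<star> y) (pr (u \<star> a))) x) z"
    unfolding gal'_def by (rule sweedler_mult[OF module_HL bil zH x])
  also have "\<dots> = sw HL (\<lambda>u v. e u \<odot>\<^bsub>HL\<^esub> ?f v) z"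
  proof (rule K_sweedler_cong[OF module_HL _ _ z])
    show "(\<lambda>u v. sw HL (\<lambda>a b. ptensor k H L (v \<star> b \<star> y) (pr (u \<star> a))) x) \<in> bilinear k H H HL"
      "(\<lambda>u v. e u \<odot>\<^bsub>HL\<^esub> ?f v) \<in> bilinear k H H HL"
      by (insert x y, (assumption | rule grules)+)
    fix u v assume u: "u \<in> K" and v: "v \<in> K"
    have "sw HL (\<lambda>a b. ptensor k H L (v \<star> b \<star> y) (pr (u \<star> a))) x
        = sw HL (\<lambda>a b. e u \<odot>\<^bsub>HL\<^esub> ptensor k H L (v \<star> (b \<star> y)) (pr a)) x"
      by (rule sweedler_cong[OF module_HL _ x])
        (insert y K_sub[OF u] K_sub[OF v], (assumption | rule grules | simp add: A.m_assoc pr_mult_K u HL_scalar counit_closed pr_closed)+)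
    also have "\<dots> = e u \<odot>\<^bsub>HL\<^esub> ?f v"
      by (rule sweedler_fuse[OF module_HL module_HL _ _ x, symmetric])
        (insert y K_sub[OF u] K_sub[OF v], (assumption | rule grules)+)
    finally show "sw HL (\<lambda>a b. ptensor k H L (v \<star> b \<star> y) (pr (u \<star> a))) x = e u \<odot>\<^bsub>HL\<^esub> ?f v" .
  qed
  also have "\<dots> = ?f z"
    by (rule sweedler_counit_left[OF module_HL _ zH]) (insert x y, (assumption | rule grules)+)
  finally show "gal' (z \<star> x) y = ?f z" .
qed

lemma gal'_left:
  assumes "z \<in> K" "x \<in> carrier H" "y \<in> carrier H"
  shows "gal' (z \<star> x) y = left_mult z (gal' x y)"
proof -
  have zH: "z \<in> carrier H" by (rule K_sub[OF assms(1)])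
  have "left_mult z (gal' x y) = sw HL (\<lambda>a b. left_mult z (ptensor k H L (b \<star> y) (pr a))) x"
    unfolding gal'_def
    by (rule sweedler_fuse[OF module_HL module_HL _ left_mult_linear[OF zH] assms(2)]) (insert assms, (assumption | rule grules)+)
  also have "\<dots> = sw HL (\<lambda>a b. ptensor k H L (z \<star> (b \<star> y)) (pr a)) x"
    by (rule sweedler_cong[OF module_HL _ assms(2)])
      (insert assms zH, (assumption | rule grules linear_map_comp[OF _ left_mult_linear] | simp add: left_mult_ptensor pr_closed)+)
  also have "\<dots> = gal' (z \<star> x) y"
    by (rule gal'_K(2)[OF assms(2,1,3), symmetric])
  finally show ?thesis ..
qed

lemma gal'_right:
  assumes "x \<in> carrier H" "y \<in> carrier H" "s \<in> carrier H"
  shows "gal' x (y \<star> s) = right_mult s (gal' x y)"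
proof -
  have "right_mult s (gal' x y) = sw HL (\<lambda>a b. right_mult s (ptensor k H L (b \<star> y) (pr a))) x"
    unfolding gal'_def
    by (rule sweedler_fuse[OF module_HL module_HL _ right_mult_linear assms(1)]) (insert assms, (assumption | rule grules)+)
  also have "\<dots> = gal' x (y \<star> s)"
    unfolding gal'_def
    by (rule sweedler_cong[OF module_HL _ assms(1)])
      (insert assms, (assumption | rule grules linear_map_comp[OF _ right_mult_linear] | simp add: right_mult_ptensor pr_closed A.m_assoc)+)
  finally show ?thesis ..
qed

abbreviation "\<beta>' \<equiv> tensor_lift HL (\<lambda>x y. gal' x y)"

lemma \<beta>'_linear: "\<beta>' \<in> linear_map k RT HL"
  by (rule RT_lift_linear[OF module_HL gal'_bilinear]) (simp add: gal'_K)

lemma \<beta>'_rpt: "x \<in> carrier H \<Longrightarrow> y \<in> carrier H \<Longrightarrow> \<beta>' (rpt x y) = gal' x y"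
  by (rule RT_lift_rpt[OF module_HL gal'_bilinear]) (simp_all add: gal'_K)

text \<open>The inverse is \<open>y \<otimes> pr x \<mapsto> x\<^sub>1 \<otimes> S(x\<^sub>2)
  y\<close>, and now the description of \<open>I\<close> with \<open>K\<^sup>+\<close> on the right
  is the fitting one: in \<open>h\<^sub>1 z\<^sub>1 \<otimes> S(z\<^sub>2) S(h\<^sub>2) y\<close>
  the element \<open>S(z\<^sub>2)\<close> of \<open>K\<close> crosses the tensor sign and cancels
  \<open>z\<^sub>1\<close>, leaving \<open>e(z) = 0\<close>.\<close>

lemma \<beta>'_inverse:
  "\<exists>g. g \<in> linear_map k HL RT \<and> (\<forall>y\<in>carrier H. \<forall>x\<in>carrier H.
      g (ptensor k H L y (pr x)) = sw RT (\<lambda>a b. rpt a (S b \<star> y)) x)"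
proof (rule HL_descend[OF module_RT])
  show bil: "(\<lambda>y x. sw RT (\<lambda>a b. rpt a (S b \<star> y)) x) \<in> bilinear k H H RT"
    by (assumption | rule grules)+
  interpret RT: module k RT by (rule module_RT)
  fix y x assume y: "y \<in> carrier H" and "x \<in> I"
  from this(2) show "sw RT (\<lambda>a b. rpt a (S b \<star> y)) x = \<zero>\<^bsub>RT\<^esub>"
  proof (induction x rule: ideal_prod.induct)
    case (prod h z)
    then have h: "h \<in> carrier H" and z: "z \<in> K" "e z = \<zero>\<^bsub>k\<^esub>" by (simp_all add: Kp_iff)
    note zH = K_sub[OF z(1)]
    have inner: "sw RT (\<lambda>u v. rpt (a \<star> u) (S (b \<star> v) \<star> y)) z = \<zero>\<^bsub>RT\<^esub>"
      if a: "a \<in> carrier H" and b: "b \<in> carrier H" for a b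
    proof -
      have "sw RT (\<lambda>u v. rpt (a \<star> u) (S (b \<star> v) \<star> y)) z
          = sw RT (\<lambda>u v. rpt (a \<star> (u \<star> S v)) (S b \<star> y)) z"
      proof (rule K_sweedler_cong[OF module_RT _ _ z(1)])
        show "(\<lambda>u v. rpt (a \<star> u) (S (b \<star> v) \<star> y)) \<in> bilinear k H H RT"
          "(\<lambda>u v. rpt (a \<star> (u \<star> S v)) (S b \<star> y)) \<in> bilinear k H H RT"
          by (insert a b y, (assumption | rule grules)+)
        fix u v assume u: "u \<in> K" and v: "v \<in> K"
        show "rpt (a \<star> u) (S (b \<star> v) \<star> y) = rpt (a \<star> (u \<star> S v)) (S b \<star> y)"
          using rpt_balanced[of "a \<star> u" "S v" "S b \<star> y"] a b y K_sub[OF u] K_sub[OF v] K_antipode[OF v]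
          by (simp add: antipode_mult antipode_closed A.m_assoc)
      qed
      also have "\<dots> = rpt (a \<star> sw H (\<lambda>u v. u \<star> S v) z) (S b \<star> y)"
        by (rule sweedler_fuse[OF module_A module_RT _ _ zH, symmetric, where f = "\<lambda>w. rpt (a \<star> w) (S b \<star> y)"])
          (insert a b y, (assumption | rule grules)+)
      also have "sw H (\<lambda>u v. u \<star> S v) z = \<zero>\<^bsub>H\<^esub>"
        using antipodal_right zH z(2) by (simp add: antipodal_def)
      also have "rpt (a \<star> \<zero>\<^bsub>H\<^esub>) (S b \<star> y) = \<zero>\<^bsub>RT\<^esub>"
        by (rule linear_map_zero[OF _ module_A module_RT, where f = "\<lambda>w. rpt (a \<star> w) (S b \<star> y)"])
          (insert a b y, (assumption | rule grules)+)
      finally show ?thesis .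
    qed
    have "sw RT (\<lambda>a b. rpt a (S b \<star> y)) (h \<star> z)
        = sw RT (\<lambda>a b. sw RT (\<lambda>u v. rpt (a \<star> u) (S (b \<star> v) \<star> y)) z) h"
      by (rule sweedler_mult[OF module_RT _ h zH]) (insert y, (assumption | rule grules)+)
    also have "\<dots> = \<zero>\<^bsub>RT\<^esub>"
      using module_RT _ h
    proof (rule sweedler_induct)
      show "(\<lambda>a b. sw RT (\<lambda>u v. rpt (a \<star> u) (S (b \<star> v) \<star> y)) z) \<in> bilinear k H H RT"
        by (insert y zH, (assumption | rule grules)+)
    qed (simp_all add: inner)
    finally show ?case .
  next
    case (sum p q)
    then show ?case by (simp add: linear_map_add[OF bilinear_right[OF bil y]] I_sub)
  qed
qed

text \<open>The composites are \<open>x\<^sub>1 \<otimes> S(x\<^sub>2) x\<^sub>3 y\<close> and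
  \<open>x\<^sub>2 S(x\<^sub>3) y \<otimes> pr x\<^sub>1\<close>; in both the antipode stands next
  to its partner, so its inverse does not enter.\<close>

lemma \<beta>'_bijective:
  obtains g where "g \<in> linear_map k HL RT" "\<And>t. t \<in> carrier RT \<Longrightarrow> g (\<beta>' t) = t" "\<And>t. t \<in> carrier HL \<Longrightarrow> \<beta>' (g t) = t"
proof -
  obtain g where g: "g \<in> linear_map k HL RT" and
    g_pt: "\<And>y x. y \<in> carrier H \<Longrightarrow> x \<in> carrier H \<Longrightarrow> g (ptensor k H L y (pr x)) = sw RT (\<lambda>a b. rpt a (S b \<star> y)) x"
    using \<beta>'_inverse by blast
  note rs = grules linear_map_comp[OF _ g] linear_map_comp[OF _ \<beta>'_linear] bilinear_app_left[OF gal'_bilinear] bilinear_app_right[OF gal'_bilinear]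
  have "g (\<beta>' t) = t" if "t \<in> carrier RT" for t
  proof (rule RT_ext[OF linear_map_comp[OF \<beta>'_linear g] linear_map_id that])
    fix x y assume x: "x \<in> carrier H" and y: "y \<in> carrier H"
    have "g (\<beta>' (rpt x y)) = g (gal' x y)" by (simp only: \<beta>'_rpt[OF x y])
    also have "\<dots> = sw RT (\<lambda>a b. g (ptensor k H L (b \<star> y) (pr a))) x"
      unfolding gal'_def
      by (rule sweedler_fuse[OF module_HL module_RT _ g x]) (insert y, (assumption | rule rs)+)
    also have "\<dots> = sw RT (\<lambda>a b. sw RT (\<lambda>c d. rpt c (S d \<star> (b \<star> y))) a) x"
      by (rule sweedler_cong[OF module_RT _ x]) (insert y, (assumption | rule rs g_pt)+)
    also have "\<dots> = sw RT (\<lambda>a b. sw RT (\<lambda>c d. rpt c (S d \<star> b \<star> y)) a) x"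
      by (intro sweedler_cong module_RT x) (insert y, (assumption | rule rs | simp add: A.m_assoc antipode_closed)+)
    also have "\<dots> = rpt x (\<one>\<^bsub>H\<^esub> \<star> y)"
      by (rule sweedler_cancel_right(2)[where \<psi> = "\<lambda>c u. rpt c (u \<star> y)", OF module_RT antipodal_left _ x])
        (insert y, (assumption | rule rs)+)
    finally show "g (\<beta>' (rpt x y)) = rpt x y" using y by simp
  qed
  moreover have "\<beta>' (g t) = t" if "t \<in> carrier HL" for t
  proof (rule HL_ext[OF linear_map_comp[OF g \<beta>'_linear] linear_map_id that])
    fix y x assume y: "y \<in> carrier H" and x: "x \<in> carrier H"
    have "\<beta>' (g (ptensor k H L y (pr x))) = sw HL (\<lambda>a b. \<beta>' (rpt a (S b \<star> y))) x"
      unfolding g_pt[OF y x]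
      by (rule sweedler_fuse[OF module_RT module_HL _ \<beta>'_linear x]) (insert y, (assumption | rule rs)+)
    also have "\<dots> = sw HL (\<lambda>a b. gal' a (S b \<star> y)) x"
      by (rule sweedler_cong[OF module_HL _ x]) (insert y, (assumption | rule rs \<beta>'_rpt)+)
    also have "\<dots> = sw HL (\<lambda>a b. sw HL (\<lambda>c d. ptensor k H L (d \<star> S b \<star> y) (pr c)) a) x"
      unfolding gal'_def
      by (intro sweedler_cong module_HL x) (insert y, (assumption | rule rs | simp add: A.m_assoc antipode_closed)+)
    also have "\<dots> = ptensor k H L (\<one>\<^bsub>H\<^esub> \<star> y) (pr x)"
      by (rule sweedler_cancel_right(2)[where \<psi> = "\<lambda>c u. ptensor k H L (u \<star> y) (pr c)", OF module_HL antipodal_right _ x])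
        (insert y, (assumption | rule rs)+)
    finally show "\<beta>' (g (ptensor k H L y (pr x))) = ptensor k H L y (pr x)" using y by simp
  qed
  ultimately show thesis using g that by blast
qed

lemma tensor_bimodule_sel:
  "carrier (tensor_bimodule H K) = carrier RT" "add (tensor_bimodule H K) = add RT"
  "\<zero>\<^bsub>tensor_bimodule H K\<^esub> = \<zero>\<^bsub>RT\<^esub>"
  by (simp_all add: tensor_bimodule_def ring.defs bimodule.defs carrier_RT add_RT zero_RT)

lemma abelian_group_tensor_bimodule: "abelian_group (tensor_bimodule H K)"
proof -
  have "abelian_group RT" using module_RT by (simp add: module_def)
  from abelian_groupE[OF this] show ?thesis
    by (intro abelian_groupI) (simp_all add: tensor_bimodule_sel)
qed

text \<open>The actions of \<open>tensor_bimodule\<close> are lifts into the bare additive group.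
  They are read as lifts into \<open>RT\<close>, which has the same addition, so that they become
  linear maps.\<close>

lemma RT_lift_ring_tensor:
  assumes \<phi>: "\<phi> \<in> bilinear k H H RT"
    and bal: "\<And>x z y. x \<in> carrier H \<Longrightarrow> z \<in> K \<Longrightarrow> y \<in> carrier H \<Longrightarrow> \<phi> (x \<star> z) y = \<phi> x (z \<star> y)"
    and t: "t \<in> carrier RT"
  shows "tensor_lift (ring_tensor H K) \<phi> t = tensor_lift RT \<phi> t"
proof -
  interpret R: linear_tensor k H H K "monoid.mult H" "monoid.mult H" RT by (rule linear_tensor_RT)
  have "\<phi> \<in> balanced_maps K H (monoid.mult H) H (monoid.mult H) RT"
    using \<phi> bal by (rule bilinear_balanced)
  moreover have "abelian_group (ring_tensor H K)"
    unfolding ring_tensor_def by (rule R.abelian_group_BT)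
  ultimately have "tensor_lift RT \<phi> t = tensor_lift (ring_tensor H K) \<phi> t"
    using t by (intro R.lift_cong R.abelian_group_T) (simp_all add: carrier_RT add_RT ring_tensor_def)
  then show ?thesis ..
qed

lemma lact_tensor_bimodule:
  assumes r: "r \<in> carrier H"
  shows "t \<in> carrier RT \<Longrightarrow> lact (tensor_bimodule H K) r t = tensor_lift RT (\<lambda>x y. rpt (r \<star> x) y) t"
    and "tensor_lift RT (\<lambda>x y. rpt (r \<star> x) y) \<in> linear_map k RT RT"
    and "x \<in> carrier H \<Longrightarrow> y \<in> carrier H \<Longrightarrow> tensor_lift RT (\<lambda>x y. rpt (r \<star> x) y) (rpt x y) = rpt (r \<star> x) y"
proof -
  have bil: "(\<lambda>x y. rpt (r \<star> x) y) \<in> bilinear k H H RT"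
    by (insert r, (assumption | rule grules)+)
  have bal: "rpt (r \<star> (x \<star> z)) y = rpt (r \<star> x) (z \<star> y)"
    if "x \<in> carrier H" "z \<in> K" "y \<in> carrier H" for x z y
    using that r by (simp add: rpt_balanced[symmetric] K_sub A.m_assoc)
  show "tensor_lift RT (\<lambda>x y. rpt (r \<star> x) y) \<in> linear_map k RT RT"
    by (rule RT_lift_linear[OF module_RT bil bal])
  show "x \<in> carrier H \<Longrightarrow> y \<in> carrier H \<Longrightarrow> tensor_lift RT (\<lambda>x y. rpt (r \<star> x) y) (rpt x y) = rpt (r \<star> x) y"
    by (rule RT_lift_rpt[OF module_RT bil bal])
  show "lact (tensor_bimodule H K) r t = tensor_lift RT (\<lambda>x y. rpt (r \<star> x) y) t" if "t \<in> carrier RT"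
    using RT_lift_ring_tensor[OF bil bal that] by (simp add: tensor_bimodule_def ring.defs bimodule.defs)
qed

lemma ract_tensor_bimodule:
  assumes s: "s \<in> carrier H"
  shows "t \<in> carrier RT \<Longrightarrow> ract (tensor_bimodule H K) t s = tensor_lift RT (\<lambda>x y. rpt x (y \<star> s)) t"
    and "tensor_lift RT (\<lambda>x y. rpt x (y \<star> s)) \<in> linear_map k RT RT"
    and "x \<in> carrier H \<Longrightarrow> y \<in> carrier H \<Longrightarrow> tensor_lift RT (\<lambda>x y. rpt x (y \<star> s)) (rpt x y) = rpt x (y \<star> s)"
proof -
  have bil: "(\<lambda>x y. rpt x (y \<star> s)) \<in> bilinear k H H RT"
    by (insert s, (assumption | rule grules)+)
  have bal: "rpt (x \<star> z) (y \<star> s) = rpt x (z \<star> y \<star> s)"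
    if "x \<in> carrier H" "z \<in> K" "y \<in> carrier H" for x z y
    using that s by (simp add: rpt_balanced K_sub A.m_assoc)
  show "tensor_lift RT (\<lambda>x y. rpt x (y \<star> s)) \<in> linear_map k RT RT"
    by (rule RT_lift_linear[OF module_RT bil bal])
  show "x \<in> carrier H \<Longrightarrow> y \<in> carrier H \<Longrightarrow> tensor_lift RT (\<lambda>x y. rpt x (y \<star> s)) (rpt x y) = rpt x (y \<star> s)"
    by (rule RT_lift_rpt[OF module_RT bil bal])
  show "ract (tensor_bimodule H K) t s = tensor_lift RT (\<lambda>x y. rpt x (y \<star> s)) t" if "t \<in> carrier RT"
    using RT_lift_ring_tensor[OF bil bal that] by (simp add: tensor_bimodule_def ring.defs bimodule.defs)
qed

end

section \<open>Embedding into a power of \<open>H\<close> and conclusion\<close>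

context split_subalgebra
begin

text \<open>Let \<open>C\<close> be the identity minus a projection onto \<open>I\<close>. It kills
  \<open>I\<close>, so each \<open>co b\<close> after \<open>C\<close> descends to \<open>L\<close>,
  and it does not change classes, so expanding \<open>C v\<close> in the basis of \<open>H\<close>
  expands \<open>pr v\<close>. The vectors \<open>pr b\<close> may be linearly dependent; the
  expansion formula is all that matters.\<close>

lemma quotient_functionals:
  obtains \<phi> where "\<And>b. b \<in> B \<Longrightarrow> \<phi> b \<in> linear_map k L (ground_algebra k)"
    "\<And>u. u \<in> carrier L \<Longrightarrow> (\<Oplus>\<^bsub>L\<^esub>b\<in>B. \<phi> b u \<odot>\<^bsub>L\<^esub> pr b) = u"
proof -
  interpret L: k_algebra k L by (rule k_algebra_L)
  have G: "module k (ground_algebra k)" by (rule K.module_ground_algebra)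
  have "submodule I k H"
    by (rule submoduleI) (auto intro: I_sub I_zero I_minus I_smult ideal_prod.sum)
  then obtain J where J: "J \<in> linear_map k H H" "\<And>v. v \<in> carrier H \<Longrightarrow> J v \<in> I" "\<And>v. v \<in> I \<Longrightarrow> J v = v"
    using subspace_projection[OF K.field_axioms module_A] by blast
  define C where "C v = v \<oplus>\<^bsub>H\<^esub> (\<ominus>\<^bsub>k\<^esub> \<one>\<^bsub>k\<^esub>) \<odot>\<^bsub>H\<^esub> J v" for v
  have C_lin: "C \<in> linear_map k H H"
    unfolding C_def by (intro linear_map_plus linear_map_smult_const module_A linear_map_id J) simp
  have C_minus: "C v = v \<ominus>\<^bsub>H\<^esub> J v" if "v \<in> carrier H" for v
    using that linear_map_closed[OF J(1) that] by (simp add: C_def smult_l_minus M.minus_eq)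
  have C_I: "C v = \<zero>\<^bsub>H\<^esub>" if "v \<in> I" for v
    using that by (simp add: C_minus I_sub J(3) M.minus_eq M.r_neg)
  have pr_C: "pr (C v) = pr v" if "v \<in> carrier H" for v
  proof -
    have "\<ominus>\<^bsub>H\<^esub> J v \<in> I" using J(2)[OF that] by (rule I_minus)
    then have "pr (C v) = pr v \<oplus>\<^bsub>L\<^esub> \<zero>\<^bsub>L\<^esub>"
      using that pr_add[of v "\<ominus>\<^bsub>H\<^esub> J v"] by (simp add: C_minus M.minus_eq I_sub pr_I)
    then show ?thesis using that by (simp add: pr_closed)
  qed
  have lin: "(\<lambda>v. co b (C v)) \<in> linear_map k H (ground_algebra k)" if "b \<in> B" for b
    by (rule linear_map_comp[OF C_lin co_linear[OF that]])
  have zero: "co b (C v) = \<zero>\<^bsub>ground_algebra k\<^esub>" if "b \<in> B" "v \<in> I" for b v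
    using linear_map_zero[OF co_linear[OF that(1)] module_A G] C_I[OF that(2)] by simp
  let ?\<phi> = "\<lambda>b u. the_elem ((\<lambda>v. co b (C v)) ` u)"
  show thesis
  proof (rule that)
    show "?\<phi> b \<in> linear_map k L (ground_algebra k)" if "b \<in> B" for b
      by (rule quotient_map_linear[OF G lin[OF that] zero[OF that]])
    fix u assume "u \<in> carrier L"
    then obtain v where v: "v \<in> carrier H" "u = pr v" by (rule L_cases)
    have Cv: "C v \<in> carrier H" by (rule linear_map_closed[OF C_lin v(1)])
    have \<phi>_v: "?\<phi> b u = co b (C v)" if "b \<in> B" for b
      using quotient_map_pr[OF G lin[OF that] zero[OF that] v(1)] v(2) by simp
    have "u = pr (\<Oplus>\<^bsub>H\<^esub>b\<in>B. co b (C v) \<odot>\<^bsub>H\<^esub> b)"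
      using v pr_C co_sum[OF Cv] by simp
    also have "\<dots> = (\<Oplus>\<^bsub>L\<^esub>b\<in>B. pr (co b (C v) \<odot>\<^bsub>H\<^esub> b))"
      by (rule linear_map_finsum[OF pr_linear module_A module_L finite_B]) (simp add: co_closed Cv B_closed)
    also have "\<dots> = (\<Oplus>\<^bsub>L\<^esub>b\<in>B. ?\<phi> b u \<odot>\<^bsub>L\<^esub> pr b)"
    proof (rule L.M.finsum_cong')
      show "pr (co b (C v) \<odot>\<^bsub>H\<^esub> b) = ?\<phi> b u \<odot>\<^bsub>L\<^esub> pr b" if "b \<in> B" for b
        unfolding \<phi>_v[OF that] using that by (simp add: pr_smult co_closed Cv B_closed)
      show "(\<lambda>b. ?\<phi> b u \<odot>\<^bsub>L\<^esub> pr b) \<in> B \<rightarrow> carrier L"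
        by (rule Pi_I) (simp only: \<phi>_v, simp add: co_closed Cv B_closed pr_closed)
    qed simp
    finally show "(\<Oplus>\<^bsub>L\<^esub>b\<in>B. ?\<phi> b u \<odot>\<^bsub>L\<^esub> pr b) = u" ..
  qed
qed

text \<open>The number of copies in \<open>depth_two\<close> has to be positive. An empty
  \<open>B\<close> would force \<open>H\<close> to be zero, contradicting that the counit of 1 is
  1.\<close>

lemma B_nonempty: "card B > 0"
proof -
  have "B \<noteq> {}"
  proof
    assume "B = {}"
    then have "\<one>\<^bsub>H\<^esub> = \<zero>\<^bsub>H\<^esub>" using co_sum[of "\<one>\<^bsub>H\<^esub>"] by simp
    then have "\<one>\<^bsub>k\<^esub> = \<zero>\<^bsub>k\<^esub>"
      using counit_one linear_map_zero[OF counit_linear module_A K.module_ground_algebra] by (simp add: ground_algebra_def)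
    then show False using K.one_not_zero by simp
  qed
  then show ?thesis using finite_B by (simp add: card_gt_0_iff)
qed

text \<open>\<open>\<Gamma>\<close> identifies the tensor product over \<open>K\<close> with
  \<open>H \<otimes> L\<close>, compatibly with the actions in \<open>R\<close> and
  \<open>S'\<close>. The coordinates of \<open>L\<close> with respect to the family
  \<open>pr b\<close> embed \<open>H \<otimes> L\<close> into the power of \<open>H\<close> indexed
  by \<open>B\<close>, and recombination is a retraction. As the family may be redundant, the image
  is in general only a direct summand.\<close>

lemma summand_of_power:
  assumes R: "R \<subseteq> carrier H" and S: "S' \<subseteq> carrier H"
    and \<Gamma>: "\<Gamma> \<in> linear_map k RT HL" and g: "g \<in> linear_map k HL RT"
    and g\<Gamma>: "\<And>t. t \<in> carrier RT \<Longrightarrow> g (\<Gamma> t) = t" and \<Gamma>g: "\<And>t. t \<in> carrier HL \<Longrightarrow> \<Gamma> (g t) = t"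
    and left: "\<And>r x y. r \<in> R \<Longrightarrow> x \<in> carrier H \<Longrightarrow> y \<in> carrier H \<Longrightarrow> \<Gamma> (rpt (r \<star> x) y) = left_mult r (\<Gamma> (rpt x y))"
    and right: "\<And>s x y. s \<in> S' \<Longrightarrow> x \<in> carrier H \<Longrightarrow> y \<in> carrier H \<Longrightarrow> \<Gamma> (rpt x (y \<star> s)) = right_mult s (\<Gamma> (rpt x y))"
  shows "iso_to_summand R S' (tensor_bimodule H K) (power_bimodule H (card B))"
proof -
  let ?n = "card B"
  let ?M = "tensor_bimodule H K"
  let ?N = "power_bimodule H ?n"
  interpret HL: module k HL by (rule module_HL)
  obtain \<phi> where \<phi>: "\<And>b. b \<in> B \<Longrightarrow> \<phi> b \<in> linear_map k L (ground_algebra k)"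
    and \<phi>_sum: "\<And>u. u \<in> carrier L \<Longrightarrow> (\<Oplus>\<^bsub>L\<^esub>b\<in>B. \<phi> b u \<odot>\<^bsub>L\<^esub> pr b) = u"
    by (rule quotient_functionals) blast
  \<comment> \<open>\<open>\<epsilon>\<close> enumerates \<open>B\<close>, since
    \<open>power_bimodule\<close> is indexed by numbers; the counit is \<open>e\<close>.\<close>
  obtain \<epsilon> where \<epsilon>: "bij_betw \<epsilon> {..<?n} B"
    using ex_bij_betw_nat_finite[OF finite_B] by (auto simp: atLeast0LessThan)
  have \<epsilon>B: "\<epsilon> i \<in> B" if "i < ?n" for i using \<epsilon> that by (auto simp: bij_betw_def)
  have \<epsilon>pr: "pr (\<epsilon> i) \<in> carrier L" if "i < ?n" for i using \<epsilon>B[OF that] by (simp add: pr_closed B_closed)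
  have \<phi>_closed: "\<phi> b u \<in> carrier k" if "b \<in> B" "u \<in> carrier L" for b u
    by (rule functional_closed[OF \<phi>[OF that(1)] that(2)])
  \<comment> \<open>The coordinate maps of \<open>H \<otimes> L\<close>, applying a functional of
    \<open>L\<close> to the second factor.\<close>
  define c where "c i = tensor_lift H (\<lambda>x u. \<phi> (\<epsilon> i) u \<odot>\<^bsub>H\<^esub> x)" for i
  have c_bil: "(\<lambda>x u. \<phi> (\<epsilon> i) u \<odot>\<^bsub>H\<^esub> x) \<in> bilinear k H L H" if "i < ?n" for i
    by (insert \<epsilon>B[OF that], (assumption | rule base_rules functional_scale_linear[OF module_A \<phi>] \<phi>_closed)+)
  have c_lin: "c i \<in> linear_map k HL H" if "i < ?n" for i
    unfolding c_def by (rule tensor_lift_linear[OF module_A module_L module_A c_bil[OF that]])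
  have c_pt: "c i (ptensor k H L x u) = \<phi> (\<epsilon> i) u \<odot>\<^bsub>H\<^esub> x" if "i < ?n" "x \<in> carrier H" "u \<in> carrier L" for i x u
    unfolding c_def by (rule tensor_lift_ptensor[OF module_A module_L module_A c_bil[OF that(1)] that(2,3)])
  have c_left: "c i (left_mult r w) = r \<star> c i w" if i: "i < ?n" and r: "r \<in> carrier H" and w: "w \<in> carrier HL" for i r w
    by (rule tensor_ext[OF module_A module_L linear_map_comp[OF left_mult_linear[OF r] c_lin[OF i]] mult_linear_right[OF c_lin[OF i] r] _ w])
      (use i r in \<open>simp add: left_mult_ptensor c_pt smult_mult_right \<phi>_closed \<epsilon>B\<close>)
  have c_right: "c i (right_mult s w) = c i w \<star> s" if i: "i < ?n" and s: "s \<in> carrier H" and w: "w \<in> carrier HL" for i s w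
    by (rule tensor_ext[OF module_A module_L linear_map_comp[OF right_mult_linear[OF s] c_lin[OF i]] mult_linear_left[OF c_lin[OF i] s] _ w])
      (use i s in \<open>simp add: right_mult_ptensor c_pt smult_mult_left \<phi>_closed \<epsilon>B\<close>)
  \<comment> \<open>Recombines coordinates; it is a left inverse of the coordinate maps by the
    expansion formula in \<open>L\<close>.\<close>
  define \<iota> where "\<iota> u = (\<Oplus>\<^bsub>HL\<^esub>i\<in>{..<?n}. ptensor k H L (u i) (pr (\<epsilon> i)))" for u
  have N_carrier: "carrier ?N = {..<?n} \<rightarrow>\<^sub>E carrier H" by (simp add: power_bimodule_def)
  have pt_closed: "ptensor k H L x (pr (\<epsilon> i)) \<in> carrier HL" if "i < ?n" "x \<in> carrier H" for i x
    by (rule ptensor_closed[OF module_A module_L that(2) \<epsilon>pr[OF that(1)]])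
  have pt_lin: "(\<lambda>x. ptensor k H L x (pr (\<epsilon> i))) \<in> linear_map k H HL" if "i < ?n" for i
    by (rule ptensor_linear_left[OF module_A module_L linear_map_id \<epsilon>pr[OF that]])
  have \<iota>_closed: "\<iota> u \<in> carrier HL" if "u \<in> carrier ?N" for u
    unfolding \<iota>_def by (rule HL.M.finsum_closed) (use that pt_closed in \<open>auto simp: N_carrier\<close>)
  have \<iota>_add: "\<iota> (u \<oplus>\<^bsub>?N\<^esub> v) = \<iota> u \<oplus>\<^bsub>HL\<^esub> \<iota> v" if u: "u \<in> carrier ?N" and v: "v \<in> carrier ?N" for u v
  proof -
    have uv: "u i \<in> carrier H" "v i \<in> carrier H" if "i < ?n" for i
      using u v that by (auto simp: N_carrier)
    have "\<iota> (u \<oplus>\<^bsub>?N\<^esub> v) = (\<Oplus>\<^bsub>HL\<^esub>i\<in>{..<?n}. ptensor k H L (u i) (pr (\<epsilon> i)) \<oplus>\<^bsub>HL\<^esub> ptensor k H L (v i) (pr (\<epsilon> i)))"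
      unfolding \<iota>_def
      by (rule HL.M.finsum_cong') (auto simp: power_bimodule_def uv linear_map_add[OF pt_lin] pt_closed)
    also have "\<dots> = \<iota> u \<oplus>\<^bsub>HL\<^esub> \<iota> v"
      unfolding \<iota>_def by (rule HL.M.finsum_addf) (auto simp: pt_closed uv)
    finally show ?thesis .
  qed
  have \<iota>_c: "\<iota> (\<lambda>i\<in>{..<?n}. c i w) = w" if w: "w \<in> carrier HL" for w
  proof -
    have "(\<Oplus>\<^bsub>HL\<^esub>i\<in>{..<?n}. ptensor k H L (c i w) (pr (\<epsilon> i))) = w"
    proof (rule tensor_ext[OF module_A module_L _ linear_map_id _ w])
      show "(\<lambda>w. \<Oplus>\<^bsub>HL\<^esub>i\<in>{..<?n}. ptensor k H L (c i w) (pr (\<epsilon> i))) \<in> linear_map k HL HL"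
        by (rule linear_map_sum[OF module_HL]) (auto intro: linear_map_comp[OF c_lin pt_lin])
      fix x u assume x: "x \<in> carrier H" and u: "u \<in> carrier L"
      have px: "(\<lambda>u. ptensor k H L x u) \<in> linear_map k L HL"
        by (rule ptensor_linear_right[OF module_A module_L linear_map_id x])
      have scl: "\<phi> b u \<odot>\<^bsub>L\<^esub> pr b \<in> carrier L" if "b \<in> B" for b
        using that u by (simp add: module.smult_closed[OF module_L] \<phi>_closed pr_closed B_closed)
      have "(\<Oplus>\<^bsub>HL\<^esub>i\<in>{..<?n}. ptensor k H L (c i (ptensor k H L x u)) (pr (\<epsilon> i)))
          = (\<Oplus>\<^bsub>HL\<^esub>i\<in>{..<?n}. ptensor k H L x (\<phi> (\<epsilon> i) u \<odot>\<^bsub>L\<^esub> pr (\<epsilon> i)))"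
        by (rule HL.M.finsum_cong')
          (use x u linear_map_closed[OF px scl] in \<open>auto simp: c_pt linear_map_smult[OF pt_lin] linear_map_smult[OF px] \<phi>_closed \<epsilon>B \<epsilon>pr pt_closed\<close>)
      also have "\<dots> = (\<Oplus>\<^bsub>HL\<^esub>b\<in>\<epsilon> ` {..<?n}. ptensor k H L x (\<phi> b u \<odot>\<^bsub>L\<^esub> pr b))"
        by (rule HL.M.finsum_reindex[symmetric])
          (use \<epsilon> linear_map_closed[OF px scl] in \<open>auto simp: bij_betw_def\<close>)
      also have "\<dots> = ptensor k H L x (\<Oplus>\<^bsub>L\<^esub>b\<in>B. \<phi> b u \<odot>\<^bsub>L\<^esub> pr b)"
        using \<epsilon> linear_map_finsum[OF px module_L module_HL finite_B, of "\<lambda>b. \<phi> b u \<odot>\<^bsub>L\<^esub> pr b"] scl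
        by (simp add: bij_betw_def)
      finally show "(\<Oplus>\<^bsub>HL\<^esub>i\<in>{..<?n}. ptensor k H L (c i (ptensor k H L x u)) (pr (\<epsilon> i))) = ptensor k H L x u"
        using \<phi>_sum[OF u] by simp
    qed
    moreover have "\<iota> (\<lambda>i\<in>{..<?n}. c i w) = (\<Oplus>\<^bsub>HL\<^esub>i\<in>{..<?n}. ptensor k H L (c i w) (pr (\<epsilon> i)))"
      unfolding \<iota>_def by (rule HL.M.finsum_cong') (auto simp: pt_closed linear_map_closed[OF c_lin w])
    ultimately show ?thesis by simp
  qed
  have \<iota>_left: "\<iota> (lact ?N r u) = left_mult r (\<iota> u)" if r: "r \<in> carrier H" and u: "u \<in> carrier ?N" for r u
  proof -
    have ui: "u i \<in> carrier H" if "i < ?n" for i using u that by (auto simp: N_carrier)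
    have "\<iota> (lact ?N r u) = (\<Oplus>\<^bsub>HL\<^esub>i\<in>{..<?n}. left_mult r (ptensor k H L (u i) (pr (\<epsilon> i))))"
      unfolding \<iota>_def
      by (rule HL.M.finsum_cong') (auto simp: power_bimodule_def left_mult_ptensor r ui \<epsilon>pr pt_closed)
    also have "\<dots> = left_mult r (\<iota> u)"
      unfolding \<iota>_def by (rule linear_map_finsum[OF left_mult_linear[OF r] module_HL module_HL, symmetric]) (auto simp: pt_closed ui)
    finally show ?thesis .
  qed
  have \<iota>_right: "\<iota> (ract ?N u s) = right_mult s (\<iota> u)" if s: "s \<in> carrier H" and u: "u \<in> carrier ?N" for s u
  proof -
    have ui: "u i \<in> carrier H" if "i < ?n" for i using u that by (auto simp: N_carrier)
    have "\<iota> (ract ?N u s) = (\<Oplus>\<^bsub>HL\<^esub>i\<in>{..<?n}. right_mult s (ptensor k H L (u i) (pr (\<epsilon> i))))"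
      unfolding \<iota>_def
      by (rule HL.M.finsum_cong') (auto simp: power_bimodule_def right_mult_ptensor s ui \<epsilon>pr pt_closed)
    also have "\<dots> = right_mult s (\<iota> u)"
      unfolding \<iota>_def by (rule linear_map_finsum[OF right_mult_linear[OF s] module_HL module_HL, symmetric]) (auto simp: pt_closed ui)
    finally show ?thesis .
  qed
  have lactM: "lact ?M r t \<in> carrier RT \<and> \<Gamma> (lact ?M r t) = left_mult r (\<Gamma> t)" if "r \<in> R" and t: "t \<in> carrier RT" for r t
  proof -
    have r: "r \<in> carrier H" using R that(1) by blast
    note la = lact_tensor_bimodule[OF r]
    have "\<Gamma> (tensor_lift RT (\<lambda>x y. rpt (r \<star> x) y) t) = left_mult r (\<Gamma> t)"
      by (rule RT_ext[OF linear_map_comp[OF la(2) \<Gamma>] linear_map_comp[OF \<Gamma> left_mult_linear[OF r]] t])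
        (simp add: la(3) left[OF that(1)])
    then show ?thesis using la(1)[OF t] linear_map_closed[OF la(2) t] by simp
  qed
  have ractM: "ract ?M t s \<in> carrier RT \<and> \<Gamma> (ract ?M t s) = right_mult s (\<Gamma> t)" if "s \<in> S'" and t: "t \<in> carrier RT" for s t
  proof -
    have s: "s \<in> carrier H" using S that(1) by blast
    note ra = ract_tensor_bimodule[OF s]
    have "\<Gamma> (tensor_lift RT (\<lambda>x y. rpt x (y \<star> s)) t) = right_mult s (\<Gamma> t)"
      by (rule RT_ext[OF linear_map_comp[OF ra(2) \<Gamma>] linear_map_comp[OF \<Gamma> right_mult_linear[OF s]] t])
        (simp add: ra(3) right[OF that(1)])
    then show ?thesis using ra(1)[OF t] linear_map_closed[OF ra(2) t] by simp
  qed
  note \<Gamma>_closed = linear_map_closed[OF \<Gamma>]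
  note c_closed = linear_map_closed[OF c_lin]
  \<comment> \<open>As \<open>g\<close> is injective, the kernel of the retraction is that of
    \<open>\<iota>\<close>, which is stable because \<open>\<iota>\<close> commutes with both
    actions.\<close>
  have g_zero: "w = \<zero>\<^bsub>HL\<^esub>" if "w \<in> carrier HL" "g w = \<zero>\<^bsub>RT\<^esub>" for w
    using \<Gamma>g[OF that(1)] that(2) linear_map_zero[OF \<Gamma> module_RT module_HL] by simp
  let ?F = "\<lambda>t. \<lambda>i\<in>{..<?n}. c i (\<Gamma> t)"
  show ?thesis
  proof (rule iso_to_summandI[OF abelian_group_tensor_bimodule abelian_group_power_bimodule[OF A.ring_axioms],
        where F = ?F and \<rho> = "\<lambda>u. g (\<iota> u)"])
    show "?F t \<in> carrier ?N" if "t \<in> carrier ?M" for t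
      using that by (simp add: N_carrier tensor_bimodule_sel c_closed \<Gamma>_closed)
    show "?F (t \<oplus>\<^bsub>?M\<^esub> t') = ?F t \<oplus>\<^bsub>?N\<^esub> ?F t'" if "t \<in> carrier ?M" "t' \<in> carrier ?M" for t t'
      using that by (auto simp: power_bimodule_def tensor_bimodule_sel linear_map_add[OF \<Gamma>] linear_map_add[OF c_lin] \<Gamma>_closed)
    show "g (\<iota> u) \<in> carrier ?M" if "u \<in> carrier ?N" for u
      using linear_map_closed[OF g \<iota>_closed[OF that]] by (simp add: tensor_bimodule_sel)
    show "g (\<iota> (u \<oplus>\<^bsub>?N\<^esub> v)) = g (\<iota> u) \<oplus>\<^bsub>?M\<^esub> g (\<iota> v)" if "u \<in> carrier ?N" "v \<in> carrier ?N" for u v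
      using that by (simp add: \<iota>_add \<iota>_closed linear_map_add[OF g] tensor_bimodule_sel)
    show "g (\<iota> (?F t)) = t" if "t \<in> carrier ?M" for t
      using that \<iota>_c[OF \<Gamma>_closed] g\<Gamma> by (simp add: tensor_bimodule_sel)
    show "lact ?M r t \<in> carrier ?M \<and> ?F (lact ?M r t) = lact ?N r (?F t)" if "r \<in> R" "t \<in> carrier ?M" for r t
    proof -
      have "r \<in> carrier H" using R that(1) by blast
      with that lactM[OF that(1)] show ?thesis
        by (auto simp: tensor_bimodule_sel power_bimodule_def c_left \<Gamma>_closed)
    qed
    show "ract ?M t s \<in> carrier ?M \<and> ?F (ract ?M t s) = ract ?N (?F t) s" if "s \<in> S'" "t \<in> carrier ?M" for s t
    proof -
      have "s \<in> carrier H" using S that(1) by blast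
      with that ractM[OF that(1)] show ?thesis
        by (auto simp: tensor_bimodule_sel power_bimodule_def c_right \<Gamma>_closed)
    qed
    show "lact ?N r u \<in> carrier ?N \<and> g (\<iota> (lact ?N r u)) = \<zero>\<^bsub>?M\<^esub>"
      if "r \<in> R" "u \<in> carrier ?N" "g (\<iota> u) = \<zero>\<^bsub>?M\<^esub>" for r u
    proof
      have r: "r \<in> carrier H" using R that(1) by blast
      show "lact ?N r u \<in> carrier ?N" using that(2) r by (auto simp: power_bimodule_def)
      have "\<iota> u = \<zero>\<^bsub>HL\<^esub>" using g_zero[OF \<iota>_closed[OF that(2)]] that(3) by (simp add: tensor_bimodule_sel)
      then show "g (\<iota> (lact ?N r u)) = \<zero>\<^bsub>?M\<^esub>"
        using linear_map_zero[OF left_mult_linear[OF r] module_HL module_HL] linear_map_zero[OF g module_HL module_RT]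
        by (simp add: \<iota>_left[OF r that(2)] tensor_bimodule_sel)
    qed
    show "ract ?N u s \<in> carrier ?N \<and> g (\<iota> (ract ?N u s)) = \<zero>\<^bsub>?M\<^esub>"
      if "s \<in> S'" "u \<in> carrier ?N" "g (\<iota> u) = \<zero>\<^bsub>?M\<^esub>" for s u
    proof
      have s: "s \<in> carrier H" using S that(1) by blast
      show "ract ?N u s \<in> carrier ?N" using that(2) s by (auto simp: power_bimodule_def)
      have "\<iota> u = \<zero>\<^bsub>HL\<^esub>" using g_zero[OF \<iota>_closed[OF that(2)]] that(3) by (simp add: tensor_bimodule_sel)
      then show "g (\<iota> (ract ?N u s)) = \<zero>\<^bsub>?M\<^esub>"
        using linear_map_zero[OF right_mult_linear[OF s] module_HL module_HL] linear_map_zero[OF g module_HL module_RT]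
        by (simp add: \<iota>_right[OF s that(2)] tensor_bimodule_sel)
    qed
  qed
qed

lemma galois_extension_H: "galois_extension k L H coact K"
  unfolding galois_extension_def
  using comodule_algebra_H coinvariants_eq galois_map_bij by blast

text \<open>\<open>\<beta>\<close> respects left \<open>H\<close> and right \<open>K\<close>,
  \<open>\<beta>'\<close> left \<open>K\<close> and right \<open>H\<close>. Both embeddings use the
  same power \<open>card B\<close>, as \<open>depth_two\<close> asks for one number serving both
  bimodule structures.\<close>

lemma depth_two_H: "depth_two H K"
proof -
  have KH: "K \<subseteq> carrier H" using K_sub by blast
  have "iso_to_summand (carrier H) K (tensor_bimodule H K) (power_bimodule H (card B))"
  proof -
    obtain g where "g \<in> linear_map k HL RT" "\<And>t. t \<in> carrier RT \<Longrightarrow> g (\<beta> t) = t" "\<And>t. t \<in> carrier HL \<Longrightarrow> \<beta> (g t) = t"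
      by (rule \<beta>_bijective) blast
    then show ?thesis
      by (rule summand_of_power[OF subset_refl KH \<beta>_linear])
        (simp_all add: \<beta>_rpt gal_left gal_right K_sub)
  qed
  moreover have "iso_to_summand K (carrier H) (tensor_bimodule H K) (power_bimodule H (card B))"
  proof -
    obtain g where "g \<in> linear_map k HL RT" "\<And>t. t \<in> carrier RT \<Longrightarrow> g (\<beta>' t) = t" "\<And>t. t \<in> carrier HL \<Longrightarrow> \<beta>' (g t) = t"
      by (rule \<beta>'_bijective) blast
    then show ?thesis
      by (rule summand_of_power[OF KH subset_refl \<beta>'_linear])
        (simp_all add: \<beta>'_rpt gal'_left gal'_right K_sub)
  qed
  ultimately show ?thesis
    unfolding depth_two_def using A.ring_axioms K_subring B_nonempty by blast
qed

end

theorem proposition3p4: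
  fixes k :: "('k, 'x) ring_scheme" and H :: "('k, 'h, 'y) hopf_scheme" and K :: "'h set"
  assumes "field k"
    and "hopf_algebra k H"
    and "finite_dimensional k H"
    and "normal_hopf_subalgebra k H K"
  shows "galois_extension k (quotient_by k H K) H (quotient_coaction k H K) K \<and> depth_two H K"
proof -
  interpret normal_subalgebra k H K
    using assms(2,4) by (simp add: normal_subalgebra_def normal_subalgebra_axioms_def)
  obtain B co P where "split_subalgebra k H K B co P"
    using split_subalgebra_exists[OF assms(3)] by blast
  then interpret split_subalgebra k H K B co P .
  show ?thesis using galois_extension_H depth_two_H by blast
qed

end
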